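(* Let $n\ge2$ and let $\Omega\subset\mathbb{C}^n$ be a bounded convex domain with Dini-smooth boundary such that $(\Omega,K_\Omega)$ is Gromov hyperbolic, where $K_\Omega$ is the Kobayashi metric of $\Omega$. Then for every $\lambda\ge1$ there exist constants $c_1,c_2>0$ such that for all $x,y\in\Omega$ and every $\lambda$-quasi-geodesic $\gamma$ in the Kobayashi metric with end points $x$ and $y$, $$l_d(\gamma)\le c_1|x-y|^{c_2}.$$
   Context: Notation: $|\cdot|$ is the Euclidean norm on $\mathbb{C}^n$ and $l_d$ denotes Euclidean length of curves. Dini-smooth boundary: $\partial\Omega$ is $C^1$-smooth and each $p\in\partial\Omega$ has a neighborhood $U$ such that $\int_0^1\frac{\omega(t)}{t}\,dt<\infty$, where $\omega(t)=\sup\{|\mathbf{n}_x-\mathbf{n}_y|:|x-y|<t,\ x,y\in\partial\Omega\cap U\}$ and $\mathbf{n}$ is the inner unit normal to $\partial\Omega$. Kobayashi metric: $k_\Omega(x;v)=\inf\{|\xi|: f:\mathbb{D}\to\Omega \text{ holomorphic},\ f(0)=x,\ d(f)_0(\xi)=v\}$, and the Kobayashi distance $K_\Omega(x,y)$ is the infimum of $\int_a^b k_\Omega(\sigma(t);\sigma'(t))\,dt$ over absolutely continuous curves $\sigma:[a,b]\to\Omega$ joining $x$ to $y$. A $\lambda$-quasi-geodesic in the Kobayashi metric is a curve $\sigma:I\to\Omega$ ($I\subset\mathbb{R}$ an interval) with $\frac1\lambda|t-s|\le K_\Omega(\sigma(s),\sigma(t))\le\lambda|t-s|$ for all $s,t\in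 I$. Gromov hyperbolic: a proper geodesic metric space $(X,\rho)$ is Gromov hyperbolic if there is $\delta\ge0$ such that $(x|y)_o\ge\min\{(x|z)_o,(z|y)_o\}-\delta$ for all $o,x,y,z\in X$, where $(x|y)_o=\frac12(\rho(x,o)+\rho(o,y)-\rho(x,y))$. *)

theory Defs
  imports "HOL-Analysis.Analysis"
begin

section \<open>Dini-smooth boundaries\<close>

text \<open>A \<open>C\<^sup>1\<close> function \<open>r\<close> on the open set \<open>U\<close>, with nowhere vanishing gradient \<open>g\<close>, such that
  \<open>\<Omega>\<close> is the side \<open>r < 0\<close> of its zero set, which is the part of the boundary inside \<open>U\<close>.\<close>

definition C1_defining_function ::
  "'a::euclidean_space set \<Rightarrow> 'a set \<Rightarrow> ('a \<Rightarrow> real) \<Rightarrow> ('a \<Rightarrow> 'a) \<Rightarrow> bool" where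
  "C1_defining_function \<Omega> U r g \<longleftrightarrow>
     open U \<and>
     (\<forall>x\<in>U. (r has_derivative (\<lambda>h. g x \<bullet> h)) (at x) \<and> g x \<noteq> 0) \<and>
     continuous_on U g \<and>
     \<Omega> \<inter> U = {x \<in> U. r x < 0} \<and>
     frontier \<Omega> \<inter> U = {x \<in> U. r x = 0}"

definition C1_boundary :: "'a::euclidean_space set \<Rightarrow> bool" where
  "C1_boundary \<Omega> \<longleftrightarrow> (\<forall>p\<in>frontier \<Omega>. \<exists>U r g. p \<in> U \<and> C1_defining_function \<Omega> U r g)"

text \<open>If \<open>\<Omega>\<close> has a \<open>C\<^sup>1\<close> boundary and \<open>x\<close> is a boundary point, the vector below does not depend on
  the choice of the local defining function.  The minus sign makes it point into \<open>\<Omega>\<close>.\<close>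

definition inner_unit_normal :: "'a::euclidean_space set \<Rightarrow> 'a \<Rightarrow> 'a" where
  "inner_unit_normal \<Omega> x =
     (THE \<nu>. \<exists>U r g. x \<in> U \<and> C1_defining_function \<Omega> U r g \<and> \<nu> = - (g x /\<^sub>R norm (g x)))"

definition normal_modulus :: "'a::euclidean_space set \<Rightarrow> 'a set \<Rightarrow> real \<Rightarrow> real" where
  "normal_modulus \<Omega> U t =
     Sup {norm (inner_unit_normal \<Omega> x - inner_unit_normal \<Omega> y) | x y.
            x \<in> frontier \<Omega> \<inter> U \<and> y \<in> frontier \<Omega> \<inter> U \<and> norm (x - y) < t}"

definition Dini_smooth_boundary :: "'a::euclidean_space set \<Rightarrow> bool" where
  "Dini_smooth_boundary \<Omega> \<longleftrightarrow>
     C1_boundary \<Omega> \<and>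
     (\<forall>p\<in>frontier \<Omega>. \<exists>U. open U \<and> p \<in> U \<and>
        (\<integral>\<^sup>+t\<in>{0<..1}. ennreal (normal_modulus \<Omega> U t / t) \<partial>lborel) < \<infinity>)"

section \<open>The Kobayashi metric and distance\<close>

text \<open>\<open>\<complex>\<^sup>n\<close> is \<^typ>\<open>complex ^ 'n\<close>, whose \<^const>\<open>norm\<close> is the Euclidean norm.  A map into it is
  holomorphic when its components are, and its complex differential at \<open>0\<close> sends \<open>\<xi>\<close> to
  the vector with components \<open>\<xi> * f\<^sub>i'(0)\<close>.\<close>

definition kobayashi_metric :: "(complex ^ 'n) set \<Rightarrow> complex ^ 'n \<Rightarrow> complex ^ 'n \<Rightarrow> real" where
  "kobayashi_metric \<Omega> x v =
     Inf {norm \<xi> | \<xi>. \<exists>f :: complex \<Rightarrow> complex ^ 'n.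
            (\<forall>i. (\<lambda>z. f z $ i) holomorphic_on ball 0 1) \<and>
            f ` ball 0 1 \<subseteq> \<Omega> \<and> f 0 = x \<and>
            (\<chi> i. \<xi> * deriv (\<lambda>z. f z $ i) 0) = v}"

definition absolutely_continuous_curve ::
  "real \<Rightarrow> real \<Rightarrow> (real \<Rightarrow> 'a::metric_space) \<Rightarrow> bool" where
  "absolutely_continuous_curve a b \<sigma> \<longleftrightarrow>
     (\<forall>\<epsilon>>0. \<exists>\<delta>>0. \<forall>(N::nat) s t.
        (\<forall>i<N. a \<le> s i \<and> s i \<le> t i \<and> t i \<le> b) \<and>
        (\<forall>i<N. \<forall>j<N. i \<noteq> j \<longrightarrow> {s i<..<t i} \<inter> {s j<..<t j} = {}) \<and>
        (\<Sum>i<N. t i - s i) < \<delta> \<longrightarrow>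
        (\<Sum>i<N. dist (\<sigma> (s i)) (\<sigma> (t i))) < \<epsilon>)"

text \<open>An absolutely continuous curve is differentiable only almost everywhere;
  \<^const>\<open>vector_derivative\<close> is arbitrary on the remaining null set.\<close>

definition kobayashi_length ::
  "(complex ^ 'n) set \<Rightarrow> real \<Rightarrow> real \<Rightarrow> (real \<Rightarrow> complex ^ 'n) \<Rightarrow> ennreal" where
  "kobayashi_length \<Omega> a b \<sigma> =
     (\<integral>\<^sup>+t\<in>{a..b}. ennreal (kobayashi_metric \<Omega> (\<sigma> t) (vector_derivative \<sigma> (at t))) \<partial>lebesgue)"

text \<open>On a domain the infimum is finite, so \<^const>\<open>enn2real\<close> loses nothing there.\<close>

definition kobayashi_dist :: "(complex ^ 'n) set \<Rightarrow> complex ^ 'n \<Rightarrow> complex ^ 'n \<Rightarrow> real" where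
  "kobayashi_dist \<Omega> x y =
     enn2real (Inf {kobayashi_length \<Omega> a b \<sigma> | a b \<sigma>.
       a \<le> b \<and> absolutely_continuous_curve a b \<sigma> \<and> \<sigma> ` {a..b} \<subseteq> \<Omega> \<and> \<sigma> a = x \<and> \<sigma> b = y})"

definition kobayashi_quasi_geodesic ::
  "(complex ^ 'n) set \<Rightarrow> real \<Rightarrow> real set \<Rightarrow> (real \<Rightarrow> complex ^ 'n) \<Rightarrow> bool" where
  "kobayashi_quasi_geodesic \<Omega> L I \<sigma> \<longleftrightarrow>
     is_interval I \<and> continuous_on I \<sigma> \<and> \<sigma> ` I \<subseteq> \<Omega> \<and>
     (\<forall>s\<in>I. \<forall>t\<in>I. 1 / L * \<bar>t - s\<bar> \<le> kobayashi_dist \<Omega> (\<sigma> s) (\<sigma> t) \<and>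
                    kobayashi_dist \<Omega> (\<sigma> s) (\<sigma> t) \<le> L * \<bar>t - s\<bar>)"

section \<open>Euclidean length\<close>

text \<open>The length on \<open>[a, b]\<close> as supremum over partitions; it is \<open>\<infinity>\<close> for non-rectifiable curves.\<close>

definition curve_length :: "real \<Rightarrow> real \<Rightarrow> (real \<Rightarrow> 'a::metric_space) \<Rightarrow> ennreal" where
  "curve_length a b \<sigma> =
     Sup {(\<Sum>i<N. ennreal (dist (\<sigma> (t i)) (\<sigma> (t (Suc i))))) | (N::nat) t.
            mono_on {..N} t \<and> t ` {..N} \<subseteq> {a..b}}"

section \<open>Gromov hyperbolicity\<close>

definition proper_metric :: "'a set \<Rightarrow> ('a \<Rightarrow> 'a \<Rightarrow> real) \<Rightarrow> bool" where
  "proper_metric X \<rho> \<longleftrightarrow>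
     (\<forall>x\<in>X. \<forall>R. compactin (Metric_space.mtopology X \<rho>) (Metric_space.mcball X \<rho> x R))"

definition geodesic_metric :: "'a set \<Rightarrow> ('a \<Rightarrow> 'a \<Rightarrow> real) \<Rightarrow> bool" where
  "geodesic_metric X \<rho> \<longleftrightarrow>
     (\<forall>x\<in>X. \<forall>y\<in>X. \<exists>\<gamma> :: real \<Rightarrow> 'a.
        \<gamma> ` {0..\<rho> x y} \<subseteq> X \<and> \<gamma> 0 = x \<and> \<gamma> (\<rho> x y) = y \<and>
        (\<forall>s\<in>{0..\<rho> x y}. \<forall>t\<in>{0..\<rho> x y}. \<rho> (\<gamma> s) (\<gamma> t) = \<bar>s - t\<bar>))"

definition gromov_product :: "('a \<Rightarrow> 'a \<Rightarrow> real) \<Rightarrow> 'a \<Rightarrow> 'a \<Rightarrow> 'a \<Rightarrow> real" where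
  "gromov_product \<rho> w x y = (\<rho> x w + \<rho> w y - \<rho> x y) / 2"

definition gromov_hyperbolic :: "'a set \<Rightarrow> ('a \<Rightarrow> 'a \<Rightarrow> real) \<Rightarrow> bool" where
  "gromov_hyperbolic X \<rho> \<longleftrightarrow>
     Metric_space X \<rho> \<and> proper_metric X \<rho> \<and> geodesic_metric X \<rho> \<and>
     (\<exists>\<delta>\<ge>0. \<forall>w\<in>X. \<forall>x\<in>X. \<forall>y\<in>X. \<forall>z\<in>X.
        gromov_product \<rho> w x y \<ge> min (gromov_product \<rho> w x z) (gromov_product \<rho> w z y) - \<delta>)"

end

theory Submission
  imports Defs "HOL-Complex_Analysis.Conformal_Mappings"
begin

text \<open>Let \<open>K\<close> be the Kobayashi distance, \<open>bd\<close> the Euclidean distance to the complement of \<open>\<Omega>\<close> and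
  \<open>z0 \<in> \<Omega>\<close> a base point.  Comparison with affine discs and with half planes bounds \<open>K\<close> from above and
  below.  It follows that the segments towards \<open>z0\<close> are quasi-geodesics up to parametrisation, hence by
  hyperbolicity close to geodesics, and that \<open>bd x\<close> decays exponentially in \<open>K x z0\<close>.

  Hyperbolicity forces every affine disc in \<open>\<Omega>\<close> about a point \<open>x\<close> to have radius at most
  \<open>C * bd x powr \<epsilon>\<close>, so that \<open>norm (x - y) \<le> C * bd x powr \<epsilon> * K x y\<close> when \<open>K x y\<close> is bounded.
  Along a quasi-geodesic \<open>g\<close> from \<open>x\<close> to \<open>y\<close>, the distance \<open>K (g t) z0\<close> is at least the Gromov product
  of \<open>x\<close> and \<open>y\<close> at \<open>z0\<close> plus a multiple of \<open>\<bar>t - t0\<bar>\<close>.  Summing up, the length of \<open>g\<close> is exponentially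
  small in this Gromov product.  The latter is at least \<open>- ln (norm (x - y)) / 2\<close> up to a constant,
  because \<open>x\<close> and \<open>y\<close> can be moved towards \<open>z0\<close> by \<open>norm (x - y)\<close>, where they are at bounded distance.
  If \<open>norm (x - y)\<close> is small compared with \<open>bd x\<close>, then \<open>g\<close> is short and stays where \<open>bd\<close> is comparable
  with \<open>bd x\<close>.\<close>

section \<open>Absolutely continuous curves\<close>

text \<open>Competitors for the Kobayashi distance are merely absolutely continuous, so a lower
  bound for it requires differentiability almost everywhere and the fundamental theorem of calculus
  for such curves; both are derived from Vitali coverings.

  All lower bounds then have one source. If \<Omega> lies in
  \<open>{y. Re (cform a (y - q)) > 0}\<close>, the differential of half the logarithm of
  \<open>cform a (y - q)\<close> is bounded by the Kobayashi metric. The real part of this logarithm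
  controls how fast points approach the boundary; the full complex logarithm yields Euclidean
  bounds, because the point \<open>q\<close> where a complex line leaves \<Omega> may lie in any
  direction on that line.

  The exponent \<epsilon> comes from an iteration. Moving \<open>z\<close> to
  \<open>ray z (A * bd z)\<close> at least doubles \<open>bd\<close>, multiplies it by at most a
  constant \<open>B\<close>, and enlarges affine discs by a factor \<open>1 + \<eta>\<close>. As no
  disc exceeds the diameter, radii are bounded by the power \<open>ln (1 + \<eta>) / ln B\<close> of
  \<open>bd z\<close>, capped at 1.\<close>

definition interval_family :: "real \<Rightarrow> real \<Rightarrow> 'i set \<Rightarrow> ('i \<Rightarrow> real) \<Rightarrow> ('i \<Rightarrow> real) \<Rightarrow> bool" where
  "interval_family a b I s t \<longleftrightarrow> finite I \<and> (\<forall>i\<in>I. a \<le> s i \<and> s i \<le> t i \<and> t i \<le> b) \<and>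
     (\<forall>i\<in>I. \<forall>j\<in>I. i \<noteq> j \<longrightarrow> {s i<..<t i} \<inter> {s j<..<t j} = {})"

text \<open>The definition numbers its intervals. With an arbitrary finite index set, a division, or
  a set of pairs of an interval and a piece of it, can index itself.\<close>

lemma absolutely_continuous_curve_family:
  assumes ac: "absolutely_continuous_curve a b f" and "\<epsilon> > 0"
  shows "\<exists>\<delta>>0. \<forall>(I :: 'i set) s t. interval_family a b I s t \<and>
       (\<Sum>i\<in>I. t i - s i) < \<delta> \<longrightarrow> (\<Sum>i\<in>I. dist (f (s i)) (f (t i))) < \<epsilon>"
proof -
  obtain \<delta> where "\<delta> > 0" and \<delta>: "\<And>(N::nat) s t. (\<forall>i<N. a \<le> s i \<and> s i \<le> t i \<and> t i \<le> b) \<and>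
        (\<forall>i<N. \<forall>j<N. i \<noteq> j \<longrightarrow> {s i<..<t i} \<inter> {s j<..<t j} = {}) \<and>
        (\<Sum>i<N. t i - s i) < \<delta> \<Longrightarrow> (\<Sum>i<N. dist (f (s i)) (f (t i))) < \<epsilon>"
    using ac \<open>\<epsilon> > 0\<close> unfolding absolutely_continuous_curve_def by blast
  show ?thesis
  proof (intro exI[of _ \<delta>] conjI allI impI \<open>\<delta> > 0\<close>, elim conjE)
    fix I :: "'i set" and s t :: "'i \<Rightarrow> real"
    assume "interval_family a b I s t" "(\<Sum>i\<in>I. t i - s i) < \<delta>"
    then have I: "finite I" "\<forall>i\<in>I. a \<le> s i \<and> s i \<le> t i \<and> t i \<le> b"
       "\<forall>i\<in>I. \<forall>j\<in>I. i \<noteq> j \<longrightarrow> {s i<..<t i} \<inter> {s j<..<t j} = {}"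
       "(\<Sum>i\<in>I. t i - s i) < \<delta>" by (simp_all add: interval_family_def)
    obtain h where h: "bij_betw h {..<card I} I"
      using ex_bij_betw_nat_finite[OF I(1)] by (auto simp: atLeast0LessThan)
    have hI: "h i \<in> I" if "i < card I" for i
      using h that by (auto simp: bij_betw_def)
    have "(\<Sum>i<card I. dist (f (s (h i))) (f (t (h i)))) < \<epsilon>"
    proof (rule \<delta>, intro conjI allI impI)
      fix i j assume ij: "i < card I" "j < card I" "i \<noteq> j"
      then have "h i \<noteq> h j"
        using h by (auto simp: bij_betw_def inj_on_def)
      then show "{s (h i)<..<t (h i)} \<inter> {s (h j)<..<t (h j)} = {}"
        using I(3) hI[OF ij(1)] hI[OF ij(2)] by blast
    next
      have "(\<Sum>i<card I. t (h i) - s (h i)) = (\<Sum>i\<in>I. t i - s i)"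
        by (rule sum.reindex_bij_betw[OF h])
      then show "(\<Sum>i<card I. t (h i) - s (h i)) < \<delta>"
        using I(4) by simp
    qed (use I(2) hI in auto)
    also have "(\<Sum>i<card I. dist (f (s (h i))) (f (t (h i)))) = (\<Sum>i\<in>I. dist (f (s i)) (f (t i)))"
      by (rule sum.reindex_bij_betw[OF h])
    finally show "(\<Sum>i\<in>I. dist (f (s i)) (f (t i))) < \<epsilon>" .
  qed
qed

lemma absolutely_continuous_curve_imp_continuous_on:
  assumes ac: "absolutely_continuous_curve a b f"
  shows "continuous_on {a..b} f"
proof (rule continuous_on_iff[THEN iffD2], intro ballI allI impI)
  fix x e :: real assume x: "x \<in> {a..b}" and "e > 0"
  obtain \<delta> where "\<delta> > 0" and \<delta>: "\<forall>(N::nat) s t. (\<forall>i<N. a \<le> s i \<and> s i \<le> t i \<and> t i \<le> b) \<and>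
        (\<forall>i<N. \<forall>j<N. i \<noteq> j \<longrightarrow> {s i<..<t i} \<inter> {s j<..<t j} = {}) \<and>
        (\<Sum>i<N. t i - s i) < \<delta> \<longrightarrow> (\<Sum>i<N. dist (f (s i)) (f (t i))) < e"
    using ac \<open>e > 0\<close> unfolding absolutely_continuous_curve_def by blast
  show "\<exists>d>0. \<forall>x'\<in>{a..b}. dist x' x < d \<longrightarrow> dist (f x') (f x) < e"
  proof (intro exI conjI ballI impI)
    fix y assume y: "y \<in> {a..b}" "dist y x < \<delta>"
    show "dist (f y) (f x) < e"
      using \<delta>[rule_format, of 1 "\<lambda>_. min x y" "\<lambda>_. max x y"] x y
      by (cases "x \<le> y") (auto simp: dist_real_def dist_commute)
  qed fact
qed

lemma absolutely_continuous_curve_Lipschitz: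
  assumes ac: "absolutely_continuous_curve a b f" and "c \<ge> 0"
    and lip: "\<And>s t. \<lbrakk>s \<in> {a..b}; t \<in> {a..b}\<rbrakk> \<Longrightarrow> dist (g s) (g t) \<le> c * dist (f s) (f t)"
  shows "absolutely_continuous_curve a b g"
  unfolding absolutely_continuous_curve_def
proof (intro allI impI)
  fix \<epsilon> :: real assume "\<epsilon> > 0"
  \<comment> \<open>\<open>c + 1\<close> keeps the quotient meaningful for
    \<open>c = 0\<close>.\<close>
  then have "\<epsilon> / (c + 1) > 0" using \<open>c \<ge> 0\<close> by simp
  then obtain \<delta> where "\<delta> > 0" and \<delta>: "\<forall>(N::nat) s t. (\<forall>i<N. a \<le> s i \<and> s i \<le> t i \<and> t i \<le> b) \<and>
        (\<forall>i<N. \<forall>j<N. i \<noteq> j \<longrightarrow> {s i<..<t i} \<inter> {s j<..<t j} = {}) \<and>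
        (\<Sum>i<N. t i - s i) < \<delta> \<longrightarrow> (\<Sum>i<N. dist (f (s i)) (f (t i))) < \<epsilon> / (c + 1)"
    using ac unfolding absolutely_continuous_curve_def by blast
  show "\<exists>\<delta>>0. \<forall>(N::nat) s t. (\<forall>i<N. a \<le> s i \<and> s i \<le> t i \<and> t i \<le> b) \<and>
        (\<forall>i<N. \<forall>j<N. i \<noteq> j \<longrightarrow> {s i<..<t i} \<inter> {s j<..<t j} = {}) \<and>
        (\<Sum>i<N. t i - s i) < \<delta> \<longrightarrow> (\<Sum>i<N. dist (g (s i)) (g (t i))) < \<epsilon>"
  proof (intro exI[of _ \<delta>] conjI allI impI)
    fix N :: nat and s t
    assume *: "(\<forall>i<N. a \<le> s i \<and> s i \<le> t i \<and> t i \<le> b) \<and>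
        (\<forall>i<N. \<forall>j<N. i \<noteq> j \<longrightarrow> {s i<..<t i} \<inter> {s j<..<t j} = {}) \<and>
        (\<Sum>i<N. t i - s i) < \<delta>"
    have "(\<Sum>i<N. dist (g (s i)) (g (t i))) \<le> (\<Sum>i<N. (c + 1) * dist (f (s i)) (f (t i)))"
    proof (rule sum_mono)
      fix i assume "i \<in> {..<N}"
      then have "s i \<in> {a..b}" "t i \<in> {a..b}" using * by (auto intro: order_trans)
      then have "dist (g (s i)) (g (t i)) \<le> c * dist (f (s i)) (f (t i))" by (rule lip)
      also have "\<dots> \<le> (c + 1) * dist (f (s i)) (f (t i))" by (simp add: mult_right_mono)
      finally show "dist (g (s i)) (g (t i)) \<le> (c + 1) * dist (f (s i)) (f (t i))" .
    qed
    also have "\<dots> = (c + 1) * (\<Sum>i<N. dist (f (s i)) (f (t i)))"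
      by (simp add: sum_distrib_left)
    also have "\<dots> < (c + 1) * (\<epsilon> / (c + 1))"
      by (intro mult_strict_left_mono) (use \<delta>[rule_format, OF *] \<open>c \<ge> 0\<close> in auto)
    finally show "(\<Sum>i<N. dist (g (s i)) (g (t i))) < \<epsilon>" using \<open>c \<ge> 0\<close> by simp
  qed fact
qed

section \<open>Divisions and Vitali coverings by intervals\<close>

lemma interval_division_elem:
  fixes k :: "real set"
  assumes "\<D> division_of S" "k \<in> \<D>"
  obtains u v where "k = {u..v}" "u \<le> v" "Inf k = u" "Sup k = v"
proof -
  obtain u v where "k = cbox u v" "k \<noteq> {}"
    using division_ofD(3,4)[OF assms(1)] assms(2) by metis
  then show thesis using that[of u v] by auto
qed

text \<open>The increment of \<open>f\<close> is an operative function of the interval once the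
  empty interval gets the value 0; this is telescoping without tags.\<close>

lemma additive_division_1:
  fixes f :: "real \<Rightarrow> 'a::real_normed_vector"
  assumes "a \<le> b" and d: "\<D> division_of {a..b}"
  shows "(\<Sum>k\<in>\<D>. f (Sup k) - f (Inf k)) = f b - f a"
proof -
  let ?f = "\<lambda>K::real set. if K = {} then 0 else f (interval_upperbound K) - f (interval_lowerbound K)"
  interpret operative_real plus 0 ?f
    rewrites "comm_monoid_set.F (+) 0 = sum"
    by standard[1] (auto simp add: sum_def)
  have "sum ?f \<D> = ?f (cbox a b)"
    using division[OF d] by simp
  also have "\<dots> = f b - f a" using assms(1) by simp
  also have "sum ?f \<D> = (\<Sum>k\<in>\<D>. f (Sup k) - f (Inf k))"
  proof (rule sum.cong[OF refl])
    fix k assume "k \<in> \<D>"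
    then obtain u v where "k = {u..v}" "u \<le> v" by (rule interval_division_elem[OF d])
    then show "?f k = f (Sup k) - f (Inf k)" by simp
  qed
  finally show ?thesis .
qed

text \<open>Intervals are balls about their midpoints, so Vitali's theorem gives countably many
  disjoint ones covering almost all of \<open>E\<close>, and finitely many of them exhaust the
  measure up to \<open>e\<close>. They fit into \<open>U\<close> because \<open>P\<close> holds for
  arbitrarily short intervals about each point.\<close>

lemma Vitali_finite_interval_cover:
  fixes E U :: "real set"
  assumes U: "open U" "E \<subseteq> U" "U \<subseteq> {a..b}" and E: "E \<in> sets lebesgue" and "e > 0"
    and P: "\<And>t d. \<lbrakk>t \<in> E; d > 0\<rbrakk> \<Longrightarrow> \<exists>u v. u < v \<and> u \<le> t \<and> t \<le> v \<and> v - u < d \<and> P u v"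
  shows "\<exists>\<D>. \<D> division_of \<Union>\<D> \<and> \<Union>\<D> \<subseteq> U \<and>
    (\<forall>k\<in>\<D>. \<exists>u v. u < v \<and> k = {u..v} \<and> P u v) \<and> measure lebesgue E - e < (\<Sum>k\<in>\<D>. Sup k - Inf k)"
proof -
  define K where "K = {(u, v). u < v \<and> {u..v} \<subseteq> U \<and> P u v}"
  have cb: "cball ((fst i + snd i) / 2) ((snd i - fst i) / 2) = {fst i..snd i}" for i :: "real \<times> real"
    by (auto simp: cball_def dist_real_def abs_real_def field_simps split: if_splits)
  let ?c = "\<lambda>i :: real \<times> real. (fst i + snd i) / 2" and ?r = "\<lambda>i :: real \<times> real. (snd i - fst i) / 2"
  have V: "\<exists>i. i \<in> K \<and> t \<in> cball (?c i) (?r i) \<and> ?r i < d" if t: "t \<in> E" "0 < d" for t d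
  proof -
    obtain r where r: "r > 0" "ball t r \<subseteq> U"
      using U t by (meson open_contains_ball subsetD)
    obtain u v where uv: "u < v" "u \<le> t" "t \<le> v" "v - u < min r d" "P u v"
      using P[OF t(1), of "min r d"] t r by auto
    have "{u..v} \<subseteq> ball t r" using uv by (auto simp: dist_real_def)
    then have "(u, v) \<in> K" using uv r by (auto simp: K_def)
    then show ?thesis
      unfolding cb using uv t by (intro exI[of _ "(u, v)"]) auto
  qed
  have K: "\<And>i. i \<in> K \<Longrightarrow> 0 < ?r i"
    by (auto simp: K_def)
  obtain C where C: "countable C" "C \<subseteq> K"
    "pairwise (\<lambda>i j. disjnt {fst i..snd i} {fst j..snd j}) C"
    "negligible (E - (\<Union>i\<in>C. {fst i..snd i}))"
    by (rule Vitali_covering_theorem_cballs[of K ?r E ?c, OF K V, unfolded cb])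
  define \<C> where "\<C> = (\<lambda>i. {fst i..snd i}) ` C"
  have KD: "fst i < snd i" "{fst i..snd i} \<subseteq> U" "P (fst i) (snd i)" if "i \<in> C" for i
    using subsetD[OF C(2) that] by (auto simp: K_def case_prod_unfold)
  have \<C>U: "\<Union>\<C> \<subseteq> U" using KD(2) unfolding \<C>_def by blast
  have Ulm: "U \<in> lmeasurable"
    using U by (intro bounded_set_imp_lmeasurable) (auto intro: bounded_subset[OF bounded_closed_interval])
  have \<C>lm: "\<Union>\<C> \<in> sets lebesgue"
    unfolding \<C>_def using C(1) by (intro sets.countable_Union) auto
  obtain \<D> where D: "\<D> \<subseteq> \<C>" "finite \<D>" "measure lebesgue (\<Union>\<C>) - e < measure lebesgue (\<Union>\<D>)"
  proof (rule measure_countable_Union_approachable[of \<C> e "measure lebesgue U"])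
    fix D assume "D \<subseteq> \<C>" "finite D"
    then show "measure lebesgue (\<Union>D) \<le> measure lebesgue U"
      using \<C>U Ulm by (intro measure_mono_fmeasurable sets.finite_Union) (auto simp: \<C>_def)
  qed (use C(1) \<open>e > 0\<close> in \<open>auto simp: \<C>_def\<close>)
  have elem: "\<exists>u v. u < v \<and> k = {u..v} \<and> P u v" if "k \<in> \<D>" for k
    using that D(1) KD unfolding \<C>_def by blast
  have div: "\<D> division_of \<Union>\<D>"
  proof (rule division_ofI)
    fix k assume "k \<in> \<D>"
    then obtain u v where "u < v" "k = {u..v}" using elem by blast
    then show "k \<noteq> {}" "\<exists>a b. k = cbox a b" by auto
  next
    fix k l assume "k \<in> \<D>" "l \<in> \<D>" "k \<noteq> l"
    then obtain i j where "i \<in> C" "j \<in> C" "k = {fst i..snd i}" "l = {fst j..snd j}"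
      using D(1) unfolding \<C>_def by blast
    with C(3) \<open>k \<noteq> l\<close> have "k \<inter> l = {}"
      by (auto simp: pairwise_def disjnt_def)
    then show "interior k \<inter> interior l = {}"
      using interior_subset by blast
  qed (use D in auto)
  have "measure lebesgue E \<le> measure lebesgue (\<Union>\<C> \<union> (E - \<Union>\<C>))"
  proof (rule measure_mono_fmeasurable)
    have "\<Union>\<C> \<in> lmeasurable" using \<C>U \<C>lm Ulm by (rule fmeasurableI2[rotated])
    moreover have "E - \<Union>\<C> \<in> lmeasurable"
      using C(4) by (simp add: \<C>_def negligible_imp_measurable)
    ultimately show "\<Union>\<C> \<union> (E - \<Union>\<C>) \<in> lmeasurable" by blast
  qed (use E in auto)
  also have "\<dots> \<le> measure lebesgue (\<Union>\<C>) + measure lebesgue (E - \<Union>\<C>)"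
    using E \<C>lm by (intro measure_Un_le) auto
  also have "measure lebesgue (E - \<Union>\<C>) = 0"
    using C(4) by (simp add: \<C>_def negligible_imp_measure0)
  finally have "measure lebesgue E - e < measure lebesgue (\<Union>\<D>)" using D(3) by simp
  also have "\<dots> \<le> (\<Sum>k\<in>\<D>. measure lebesgue k)"
    using measure_UNION_le[of \<D> "\<lambda>k. k" lebesgue] D by (force simp: \<C>_def)
  also have "\<dots> = (\<Sum>k\<in>\<D>. (Sup k - Inf k))"
    by (intro sum.cong refl) (use elem in fastforce)
  finally show ?thesis
    using div elem Union_mono[OF D(1)] \<C>U by (intro exI[of _ \<D>]) auto
qed


text \<open>Almost all of \<open>E\<close> is covered by disjoint intervals of slope at most \<open>p\<close>, and these in turn are
  filled, up to gaps of small total length, by intervals of slope at least \<open>q\<close>.  By absolute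
  continuity the gaps contribute little to the increments, which contradicts \<open>p < q\<close>.\<close>

lemma absolutely_continuous_increments_measure_zero:
  fixes f :: "real \<Rightarrow> real"
  assumes ac: "absolutely_continuous_curve a b f" and E: "E \<in> sets lebesgue" "E \<subseteq> {a<..<b}"
    and "p < q"
    and lo: "\<And>t d. \<lbrakk>t \<in> E; d > 0\<rbrakk> \<Longrightarrow> \<exists>u v. u < v \<and> u \<le> t \<and> t \<le> v \<and> v - u < d \<and> f v - f u \<le> p * (v - u)"
    and hi: "\<And>t d. \<lbrakk>t \<in> E; d > 0\<rbrakk> \<Longrightarrow> \<exists>u v. u < v \<and> u \<le> t \<and> t \<le> v \<and> v - u < d \<and> f v - f u \<ge> q * (v - u)"
  shows "measure lebesgue E = 0"
proof (rule ccontr)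
  define s where "s = measure lebesgue E"
  assume "measure lebesgue E \<noteq> 0"
  then have "s > 0" by (simp add: s_def zero_less_measure_iff)
  have Elm: "E \<in> lmeasurable"
    by (rule fmeasurableI2[of "{a<..<b}"]) (use E in auto)
  \<comment> \<open>On a total length of more than \<open>s / 2\<close> the slopes differ by
    \<open>q - p\<close>. This has to outweigh two errors of size \<epsilon>: the increments over
    the gaps, and \<open>q\<close> times the length of the gaps.\<close>
  define \<epsilon> where "\<epsilon> = (q - p) * s / 4"
  have "\<epsilon> > 0" using \<open>s > 0\<close> \<open>p < q\<close> by (simp add: \<epsilon>_def)
  obtain \<delta> where "\<delta> > 0"
    and \<delta>: "\<forall>(I :: (real set \<times> real set) set) s t. interval_family a b I s t \<and>
       (\<Sum>i\<in>I. t i - s i) < \<delta> \<longrightarrow> (\<Sum>i\<in>I. dist (f (s i)) (f (t i))) < \<epsilon>"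
    using absolutely_continuous_curve_family[OF ac \<open>\<epsilon> > 0\<close>] by blast
  \<comment> \<open>The gaps will have total length at most \<open>2 * \<eta>\<close>, which must be
    below \<delta> and, multiplied by \<open>\<bar>q\<bar>\<close>, at most \<epsilon>.\<close>
  define \<eta> where "\<eta> = min (\<delta> / 8) (min (s / 4) (\<epsilon> / (4 * (\<bar>q\<bar> + 1))))"
  have "\<eta> > 0" using \<open>\<delta> > 0\<close> \<open>s > 0\<close> \<open>\<epsilon> > 0\<close> by (simp add: \<eta>_def)
  have \<eta>1: "4 * \<eta> < \<delta>" using \<open>\<delta> > 0\<close> by (simp add: \<eta>_def min_def)
  have \<eta>2: "\<eta> \<le> s / 4" unfolding \<eta>_def by linarith
  have "\<bar>q\<bar> * (4 * \<eta>) \<le> (\<bar>q\<bar> + 1) * (4 * \<eta>)" using \<open>\<eta> > 0\<close> by (intro mult_right_mono) auto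
  also have "\<dots> \<le> (\<bar>q\<bar> + 1) * (4 * (\<epsilon> / (4 * (\<bar>q\<bar> + 1))))"
    by (intro mult_left_mono) (auto simp: \<eta>_def)
  also have "\<dots> = \<epsilon>" by (simp add: field_simps)
  finally have \<eta>3: "\<bar>q\<bar> * (4 * \<eta>) \<le> \<epsilon>" .
  obtain T where T: "open T" "E \<subseteq> T" "T - E \<in> lmeasurable" "emeasure lebesgue (T - E) < ennreal \<eta>"
    using sets_lebesgue_outer_open[OF E(1) \<open>\<eta> > 0\<close>] by blast
  define U where "U = T \<inter> {a<..<b}"
  have U: "open U" "E \<subseteq> U" "U \<subseteq> {a..b}" "U \<subseteq> {a<..<b}" using T E by (auto simp: U_def)
  have Ulm: "U \<in> lmeasurable"
    using U by (intro bounded_set_imp_lmeasurable) (auto intro: bounded_subset[OF bounded_closed_interval])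
  have "measure lebesgue (U - E) \<le> measure lebesgue (T - E)"
    using T Ulm Elm by (intro measure_mono_fmeasurable) (auto simp: U_def)
  also have "\<dots> < \<eta>"
    using T(3,4) \<open>\<eta> > 0\<close> by (simp add: emeasure_eq_measure2 ennreal_less_iff)
  finally have UE: "measure lebesgue (U - E) < \<eta>" .
  have "measure lebesgue (U - E) = measure lebesgue U - s"
    unfolding s_def using U Ulm Elm by (intro measurable_measure_Diff) auto
  with UE have Us: "measure lebesgue U < s + \<eta>" by simp
  obtain D where D: "D division_of \<Union>D" "\<Union>D \<subseteq> U"
    "\<And>k. k \<in> D \<Longrightarrow> \<exists>u v. u < v \<and> k = {u..v} \<and> f v - f u \<le> p * (v - u)"
    "measure lebesgue E - \<eta> < (\<Sum>k\<in>D. (Sup k - Inf k))"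
    using Vitali_finite_interval_cover[OF U(1-3) E(1) \<open>\<eta> > 0\<close> lo] by auto
  have "finite D" using D(1) by blast
  \<comment> \<open>An error of \<open>\<eta> / n\<close> in each interval of \<open>D\<close> adds
    up to at most \<eta>; the summand 1 covers an empty \<open>D\<close>.\<close>
  define n where "n = real (card D) + 1"
  have "n > 0" by (simp add: n_def)
  \<comment> \<open>\<open>Q\<close> divides the interval \<open>k\<close> of slope at most
    \<open>p\<close>. The pieces in \<open>G\<close> have slope at least \<open>q\<close> and nearly
    cover \<open>E \<inter> k\<close>; those in \<open>Q - G\<close> are the gaps.\<close>
  define R where "R k Q G \<longleftrightarrow> Q division_of k \<and> G \<subseteq> Q \<and>
      (\<forall>j\<in>G. f (Sup j) - f (Inf j) \<ge> q * (Sup j - Inf j)) \<and>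
      measure lebesgue (E \<inter> k) - \<eta> / n < (\<Sum>j\<in>G. Sup j - Inf j)" for k Q G
  have "\<exists>Q G. R k Q G" if k: "k \<in> D" for k
  proof -
    obtain u v where uv: "u < v" "k = {u..v}" using D(3)[OF k] by blast
    have meas: "measure lebesgue (E \<inter> {u<..<v}) = measure lebesgue (E \<inter> k)"
    proof (rule measure_eq_AE)
      have "AE x in lebesgue. x \<noteq> u \<and> x \<noteq> v"
        by (intro AE_conjI AE_completion AE_lborel_singleton)
      then show "AE x in lebesgue. x \<in> E \<inter> {u<..<v} \<longleftrightarrow> x \<in> E \<inter> k"
        by eventually_elim (auto simp: uv)
    qed (use E uv in auto)
    have "\<exists>G. G division_of \<Union>G \<and> \<Union>G \<subseteq> {u<..<v} \<and>
      (\<forall>k\<in>G. \<exists>u v. u < v \<and> k = {u..v} \<and> f v - f u \<ge> q * (v - u)) \<and>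
      measure lebesgue (E \<inter> {u<..<v}) - \<eta> / n < (\<Sum>k\<in>G. Sup k - Inf k)"
    proof (rule Vitali_finite_interval_cover[of "{u<..<v}" "E \<inter> {u<..<v}" u v "\<eta> / n"
            "\<lambda>u v. f v - f u \<ge> q * (v - u)"])
      fix t d :: real assume "t \<in> E \<inter> {u<..<v}" "0 < d"
      then show "\<exists>u v. u < v \<and> u \<le> t \<and> t \<le> v \<and> v - u < d \<and> q * (v - u) \<le> f v - f u"
        using hi by blast
    qed (use E \<open>\<eta> > 0\<close> \<open>n > 0\<close> in auto)
    then obtain G where G: "G division_of \<Union>G" "\<Union>G \<subseteq> {u<..<v}"
      "\<And>k. k \<in> G \<Longrightarrow> \<exists>u v. u < v \<and> k = {u..v} \<and> f v - f u \<ge> q * (v - u)"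
      "measure lebesgue (E \<inter> {u<..<v}) - \<eta> / n < (\<Sum>k\<in>G. Sup k - Inf k)"
      by auto
    have "\<Union>G \<subseteq> cbox u v" using G(2) by auto
    then obtain Q where Q: "G \<subseteq> Q" "Q division_of cbox u v"
      using partial_division_extend_interval[OF G(1)] by metis
    have "f (Sup j) - f (Inf j) \<ge> q * (Sup j - Inf j)" if j: "j \<in> G" for j
      using G(3)[OF j] by auto
    with Q G(4) have "R k Q G"
      unfolding R_def meas by (simp add: uv)
    then show ?thesis by blast
  qed
  then have "\<forall>k\<in>D. \<exists>QG. R k (fst QG) (snd QG)" by simp
  from bchoice[OF this] obtain QG where QG: "\<forall>k\<in>D. R k (fst (QG k)) (snd (QG k))" ..
  define Q where "Q k = fst (QG k)" for k
  define G where "G k = snd (QG k)" for k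
  have R: "R k (Q k) (G k)" if "k \<in> D" for k
    using QG that by (simp add: Q_def G_def)
  have Q: "finite (Q k)" "Q k division_of k" if "k \<in> D" for k
    using R[OF that] unfolding R_def by auto
  have G: "G k \<subseteq> Q k" "\<And>j. j \<in> G k \<Longrightarrow> f (Sup j) - f (Inf j) \<ge> q * (Sup j - Inf j)"
      "measure lebesgue (E \<inter> k) - \<eta> / n < (\<Sum>j\<in>G k. Sup j - Inf j)" if "k \<in> D" for k
    using R[OF that] unfolding R_def by auto
  define S1 where "S1 = (\<Sum>k\<in>D. Sup k - Inf k)"
  define S2 where "S2 = (\<Sum>k\<in>D. \<Sum>j\<in>G k. Sup j - Inf j)"
  \<comment> \<open>Gaps are paired with the interval that contains them, so that sums over
    \<open>I\<close> are double sums whether or not the sets \<open>Q k\<close> are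
    disjoint.\<close>
  define I where "I = Sigma D (\<lambda>k. Q k - G k)"
  have kQ: "(\<Sum>j\<in>Q k. g (Sup j) - g (Inf j)) = g (Sup k) - g (Inf k)" if k: "k \<in> D"
    for k and g :: "real \<Rightarrow> real"
  proof -
    obtain u v where uv: "u < v" "k = {u..v}" using D(3)[OF k] by blast
    then show ?thesis using additive_division_1[of u v "Q k" g] Q(2)[OF k] by simp
  qed
  \<comment> \<open>Used twice: with the identity for lengths and with \<open>f\<close> for
    increments.\<close>
  have split: "(\<Sum>k\<in>D. g (Sup k) - g (Inf k)) =
      (\<Sum>k\<in>D. \<Sum>j\<in>G k. g (Sup j) - g (Inf j)) + (\<Sum>i\<in>I. g (Sup (snd i)) - g (Inf (snd i)))"
    for g :: "real \<Rightarrow> real"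
  proof -
    have "(\<Sum>k\<in>D. g (Sup k) - g (Inf k)) = (\<Sum>k\<in>D. \<Sum>j\<in>Q k. g (Sup j) - g (Inf j))"
      by (intro sum.cong refl kQ[symmetric])
    also have "\<dots> = (\<Sum>k\<in>D. (\<Sum>j\<in>Q k - G k. g (Sup j) - g (Inf j)) + (\<Sum>j\<in>G k. g (Sup j) - g (Inf j)))"
      by (intro sum.cong refl sum.subset_diff G Q)
    also have "\<dots> = (\<Sum>k\<in>D. \<Sum>j\<in>Q k - G k. g (Sup j) - g (Inf j)) + (\<Sum>k\<in>D. \<Sum>j\<in>G k. g (Sup j) - g (Inf j))"
      by (rule sum.distrib)
    also have "(\<Sum>k\<in>D. \<Sum>j\<in>Q k - G k. g (Sup j) - g (Inf j)) = (\<Sum>i\<in>I. g (Sup (snd i)) - g (Inf (snd i)))"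
      unfolding I_def using \<open>finite D\<close> Q(1) by (subst sum.Sigma) (auto simp: case_prod_unfold)
    finally show ?thesis by simp
  qed
  have "(\<Union>D) \<in> lmeasurable"
    using D(1) by (rule lmeasurable_division)
  have S1m: "S1 = measure lebesgue (\<Union>D)"
  proof -
    have "Sup k - Inf k = measure lebesgue k" if "k \<in> D" for k
      using D(3)[OF that] by auto
    then have "S1 = (\<Sum>k\<in>D. measure lebesgue k)"
      unfolding S1_def by (intro sum.cong refl)
    then show ?thesis using content_division[OF D(1)] by simp
  qed
  have S1_le: "S1 \<le> measure lebesgue U"
    unfolding S1m using D(2) Ulm \<open>\<Union>D \<in> lmeasurable\<close> by (intro measure_mono_fmeasurable) auto
  \<comment> \<open>Little of \<open>U\<close> lies outside \<open>E\<close>, so \<open>E\<close>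
    nearly fills the intervals of \<open>D\<close>, and hence so do the pieces in the sets
    \<open>G k\<close>.\<close>
  have "measure lebesgue (E \<inter> \<Union>D) \<ge> S1 - \<eta>"
  proof -
    have "S1 \<le> measure lebesgue (E \<inter> \<Union>D \<union> (U - E))"
      unfolding S1m using D(2) Ulm Elm \<open>\<Union>D \<in> lmeasurable\<close> by (intro measure_mono_fmeasurable) auto
    also have "\<dots> \<le> measure lebesgue (E \<inter> \<Union>D) + measure lebesgue (U - E)"
      using Ulm Elm \<open>\<Union>D \<in> lmeasurable\<close> by (intro measure_Un_le) auto
    finally show ?thesis using UE by simp
  qed
  moreover have "measure lebesgue (E \<inter> \<Union>D) \<le> (\<Sum>k\<in>D. measure lebesgue (E \<inter> k))"
  proof -
    have "E \<inter> \<Union>D = (\<Union>k\<in>D. E \<inter> k)" by blast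
    moreover have "E \<inter> k \<in> sets lebesgue" if "k \<in> D" for k
      using D(3)[OF that] E by auto
    ultimately show ?thesis using measure_UNION_le[OF \<open>finite D\<close>, of "\<lambda>k. E \<inter> k" lebesgue] by simp
  qed
  moreover have "(\<Sum>k\<in>D. measure lebesgue (E \<inter> k)) \<le> (\<Sum>k\<in>D. (\<Sum>j\<in>G k. Sup j - Inf j) + \<eta> / n)"
    by (intro sum_mono) (use G(3) in \<open>auto simp: less_imp_le algebra_simps diff_le_eq\<close>)
  moreover have "\<dots> \<le> S2 + \<eta>"
  proof -
    have "real (card D) * (\<eta> / n) \<le> n * (\<eta> / n)"
      using \<open>n > 0\<close> \<open>\<eta> > 0\<close> by (intro mult_right_mono) (auto simp: n_def)
    then show ?thesis using \<open>n > 0\<close> by (simp add: sum.distrib S2_def)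
  qed
  ultimately have S2_ge: "S2 \<ge> S1 - 2 * \<eta>" by linarith
  have gaps: "(\<Sum>i\<in>I. Sup (snd i) - Inf (snd i)) = S1 - S2"
    using split[of "\<lambda>x. x"] by (simp add: S1_def S2_def)
  have I_elem: "\<exists>u v. snd i = {u..v} \<and> u \<le> v \<and> a \<le> u \<and> v \<le> b \<and> snd i \<subseteq> fst i" if i: "i \<in> I" for i
  proof -
    have k: "fst i \<in> D" "snd i \<in> Q (fst i)" using i by (auto simp: I_def)
    obtain u v where uv: "snd i = {u..v}" "u \<le> v"
      using interval_division_elem[OF Q(2)[OF k(1)] k(2)] by metis
    have "snd i \<subseteq> fst i" using Q(2)[OF k(1)] k(2) by blast
    moreover have "fst i \<subseteq> {a..b}" using D(2) U k(1) by blast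
    moreover have "u \<in> {u..v}" "v \<in> {u..v}"
      using uv(2) by auto
    ultimately have "u \<in> {a..b}" "v \<in> {a..b}" "snd i \<subseteq> fst i"
      using uv(1) by blast+
    with uv show ?thesis by (intro exI[of _ u] exI[of _ v]) auto
  qed
  have "(\<Sum>i\<in>I. dist (f (Inf (snd i))) (f (Sup (snd i)))) < \<epsilon>"
  proof (rule \<delta>[rule_format], unfold interval_family_def, intro conjI ballI impI)
    show "finite I" using \<open>finite D\<close> Q(1) by (auto simp: I_def)
    show "(\<Sum>i\<in>I. Sup (snd i) - Inf (snd i)) < \<delta>" using gaps S2_ge \<open>\<eta> > 0\<close> \<eta>1 by simp
    fix i assume "i \<in> I"
    from I_elem[OF this] show "a \<le> Inf (snd i)" "Inf (snd i) \<le> Sup (snd i)" "Sup (snd i) \<le> b"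
      by auto
  next
    fix i j assume ij: "i \<in> I" "j \<in> I" "i \<noteq> j"
    have int: "{Inf (snd i)<..<Sup (snd i)} = interior (snd i)" if "i \<in> I" for i
      using I_elem[OF that] by (auto simp: interior_atLeastAtMost_real)
    have "interior (snd i) \<inter> interior (snd j) = {}"
    proof (cases "fst i = fst j")
      case True
      then show ?thesis
        using ij division_ofD(5)[OF Q(2)[of "fst i"], of "snd i" "snd j"]
        by (auto simp: I_def prod_eq_iff)
    next
      case False
      then have "interior (fst i) \<inter> interior (fst j) = {}"
        using ij division_ofD(5)[OF D(1), of "fst i" "fst j"] by (auto simp: I_def)
      moreover have "interior (snd i) \<subseteq> interior (fst i)" "interior (snd j) \<subseteq> interior (fst j)"
        using I_elem[OF ij(1)] I_elem[OF ij(2)] by (auto intro!: interior_mono)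
      ultimately show ?thesis by blast
    qed
    then show "{Inf (snd i)<..<Sup (snd i)} \<inter> {Inf (snd j)<..<Sup (snd j)} = {}"
      using int ij by simp
  qed
  then have gapsf: "\<bar>\<Sum>i\<in>I. f (Sup (snd i)) - f (Inf (snd i))\<bar> < \<epsilon>"
    by (intro le_less_trans[OF sum_abs]) (simp add: dist_real_def abs_minus_commute)
  have "f (Sup k) - f (Inf k) \<le> p * (Sup k - Inf k)" if "k \<in> D" for k
    using D(3)[OF that] by auto
  then have "(\<Sum>k\<in>D. f (Sup k) - f (Inf k)) \<le> p * S1"
    unfolding S1_def sum_distrib_left by (intro sum_mono)
  moreover have "(\<Sum>k\<in>D. \<Sum>j\<in>G k. f (Sup j) - f (Inf j)) \<ge> q * S2"
    unfolding S2_def sum_distrib_left by (intro sum_mono) (use G(2) in auto)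
  ultimately have "q * S2 - \<epsilon> < p * S1"
    using split[of f] gapsf by linarith
  moreover have "q * (S1 - S2) \<le> \<epsilon>"
  proof -
    have "0 \<le> Sup (snd i) - Inf (snd i)" if "i \<in> I" for i
      using I_elem[OF that] by auto
    then have "0 \<le> S1 - S2" unfolding gaps[symmetric] by (intro sum_nonneg)
    then have "q * (S1 - S2) \<le> \<bar>q\<bar> * (4 * \<eta>)"
      using S2_ge \<open>\<eta> > 0\<close> by (intro mult_mono) auto
    then show ?thesis using \<eta>3 by linarith
  qed
  ultimately have "(q - p) * S1 < 2 * \<epsilon>" by (simp add: algebra_simps)
  also have "2 * \<epsilon> = (q - p) * (s / 2)" by (simp add: \<epsilon>_def)
  finally have "S1 < s / 2" using \<open>p < q\<close> by simp
  then show False using D(4) \<eta>2 \<open>s > 0\<close> by (simp add: S1_def s_def)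
qed

section \<open>Differentiability almost everywhere\<close>

lemma absolutely_continuous_curve_division:
  assumes ac: "absolutely_continuous_curve a b f" and "\<epsilon> > 0"
  shows "\<exists>\<delta>>0. \<forall>\<D>. \<D> division_of \<Union>\<D> \<and> \<Union>\<D> \<subseteq> {a..b} \<and> (\<Sum>k\<in>\<D>. Sup k - Inf k) < \<delta> \<longrightarrow>
    (\<Sum>k\<in>\<D>. dist (f (Inf k)) (f (Sup k))) < \<epsilon>"
proof -
  obtain \<delta> where "\<delta> > 0"
    and \<delta>: "\<forall>(I :: real set set) s t. interval_family a b I s t \<and>
       (\<Sum>i\<in>I. t i - s i) < \<delta> \<longrightarrow> (\<Sum>i\<in>I. dist (f (s i)) (f (t i))) < \<epsilon>"
    using absolutely_continuous_curve_family[OF ac \<open>\<epsilon> > 0\<close>] by blast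
  show ?thesis
  proof (intro exI[of _ \<delta>] conjI allI impI \<open>\<delta> > 0\<close>, elim conjE)
    fix \<D> assume D: "\<D> division_of \<Union>\<D>" "\<Union>\<D> \<subseteq> {a..b}" "(\<Sum>k\<in>\<D>. Sup k - Inf k) < \<delta>"
    have elem: "\<exists>u v. k = {u..v} \<and> u \<le> v \<and> a \<le> u \<and> v \<le> b" if k: "k \<in> \<D>" for k
    proof -
      obtain u v where uv: "k = {u..v}" "u \<le> v"
        using interval_division_elem[OF D(1) k] by metis
      then have "u \<in> k" "v \<in> k" by auto
      then have "u \<in> {a..b}" "v \<in> {a..b}" using D(2) k by blast+
      with uv show ?thesis by auto
    qed
    show "(\<Sum>k\<in>\<D>. dist (f (Inf k)) (f (Sup k))) < \<epsilon>"
    proof (rule \<delta>[rule_format], unfold interval_family_def, intro conjI ballI impI)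
      fix k assume "k \<in> \<D>"
      from elem[OF this] show "a \<le> Inf k" "Inf k \<le> Sup k" "Sup k \<le> b" by auto
    next
      fix k l assume kl: "k \<in> \<D>" "l \<in> \<D>" "k \<noteq> l"
      have int: "{Inf k<..<Sup k} = interior k" if "k \<in> \<D>" for k
        using elem[OF that] by (auto simp: interior_atLeastAtMost_real)
      then show "{Inf k<..<Sup k} \<inter> {Inf l<..<Sup l} = {}"
        using division_ofD(5)[OF D(1) kl] kl by simp
    qed (use D in auto)
  qed
qed

text \<open>Asking for \<open>t\<close> in the interior of the intervals makes this a countable intersection of open
  sets, hence measurable for every \<open>f\<close>.\<close>

definition steep_points :: "real \<Rightarrow> real \<Rightarrow> (real \<Rightarrow> real) \<Rightarrow> real \<Rightarrow> real set" where
  "steep_points a b f q = {t. \<forall>d>0. \<exists>u v. a \<le> u \<and> v \<le> b \<and> u < t \<and> t < v \<and> v - u < d \<and> f v - f u > q * (v - u)}"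

lemma steep_points_lebesgue: "steep_points a b f q \<in> sets lebesgue"
proof -
  let ?I = "\<lambda>n::nat. {(u, v). a \<le> u \<and> v \<le> b \<and> v - u < inverse (Suc n) \<and> f v - f u > q * (v - u)}"
  have "steep_points a b f q = (\<Inter>n. \<Union>i\<in>?I n. {fst i<..<snd i})"
  proof (intro set_eqI iffI)
    fix t assume "t \<in> steep_points a b f q"
    then have t: "\<forall>d>0. \<exists>u v. a \<le> u \<and> v \<le> b \<and> u < t \<and> t < v \<and> v - u < d \<and> f v - f u > q * (v - u)"
      by (simp add: steep_points_def)
    have "\<exists>i\<in>?I n. t \<in> {fst i<..<snd i}" for n
      using t[rule_format, of "inverse (Suc n)"] by auto
    then show "t \<in> (\<Inter>n. \<Union>i\<in>?I n. {fst i<..<snd i})" by blast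
  next
    fix t assume t: "t \<in> (\<Inter>n. \<Union>i\<in>?I n. {fst i<..<snd i})"
    have "\<exists>u v. a \<le> u \<and> v \<le> b \<and> u < t \<and> t < v \<and> v - u < d \<and> f v - f u > q * (v - u)" if "d > 0" for d
    proof -
      obtain n where n: "inverse (real (Suc n)) < d" using reals_Archimedean[OF \<open>d > 0\<close>] by auto
      from t obtain i where "i \<in> ?I n" "t \<in> {fst i<..<snd i}" by blast
      then show ?thesis using n by (intro exI[of _ "fst i"] exI[of _ "snd i"]) auto
    qed
    then show "t \<in> steep_points a b f q" by (simp add: steep_points_def)
  qed
  moreover have "open (\<Union>i\<in>?I n. {fst i<..<snd i})" for n by (intro open_UN) auto
  ultimately show ?thesis by (auto intro!: sets.countable_INT borel_open)
qed

lemma steep_points_subset: "steep_points a b f q \<subseteq> {a<..<b}"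
proof
  fix t assume "t \<in> steep_points a b f q"
  then have "\<exists>u v. a \<le> u \<and> v \<le> b \<and> u < t \<and> t < v \<and> v - u < 1 \<and> f v - f u > q * (v - u)"
    unfolding steep_points_def using zero_less_one by blast
  then obtain u v where "a \<le> u" "v \<le> b" "u < t" "t < v" by blast
  then show "t \<in> {a<..<b}" by simp
qed

lemma steep_pointsD:
  assumes "t \<in> steep_points a b f q" "d > 0"
  shows "\<exists>u v. u < v \<and> u \<le> t \<and> t \<le> v \<and> v - u < d \<and> f v - f u \<ge> q * (v - u)"
proof -
  from assms obtain u v where "u < t" "t < v" "v - u < d" "f v - f u > q * (v - u)"
    unfolding steep_points_def by blast
  then show ?thesis by (intro exI[of _ u] exI[of _ v]) auto
qed

text \<open>A difference quotient at \<open>t\<close> belongs to an interval that has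
  \<open>t\<close> as an end point. By continuity this end point can be pushed slightly beyond
  \<open>t\<close> without losing the strict inequality.\<close>

lemma frequently_steep_imp_steep_points:
  fixes f :: "real \<Rightarrow> real"
  assumes t: "a < t" "t < b" "isCont f t" and fr: "\<exists>\<^sub>F x in at t. (f x - f t) / (x - t) > q"
  shows "t \<in> steep_points a b f q"
  unfolding steep_points_def
proof (intro CollectI allI impI)
  fix d :: real assume "d > 0"
  define r where "r = min (d / 2) (min (t - a) (b - t))"
  have "r > 0" using \<open>d > 0\<close> t by (simp add: r_def)
  then have ev: "\<forall>\<^sub>F x in at t. dist x t < r \<and> x \<noteq> t"
    by (auto simp: eventually_at)
  obtain x where x: "(f x - f t) / (x - t) > q" "dist x t < r" "x \<noteq> t"
    using frequently_ex[OF frequently_eventually_frequently[OF fr ev]] by blast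
  have rd: "y > t - r \<Longrightarrow> y \<ge> a" "y < t + r \<Longrightarrow> y \<le> b" "t - r \<ge> t - d / 2" "t + r \<le> t + d / 2" for y
    unfolding r_def by linarith+
  show "\<exists>u v. a \<le> u \<and> v \<le> b \<and> u < t \<and> t < v \<and> v - u < d \<and> f v - f u > q * (v - u)"
  proof (cases "x > t")
    case True
    then have "0 < f x - f t - q * (x - t)" using x by (simp add: field_simps)
    moreover have "((\<lambda>u. f x - f u - q * (x - u)) \<longlongrightarrow> f x - f t - q * (x - t)) (at_left t)"
      using t(3) by (intro tendsto_intros) (auto simp: isCont_def intro: tendsto_within_subset)
    ultimately have "\<forall>\<^sub>F u in at_left t. 0 < f x - f u - q * (x - u)"
      by (metis order_tendstoD(1))
    moreover have "\<forall>\<^sub>F u in at_left t. t - r < u \<and> u < t"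
      using \<open>r > 0\<close> eventually_at_left_real[of "t - r" t] by auto
    ultimately have "\<forall>\<^sub>F u in at_left t. 0 < f x - f u - q * (x - u) \<and> t - r < u \<and> u < t"
      by eventually_elim auto
    then obtain u where "0 < f x - f u - q * (x - u)" "t - r < u" "u < t"
      using eventually_happens'[OF trivial_limit_at_left_real] by blast
    then show ?thesis using True x(2) rd(1)[of u] rd(2)[of x] rd(3,4)
      by (intro exI[of _ u] exI[of _ x]) (auto simp: dist_real_def)
  next
    case False
    then have "x < t" using x by simp
    then have "0 < f t - f x - q * (t - x)" using x by (simp add: field_simps)
    moreover have "((\<lambda>u. f u - f x - q * (u - x)) \<longlongrightarrow> f t - f x - q * (t - x)) (at_right t)"
      using t(3) by (intro tendsto_intros) (auto simp: isCont_def intro: tendsto_within_subset)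
    ultimately have "\<forall>\<^sub>F u in at_right t. 0 < f u - f x - q * (u - x)"
      by (metis order_tendstoD(1))
    moreover have "\<forall>\<^sub>F u in at_right t. t < u \<and> u < t + r"
      using \<open>r > 0\<close> eventually_at_right_real[of t "t + r"] by auto
    ultimately have "\<forall>\<^sub>F u in at_right t. 0 < f u - f x - q * (u - x) \<and> t < u \<and> u < t + r"
      by eventually_elim auto
    then obtain u where "0 < f u - f x - q * (u - x)" "t < u" "u < t + r"
      using eventually_happens'[OF trivial_limit_at_right_real] by blast
    then show ?thesis using \<open>x < t\<close> x(2) rd(1)[of x] rd(2)[of u] rd(3,4)
      by (intro exI[of _ x] exI[of _ u]) (auto simp: dist_real_def)
  qed
qed

text \<open>If the lower and upper limits of the difference quotient differ, two rationals fit
  between them; if they agree but are infinite, \<open>t\<close> is steep for every natural number;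
  otherwise the derivative exists. Only countably many exceptional sets occur.\<close>

lemma not_differentiable_steep_points:
  fixes f :: "real \<Rightarrow> real"
  assumes t: "a < t" "t < b" "isCont f t" and nd: "\<not> f differentiable at t"
  shows "t \<in> (\<Union>p\<in>\<rat>. \<Union>q\<in>\<rat> \<inter> {p<..}. steep_points a b f q \<inter> steep_points a b (\<lambda>x. - f x) (- p)) \<union>
    ((\<Inter>m::nat. steep_points a b f m) \<union> (\<Inter>m::nat. steep_points a b (\<lambda>x. - f x) m))"
proof (rule ccontr)
  assume nt: "\<not> ?thesis"
  define Q where "Q x = (f x - f t) / (x - t)" for x
  have Q': "(- f x - - f t) / (x - t) = - Q x" for x
    unfolding Q_def by (simp add: minus_divide_left)
  have up: "\<forall>\<^sub>F x in at t. Q x \<le> q" if "t \<notin> steep_points a b f q" for q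
    using frequently_steep_imp_steep_points[OF t, of q] that
    by (auto simp: frequently_def not_less Q_def)
  have lo: "\<forall>\<^sub>F x in at t. - q \<le> Q x" if "t \<notin> steep_points a b (\<lambda>x. - f x) q" for q
  proof -
    have "\<not> (\<exists>\<^sub>F x in at t. q < - Q x)"
      using frequently_steep_imp_steep_points[OF t(1,2), of "\<lambda>x. - f x" q] that t(3)
      unfolding Q' by (auto simp: continuous_minus)
    then have "\<forall>\<^sub>F x in at t. \<not> q < - Q x" by (simp add: frequently_def)
    then show ?thesis by eventually_elim simp
  qed
  let ?E = "\<lambda>x. ereal (Q x)"
  let ?l = "Liminf (at t) ?E" and ?u = "Limsup (at t) ?E"
  have "?l \<le> ?u" by (rule Liminf_le_Limsup) simp
  moreover have "\<not> ?l < ?u"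
  proof
    assume "?l < ?u"
    then obtain p where p: "?l < ereal (real_of_rat p)" "ereal (real_of_rat p) < ?u" using ereal_dense3 by blast
    then obtain q where q: "ereal (real_of_rat p) < ereal (real_of_rat q)" "ereal (real_of_rat q) < ?u"
      using ereal_dense3 by blast
    have "t \<in> steep_points a b f (real_of_rat q)"
    proof (rule ccontr)
      assume "t \<notin> steep_points a b f (real_of_rat q)"
      then have "?u \<le> ereal (real_of_rat q)" using up by (intro Limsup_bounded) auto
      then show False using q by simp
    qed
    moreover have "t \<in> steep_points a b (\<lambda>x. - f x) (- real_of_rat p)"
    proof (rule ccontr)
      assume "t \<notin> steep_points a b (\<lambda>x. - f x) (- real_of_rat p)"
      then have "ereal (real_of_rat p) \<le> ?l" using lo[of "- real_of_rat p"] by (intro Liminf_bounded) auto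
      then show False using p by simp
    qed
    moreover have "real_of_rat p \<in> \<rat>" "real_of_rat q \<in> \<rat> \<inter> {real_of_rat p<..}" using q by auto
    ultimately show False using nt by blast
  qed
  ultimately have eq: "?l = ?u" by simp
  obtain m :: nat where "t \<notin> steep_points a b f m" using nt by auto
  then have "?u \<le> ereal m" using up by (intro Limsup_bounded) auto
  moreover obtain m' :: nat where "t \<notin> steep_points a b (\<lambda>x. - f x) m'" using nt by auto
  then have "ereal (- m') \<le> ?l" using lo[of m'] by (intro Liminf_bounded) auto
  ultimately obtain r where "?u = ereal r" using eq by (cases ?u) auto
  then have "(?E \<longlongrightarrow> ereal r) (at t)"
    using eq by (intro Liminf_eq_Limsup) auto
  then have "(Q \<longlongrightarrow> r) (at t)" by simp
  then have "(f has_field_derivative r) (at t)"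
    by (simp add: has_field_derivative_iff Q_def[abs_def])
  then show False using nd real_differentiable_def by blast
qed

text \<open>A part of positive measure would contain disjoint intervals of slope \<open>m\<close>
  whose total length exceeds half that measure. For large \<open>m\<close> their increments add up
  to more than 1, although their total length is below the \<delta> that belongs to 1.\<close>

lemma absolutely_continuous_infinitely_steep_negligible:
  fixes f :: "real \<Rightarrow> real"
  assumes ac: "absolutely_continuous_curve a b f"
  shows "negligible (\<Inter>m::nat. steep_points a b f m)" (is "negligible ?E")
proof -
  obtain \<delta> where "\<delta> > 0" and \<delta>: "\<forall>\<D>. \<D> division_of \<Union>\<D> \<and> \<Union>\<D> \<subseteq> {a..b} \<and> (\<Sum>k\<in>\<D>. Sup k - Inf k) < \<delta> \<longrightarrow>
    (\<Sum>k\<in>\<D>. dist (f (Inf k)) (f (Sup k))) < 1"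
    using absolutely_continuous_curve_division[OF ac zero_less_one] by blast
  have E: "?E \<in> sets lebesgue"
    by (intro sets.countable_INT) (use steep_points_lebesgue in auto)
  \<comment> \<open>Localising to length \<open>\<delta> / 2\<close> keeps the total length of any
    disjoint intervals below \<delta>; rational centres cover the line.\<close>
  have piece: "negligible (?E \<inter> {c - \<delta>/4<..<c + \<delta>/4})" for c
  proof (rule ccontr)
    define E' where "E' = ?E \<inter> {c - \<delta>/4<..<c + \<delta>/4}"
    define U where "U = {a<..<b} \<inter> {c - \<delta>/4<..<c + \<delta>/4}"
    assume "\<not> negligible (?E \<inter> {c - \<delta>/4<..<c + \<delta>/4})"
    then have nn: "\<not> negligible E'" by (simp add: E'_def)
    have "?E \<subseteq> {a<..<b}" using steep_points_subset by blast
    then have E'U: "E' \<subseteq> U" by (auto simp: E'_def U_def)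
    have E': "E' \<in> sets lebesgue" using E by (auto simp: E'_def)
    have Ulm: "U \<in> lmeasurable" unfolding U_def by (intro fmeasurable.Int) auto
    then have "E' \<in> lmeasurable" using E'U E' by (rule fmeasurableI2)
    then have s: "measure lebesgue E' > 0" using nn by (simp add: negligible_iff_measure0 zero_less_measure_iff)
    obtain m :: nat where m: "m * (measure lebesgue E' / 2) > 1"
      using ex_less_of_nat_mult[of "measure lebesgue E' / 2" 1] s by auto
    have P: "\<exists>u v. u < v \<and> u \<le> t \<and> t \<le> v \<and> v - u < d \<and> f v - f u \<ge> real m * (v - u)" if "t \<in> E'" "d > 0" for t d
      using that by (intro steep_pointsD) (auto simp: E'_def)
    have "\<exists>D. D division_of \<Union>D \<and> \<Union>D \<subseteq> U \<and>
      (\<forall>k\<in>D. \<exists>u v. u < v \<and> k = {u..v} \<and> f v - f u \<ge> real m * (v - u)) \<and>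
      measure lebesgue E' - measure lebesgue E' / 2 < (\<Sum>k\<in>D. Sup k - Inf k)"
    proof (rule Vitali_finite_interval_cover[of U E' a b "measure lebesgue E' / 2"])
      show "open U" by (auto simp: U_def)
      show "U \<subseteq> {a..b}" by (auto simp: U_def)
    qed (use P E' E'U s in auto)
    then obtain D where D: "D division_of \<Union>D" "\<Union>D \<subseteq> U"
      "\<And>k. k \<in> D \<Longrightarrow> \<exists>u v. u < v \<and> k = {u..v} \<and> f v - f u \<ge> real m * (v - u)"
      "measure lebesgue E' - measure lebesgue E' / 2 < (\<Sum>k\<in>D. Sup k - Inf k)"
      by auto
    have len: "Sup k - Inf k = measure lebesgue k" if "k \<in> D" for k
      using D(3)[OF that] by auto
    have "(\<Sum>k\<in>D. Sup k - Inf k) = measure lebesgue (\<Union>D)"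
      using len content_division[OF D(1)] by simp
    also have "\<dots> \<le> measure lebesgue {c - \<delta>/4<..<c + \<delta>/4}"
      using D(2) lmeasurable_division[OF D(1)] by (intro measure_mono_fmeasurable) (auto simp: U_def)
    also have "\<dots> = \<delta> / 2" using \<open>\<delta> > 0\<close> by simp
    finally have "(\<Sum>k\<in>D. Sup k - Inf k) < \<delta>" using \<open>\<delta> > 0\<close> by simp
    moreover have "\<Union>D \<subseteq> {a..b}" using D(2) by (auto simp: U_def)
    ultimately have "(\<Sum>k\<in>D. dist (f (Inf k)) (f (Sup k))) < 1" using \<delta> D(1) by blast
    moreover have "real m * (\<Sum>k\<in>D. Sup k - Inf k) \<le> (\<Sum>k\<in>D. dist (f (Inf k)) (f (Sup k)))"
      unfolding sum_distrib_left
    proof (rule sum_mono)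
      fix k assume "k \<in> D"
      from D(3)[OF this] show "real m * (Sup k - Inf k) \<le> dist (f (Inf k)) (f (Sup k))"
        by (auto simp: dist_real_def)
    qed
    moreover have "m * (measure lebesgue E' / 2) \<le> real m * (\<Sum>k\<in>D. Sup k - Inf k)"
      using D(4) by (intro mult_left_mono) auto
    ultimately show False using m by linarith
  qed
  have "?E \<subseteq> (\<Union>c\<in>\<rat>. ?E \<inter> {c - \<delta>/4<..<c + \<delta>/4})"
  proof
    fix t assume "t \<in> ?E"
    obtain c where "c \<in> \<rat>" "t - \<delta>/4 < c" "c < t + \<delta>/4" using Rats_dense_in_real[of "t - \<delta>/4" "t + \<delta>/4"] \<open>\<delta> > 0\<close> by auto
    then show "t \<in> (\<Union>c\<in>\<rat>. ?E \<inter> {c - \<delta>/4<..<c + \<delta>/4})" using \<open>t \<in> ?E\<close> by (intro UN_I[of c]) auto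
  qed
  moreover have "negligible (\<Union>c\<in>\<rat>. ?E \<inter> {c - \<delta>/4<..<c + \<delta>/4})"
    using piece countable_rat by (intro negligible_countable_Union) auto
  ultimately show ?thesis by (rule negligible_subset[rotated])
qed

lemma absolutely_continuous_differentiable_ae_real:
  fixes f :: "real \<Rightarrow> real"
  assumes ac: "absolutely_continuous_curve a b f"
  shows "negligible {t \<in> {a<..<b}. \<not> f differentiable at t}"
proof -
  have ac': "absolutely_continuous_curve a b (\<lambda>x. - f x)"
    by (rule absolutely_continuous_curve_Lipschitz[OF ac, of 1]) (auto simp: dist_real_def)
  have "negligible (steep_points a b f q \<inter> steep_points a b (\<lambda>x. - f x) (- p))" (is "negligible ?E") if "p < q" for p q
  proof -
    have E: "?E \<in> sets lebesgue" using steep_points_lebesgue by (rule sets.Int) (rule steep_points_lebesgue)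
    have sub: "?E \<subseteq> {a<..<b}" using steep_points_subset by blast
    have "measure lebesgue ?E = 0"
    proof (rule absolutely_continuous_increments_measure_zero[OF ac E sub \<open>p < q\<close>])
      fix t d :: real assume td: "t \<in> ?E" "0 < d"
      show "\<exists>u v. u < v \<and> u \<le> t \<and> t \<le> v \<and> v - u < d \<and> f v - f u \<ge> q * (v - u)"
        using td by (intro steep_pointsD) auto
      \<comment> \<open>Slope at least \<open>- p\<close> for \<open>- f\<close> is slope at most
        \<open>p\<close> for \<open>f\<close>.\<close>
      have "\<exists>u v. u < v \<and> u \<le> t \<and> t \<le> v \<and> v - u < d \<and> - f v - - f u \<ge> - p * (v - u)"
        using td by (intro steep_pointsD[of _ a b]) auto
      then show "\<exists>u v. u < v \<and> u \<le> t \<and> t \<le> v \<and> v - u < d \<and> f v - f u \<le> p * (v - u)"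
        by (auto simp: algebra_simps)
    qed
    moreover have "?E \<in> lmeasurable" using sub E by (rule fmeasurableI2[rotated]) auto
    ultimately show ?thesis by (simp add: negligible_iff_measure0)
  qed
  then have "negligible (\<Union>p\<in>\<rat>. \<Union>q\<in>\<rat> \<inter> {p<..}. steep_points a b f q \<inter> steep_points a b (\<lambda>x. - f x) (- p))"
    (is "negligible ?U")
    by (intro negligible_countable_Union countable_image countable_rat countable_Int1 ballI)
      (auto intro!: negligible_countable_Union countable_image countable_rat simp del: UN_simps Int_UN_distrib2)
  then have "negligible (?U \<union> ((\<Inter>m::nat. steep_points a b f m) \<union> (\<Inter>m::nat. steep_points a b (\<lambda>x. - f x) m)))"
    using absolutely_continuous_infinitely_steep_negligible[OF ac]
      absolutely_continuous_infinitely_steep_negligible[OF ac'] by (intro negligible_Un)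
  then show ?thesis
  proof (rule negligible_subset, intro subsetI)
    fix t assume t: "t \<in> {t \<in> {a<..<b}. \<not> f differentiable at t}"
    then have "isCont f t"
      using absolutely_continuous_curve_imp_continuous_on[OF ac]
      by (intro continuous_on_interior[of "{a..b}"]) (auto simp: interior_atLeastAtMost_real)
    then show "t \<in> ?U \<union> ((\<Inter>m::nat. steep_points a b f m) \<union> (\<Inter>m::nat. steep_points a b (\<lambda>x. - f x) m))"
      using t by (intro not_differentiable_steep_points) auto
  qed
qed

lemma absolutely_continuous_differentiable_ae:
  fixes f :: "real \<Rightarrow> 'a::euclidean_space"
  assumes ac: "absolutely_continuous_curve a b f"
  shows "negligible {t \<in> {a<..<b}. \<not> f differentiable at t}"
proof -
  have "negligible (\<Union>i\<in>Basis. {t \<in> {a<..<b}. \<not> (\<lambda>x. f x \<bullet> i) differentiable at t})"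
  proof (rule negligible_Union, safe)
    fix i :: 'a assume i: "i \<in> Basis"
    have "absolutely_continuous_curve a b (\<lambda>x. f x \<bullet> i)"
    proof (rule absolutely_continuous_curve_Lipschitz[OF ac, of 1])
      fix s t
      show "dist (f s \<bullet> i) (f t \<bullet> i) \<le> 1 * dist (f s) (f t)"
        using Basis_le_norm[OF i, of "f s - f t"] by (simp add: dist_norm inner_diff_left)
    qed auto
    then show "negligible {t \<in> {a<..<b}. \<not> (\<lambda>x. f x \<bullet> i) differentiable at t}"
      by (rule absolutely_continuous_differentiable_ae_real)
  qed auto
  then show ?thesis
    by (rule negligible_subset) (use differentiable_componentwise_within[of f _ UNIV] in blast)
qed

section \<open>The fundamental theorem of calculus for absolutely continuous functions\<close>

text \<open>For the gauge integral, integrability of \<open>\<phi>'\<close> is part of the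
  conclusion. Tags outside \<open>N\<close> are handled by the derivative. Tags in \<open>N\<close>
  get balls inside an open set of measure below \<delta>, so their intervals have small total
  length; \<open>\<phi>'\<close> vanishes there and absolute continuity bounds the
  increments.\<close>

lemma absolutely_continuous_fundamental_theorem:
  fixes \<phi> \<phi>' :: "real \<Rightarrow> real"
  assumes ac: "absolutely_continuous_curve a b \<phi>" and "a \<le> b" and N: "negligible N"
    and der: "\<And>t. t \<in> {a..b} - N \<Longrightarrow> (\<phi> has_real_derivative \<phi>' t) (at t)"
    and zero: "\<And>t. t \<in> N \<Longrightarrow> \<phi>' t = 0"
  shows "(\<phi>' has_integral (\<phi> b - \<phi> a)) {a..b}"
  unfolding has_integral_real
proof (intro allI impI)
  fix e :: real assume "e > 0"
  obtain \<delta> where "\<delta> > 0"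
    and \<delta>: "\<forall>(I :: (real \<times> real set) set) s t. interval_family a b I s t \<and>
       (\<Sum>i\<in>I. t i - s i) < \<delta> \<longrightarrow> (\<Sum>i\<in>I. dist (\<phi> (s i)) (\<phi> (t i))) < e / 2"
    using absolutely_continuous_curve_family[OF ac half_gt_zero[OF \<open>e > 0\<close>]] by blast
  obtain T where T: "open T" "N \<subseteq> T" "T - N \<in> lmeasurable" "emeasure lebesgue (T - N) < ennreal \<delta>"
    using sets_lebesgue_outer_open[OF negligible_imp_sets[OF N] \<open>\<delta> > 0\<close>] by blast
  have Nlm: "N \<in> lmeasurable" using N by (rule negligible_imp_measurable)
  have "(T - N) \<union> N \<in> lmeasurable" using T(3) Nlm by blast
  moreover have TN: "(T - N) \<union> N = T" using T(2) by blast
  ultimately have Tlm: "T \<in> lmeasurable" by simp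
  have "measure lebesgue T \<le> measure lebesgue (T - N) + measure lebesgue N"
    using measure_Un_le[of "T - N" lebesgue N] T(3) Nlm TN by auto
  also have "\<dots> < \<delta>"
    using T(3,4) N \<open>\<delta> > 0\<close> by (simp add: negligible_imp_measure0 emeasure_eq_measure2 ennreal_less_iff)
  finally have T\<delta>: "measure lebesgue T < \<delta>" .
  define e' where "e' = e / (4 * (b - a + 1))"
  have "e' > 0" using \<open>e > 0\<close> \<open>a \<le> b\<close> by (simp add: e'_def)
  have ex: "\<exists>r>0. (t \<in> N \<longrightarrow> ball t r \<subseteq> T) \<and>
      (t \<in> {a..b} - N \<longrightarrow> (\<forall>y. \<bar>y - t\<bar> < r \<longrightarrow> \<bar>\<phi> y - \<phi> t - \<phi>' t * (y - t)\<bar> \<le> e' * \<bar>y - t\<bar>))" for t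
  proof (cases "t \<in> N")
    case True
    then show ?thesis using T(1,2) by (auto simp: open_contains_ball)
  next
    case False
    show ?thesis
    proof (cases "t \<in> {a..b}")
      case True
      then have "(\<phi> has_derivative (*) (\<phi>' t)) (at t)"
        using der False by (simp add: has_field_derivative_def)
      then show ?thesis using \<open>e' > 0\<close> False unfolding has_derivative_at_alt by auto
    qed (use False in \<open>auto intro!: exI[of _ 1]\<close>)
  qed
  obtain r where "\<forall>t. r t > 0 \<and> (t \<in> N \<longrightarrow> ball t (r t) \<subseteq> T) \<and>
      (t \<in> {a..b} - N \<longrightarrow> (\<forall>y. \<bar>y - t\<bar> < r t \<longrightarrow> \<bar>\<phi> y - \<phi> t - \<phi>' t * (y - t)\<bar> \<le> e' * \<bar>y - t\<bar>))"
    using choice[OF allI[OF ex]] by (rule exE)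
  then have r: "\<And>t. r t > 0" "\<And>t. t \<in> N \<Longrightarrow> ball t (r t) \<subseteq> T"
    "\<And>t y. \<lbrakk>t \<in> {a..b} - N; \<bar>y - t\<bar> < r t\<rbrakk> \<Longrightarrow> \<bar>\<phi> y - \<phi> t - \<phi>' t * (y - t)\<bar> \<le> e' * \<bar>y - t\<bar>"
    by blast+
  show "\<exists>\<gamma>. gauge \<gamma> \<and> (\<forall>\<D>. \<D> tagged_division_of {a..b} \<and> \<gamma> fine \<D> \<longrightarrow>
      norm ((\<Sum>(x, k)\<in>\<D>. measure lborel k *\<^sub>R \<phi>' x) - (\<phi> b - \<phi> a)) < e)"
  proof (intro exI[of _ "\<lambda>t. ball t (r t)"] conjI allI impI, goal_cases)
    case 1
    show ?case using r(1) by (simp add: gauge_def)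
  next
    case (2 p)
    then have p: "p tagged_division_of {a..b}" and fine: "(\<lambda>t. ball t (r t)) fine p" by auto
    have elem: "\<exists>u v. k = {u..v} \<and> u \<le> x \<and> x \<le> v \<and> a \<le> u \<and> v \<le> b \<and> k \<subseteq> ball x (r x)" if xk: "(x, k) \<in> p" for x k
    proof -
      obtain u v where uv: "k = cbox u v" using tagged_division_ofD(4)[OF p xk] by blast
      have "x \<in> k" "k \<subseteq> {a..b}" using tagged_division_ofD(2,3)[OF p xk] by auto
      moreover have "k \<subseteq> ball x (r x)" using fine xk by (auto simp: fine_def)
      ultimately show ?thesis using uv by (intro exI[of _ u] exI[of _ v]) auto
    qed
    have fin: "finite p" using p by blast
    define p1 where "p1 = {i \<in> p. fst i \<in> N}"
    have "(\<Sum>i\<in>p1. dist (\<phi> (Inf (snd i))) (\<phi> (Sup (snd i)))) < e / 2"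
    proof (rule \<delta>[rule_format], unfold interval_family_def, intro conjI ballI impI)
      show "finite p1" using fin by (simp add: p1_def)
      have e1: "\<exists>u v. snd i = {u..v} \<and> u \<le> v \<and> a \<le> u \<and> v \<le> b \<and> {u..v} \<subseteq> T" if "i \<in> p1" for i
      proof -
        have "(fst i, snd i) \<in> p" using that by (simp add: p1_def)
        from elem[OF this] obtain u v where "snd i = {u..v}" "u \<le> fst i" "fst i \<le> v" "a \<le> u" "v \<le> b"
            "snd i \<subseteq> ball (fst i) (r (fst i))"
          by blast
        moreover have "ball (fst i) (r (fst i)) \<subseteq> T" using that r(2) by (auto simp: p1_def)
        ultimately show ?thesis by (intro exI[of _ u] exI[of _ v]) auto
      qed
      {
        fix i assume "i \<in> p1"
        from e1[OF this] show "a \<le> Inf (snd i)" "Inf (snd i) \<le> Sup (snd i)" "Sup (snd i) \<le> b"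
          by auto
      }
      have int: "{Inf (snd i)<..<Sup (snd i)} = interior (snd i)" if "i \<in> p1" for i
        using e1[OF that] by (auto simp: interior_atLeastAtMost_real)
      have disj: "interior (snd i) \<inter> interior (snd j) = {}" if "i \<in> p1" "j \<in> p1" "i \<noteq> j" for i j
        using tagged_division_ofD(5)[OF p, of "fst i" "snd i" "fst j" "snd j"] that
        by (simp add: p1_def prod_eq_iff)
      show "{Inf (snd i)<..<Sup (snd i)} \<inter> {Inf (snd j)<..<Sup (snd j)} = {}" if "i \<in> p1" "j \<in> p1" "i \<noteq> j" for i j
        using disj[OF that] int that by simp
      \<comment> \<open>Passing to interiors makes the family disjoint, since the intervals may
        share end points.\<close>
      have "(\<Sum>i\<in>p1. Sup (snd i) - Inf (snd i)) = (\<Sum>i\<in>p1. measure lebesgue (interior (snd i)))"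
      proof (rule sum.cong[OF refl])
        fix i assume i: "i \<in> p1"
        from e1[OF i] show "Sup (snd i) - Inf (snd i) = measure lebesgue (interior (snd i))"
          unfolding int[OF i, symmetric] by auto
      qed
      also have "\<dots> = measure lebesgue (\<Union>i\<in>p1. interior (snd i))"
      proof (rule measure_finite_Union[symmetric])
        show "disjoint_family_on (\<lambda>i. interior (snd i)) p1"
          using disj by (auto simp: disjoint_family_on_def)
        show "emeasure lebesgue (interior (snd i)) \<noteq> \<infinity>" if "i \<in> p1" for i
          unfolding int[OF that, symmetric] using e1[OF that] by auto
      qed (use \<open>finite p1\<close> in auto)
      also have "\<dots> \<le> measure lebesgue T"
      proof (rule measure_mono_fmeasurable[OF _ _ Tlm])
        show "(\<Union>i\<in>p1. interior (snd i)) \<subseteq> T"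
          using e1 interior_subset by fastforce
        show "(\<Union>i\<in>p1. interior (snd i)) \<in> sets lebesgue"
          using \<open>finite p1\<close> by (intro sets.finite_UN) auto
      qed
      finally show "(\<Sum>i\<in>p1. Sup (snd i) - Inf (snd i)) < \<delta>" using T\<delta> by simp
    qed
    then have s1: "(\<Sum>i\<in>p1. \<bar>measure lborel (snd i) * \<phi>' (fst i) - (\<phi> (Sup (snd i)) - \<phi> (Inf (snd i)))\<bar>) < e / 2"
      by (rule le_less_trans[rotated], intro sum_mono) (auto simp: p1_def zero dist_real_def)
    have "(\<Sum>i\<in>p - p1. \<bar>measure lborel (snd i) * \<phi>' (fst i) - (\<phi> (Sup (snd i)) - \<phi> (Inf (snd i)))\<bar>)
       \<le> (\<Sum>i\<in>p - p1. e' * (Sup (snd i) - Inf (snd i)))"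
    proof (rule sum_mono)
      fix i assume i: "i \<in> p - p1"
      have "(fst i, snd i) \<in> p" using i by simp
      from elem[OF this] obtain u v where uv: "snd i = {u..v}" "u \<le> fst i" "fst i \<le> v" "a \<le> u" "v \<le> b"
          "snd i \<subseteq> ball (fst i) (r (fst i))"
        by blast
      have x: "fst i \<in> {a..b} - N" using uv i by (auto simp: p1_def)
      have "u \<in> snd i" "v \<in> snd i" using uv(1-3) by auto
      then have "u \<in> ball (fst i) (r (fst i))" "v \<in> ball (fst i) (r (fst i))" using uv(6) by blast+
      then have "\<bar>\<phi> u - \<phi> (fst i) - \<phi>' (fst i) * (u - fst i)\<bar> \<le> e' * \<bar>u - fst i\<bar>"
         "\<bar>\<phi> v - \<phi> (fst i) - \<phi>' (fst i) * (v - fst i)\<bar> \<le> e' * \<bar>v - fst i\<bar>"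
        by (intro r(3)[OF x]; simp add: dist_real_def abs_minus_commute)+
      then have "\<bar>(v - u) * \<phi>' (fst i) - (\<phi> v - \<phi> u)\<bar> \<le> e' * (v - u)"
        using uv(2,3) by (simp add: abs_le_iff algebra_simps)
      then show "\<bar>measure lborel (snd i) * \<phi>' (fst i) - (\<phi> (Sup (snd i)) - \<phi> (Inf (snd i)))\<bar> \<le> e' * (Sup (snd i) - Inf (snd i))"
        using uv(1,2,3) by simp
    qed
    also have "\<dots> \<le> (\<Sum>i\<in>p. e' * (Sup (snd i) - Inf (snd i)))"
    proof (rule sum_mono2)
      fix i assume "i \<in> p - (p - p1)"
      then show "0 \<le> e' * (Sup (snd i) - Inf (snd i))"
        using elem[of "fst i" "snd i"] \<open>e' > 0\<close> by auto
    qed (use fin in auto)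
    also have "\<dots> = e' * (b - a)"
      using additive_tagged_division_1[OF \<open>a \<le> b\<close> p, of "\<lambda>x. x"]
      by (simp add: sum_distrib_left[symmetric] case_prod_unfold)
    also have "\<dots> \<le> e / 4" using \<open>e > 0\<close> \<open>a \<le> b\<close> by (simp add: e'_def field_simps)
    finally have s2: "(\<Sum>i\<in>p - p1. \<bar>measure lborel (snd i) * \<phi>' (fst i) - (\<phi> (Sup (snd i)) - \<phi> (Inf (snd i)))\<bar>) \<le> e / 4" .
    have "(\<Sum>(x, k)\<in>p. measure lborel k *\<^sub>R \<phi>' x) - (\<phi> b - \<phi> a)
       = (\<Sum>i\<in>p. measure lborel (snd i) * \<phi>' (fst i) - (\<phi> (Sup (snd i)) - \<phi> (Inf (snd i))))"
      using additive_tagged_division_1[OF \<open>a \<le> b\<close> p, of \<phi>]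
      by (simp add: sum_subtractf case_prod_unfold)
    also have "norm \<dots> \<le> (\<Sum>i\<in>p. \<bar>measure lborel (snd i) * \<phi>' (fst i) - (\<phi> (Sup (snd i)) - \<phi> (Inf (snd i)))\<bar>)"
      by (simp add: sum_abs)
    also have "\<dots> = (\<Sum>i\<in>p - p1. \<bar>measure lborel (snd i) * \<phi>' (fst i) - (\<phi> (Sup (snd i)) - \<phi> (Inf (snd i)))\<bar>) +
       (\<Sum>i\<in>p1. \<bar>measure lborel (snd i) * \<phi>' (fst i) - (\<phi> (Sup (snd i)) - \<phi> (Inf (snd i)))\<bar>)"
      using fin by (intro sum.subset_diff) (auto simp: p1_def)
    finally show ?case using s1 s2 \<open>e > 0\<close> by linarith
  qed
qed

section \<open>Stability of quasi-geodesics\<close>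

locale hyperbolic_geodesic_space = Metric_space M d for M :: "'a set" and d +
  fixes \<delta> :: real
  assumes \<delta>_nonneg: "\<delta> \<ge> 0"
    and geodesic: "geodesic_metric M d"
    and hyperbolic: "\<lbrakk>w \<in> M; x \<in> M; y \<in> M; z \<in> M\<rbrakk> \<Longrightarrow>
      gromov_product d w x y \<ge> min (gromov_product d w x z) (gromov_product d w z y) - \<delta>"
begin

lemma gromov_product_commute: "gromov_product d w x y = gromov_product d w y x"
  by (simp add: gromov_product_def commute add.commute)

lemma gromov_product_ge_dist_diff:
  assumes "p \<in> M" "u \<in> M" "v \<in> M"
  shows "d p u \<le> gromov_product d p u v + d u v"
  using triangle[of p v u] assms commute[of u p] commute[of v u] unfolding gromov_product_def
  by (simp add: field_simps)

lemma gromov_product_base_change: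
  assumes "p \<in> M" "q \<in> M" "x \<in> M" "y \<in> M"
  shows "gromov_product d p x y \<le> gromov_product d q x y + d p q"
  using triangle[of x q p] triangle[of p q y] assms commute[of q p] unfolding gromov_product_def
  by (simp add: field_simps)

text \<open>Each halving of the chain costs one \<delta>, and one of the two halves inherits the
  bound.\<close>

lemma gromov_product_chain:
  assumes "p \<in> M" and "\<And>i. i \<le> 2 ^ k \<Longrightarrow> u i \<in> M"
  shows "\<exists>i < 2 ^ k. gromov_product d p (u i) (u (Suc i)) \<le> gromov_product d p (u 0) (u (2 ^ k)) + real k * \<delta>"
  using assms(2)
proof (induction k arbitrary: u)
  case 0
  then show ?case by (auto intro!: exI[of _ 0])
next
  case (Suc k)
  let ?m = "2 ^ k :: nat"
  have M: "u 0 \<in> M" "u ?m \<in> M" "u (2 * ?m) \<in> M" using Suc.prems by auto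
  have "gromov_product d p (u 0) (u (2 * ?m)) \<ge>
      min (gromov_product d p (u 0) (u ?m)) (gromov_product d p (u ?m) (u (2 * ?m))) - \<delta>"
    using hyperbolic[OF assms(1) M(1) M(3) M(2)] .
  then consider "gromov_product d p (u 0) (u ?m) \<le> gromov_product d p (u 0) (u (2 * ?m)) + \<delta>"
    | "gromov_product d p (u ?m) (u (2 * ?m)) \<le> gromov_product d p (u 0) (u (2 * ?m)) + \<delta>"
    by linarith
  then show ?case
  proof cases
    case 1
    have "\<exists>i < 2 ^ k. gromov_product d p (u i) (u (Suc i)) \<le> gromov_product d p (u 0) (u ?m) + real k * \<delta>"
      by (rule Suc.IH) (use Suc.prems in auto)
    then obtain i where "i < 2 ^ k" "gromov_product d p (u i) (u (Suc i)) \<le> gromov_product d p (u 0) (u ?m) + real k * \<delta>"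
      by blast
    with 1 show ?thesis by (intro exI[of _ i]) (auto simp: algebra_simps)
  next
    case 2
    have "\<exists>i < 2 ^ k. gromov_product d p (u (?m + i)) (u (?m + Suc i))
        \<le> gromov_product d p (u (?m + 0)) (u (?m + ?m)) + real k * \<delta>"
      by (rule Suc.IH) (use Suc.prems in auto)
    then obtain i where "i < 2 ^ k"
      "gromov_product d p (u (?m + i)) (u (?m + Suc i)) \<le> gromov_product d p (u ?m) (u (2 * ?m)) + real k * \<delta>"
      by (auto simp: mult_2)
    with 2 show ?thesis by (intro exI[of _ "?m + i"]) (auto simp: algebra_simps)
  qed
qed

text \<open>Cut the parameter interval into \<open>2 ^ k\<close> steps. A step whose end points have
  small Gromov product at \<open>p\<close> passes close to \<open>p\<close>, up to its own length.
  The loss \<open>k * \<delta>\<close> is only logarithmic in the number of steps, so a path that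
  avoids \<open>p\<close> must be exponentially long.\<close>

lemma Lipschitz_path_near_point:
  assumes "p \<in> M" "a \<le> b" and g: "\<And>t. t \<in> {a..b} \<Longrightarrow> g t \<in> M"
    and lip: "\<And>s t. \<lbrakk>s \<in> {a..b}; t \<in> {a..b}\<rbrakk> \<Longrightarrow> d (g s) (g t) \<le> L * \<bar>s - t\<bar>"
  shows "\<exists>t\<in>{a..b}. d p (g t) \<le> gromov_product d p (g a) (g b) + real k * \<delta> + L * (b - a) / 2 ^ k"
proof -
  define h where "h i = a + (b - a) * real i / 2 ^ k" for i :: nat
  have h: "h i \<in> {a..b}" if "i \<le> 2 ^ k" for i
  proof -
    have "real i \<le> 2 ^ k" using that by (metis of_nat_le_iff of_nat_numeral of_nat_power)
    then have "(b - a) * (real i / 2 ^ k) \<le> (b - a) * 1" using \<open>a \<le> b\<close> by (intro mult_left_mono) auto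
    then show ?thesis using \<open>a \<le> b\<close> by (auto simp: h_def)
  qed
  have h0: "h 0 = a" and h1: "h (2 ^ k) = b" by (auto simp: h_def)
  obtain i where i: "i < 2 ^ k"
    "gromov_product d p (g (h i)) (g (h (Suc i))) \<le> gromov_product d p (g (h 0)) (g (h (2 ^ k))) + real k * \<delta>"
    using gromov_product_chain[OF assms(1), of k "\<lambda>i. g (h i)"] g h by blast
  have hi: "h i \<in> {a..b}" "h (Suc i) \<in> {a..b}" using h i by auto
  have "h (Suc i) - h i = (b - a) / 2 ^ k" by (simp add: h_def field_simps)
  then have "\<bar>h i - h (Suc i)\<bar> = (b - a) / 2 ^ k" using \<open>a \<le> b\<close> by (subst abs_minus_commute) simp
  then have "d (g (h i)) (g (h (Suc i))) \<le> L * (b - a) / 2 ^ k"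
    using lip[OF hi] by simp
  moreover have "d p (g (h i)) \<le> gromov_product d p (g (h i)) (g (h (Suc i))) + d (g (h i)) (g (h (Suc i)))"
    by (intro gromov_product_ge_dist_diff) (use assms(1) g hi in auto)
  ultimately show ?thesis
    using i hi h0 h1 by (intro bexI[of _ "h i"]) auto
qed

text \<open>Let \<open>p\<close> be a point of the geodesic at nearly maximal distance \<open>D\<close> from the quasi-geodesic, and
  walk along the geodesic by \<open>2 D\<close> to both sides of \<open>p\<close>.  Between points near the two ends, the
  quasi-geodesic has parameter length at most \<open>L (6 D + 2)\<close>, so that the fixed number \<open>k\<close> of halvings
  brings it within \<open>D / 2 + O(k \<delta>)\<close> of \<open>p\<close>; this bounds \<open>D\<close>.\<close>

lemma geodesic_near_quasi_geodesic:
  assumes "L \<ge> 1" "a \<le> b" and g: "\<And>t. t \<in> {a..b} \<Longrightarrow> g t \<in> M"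
    and up: "\<And>s t. \<lbrakk>s \<in> {a..b}; t \<in> {a..b}\<rbrakk> \<Longrightarrow> d (g s) (g t) \<le> L * \<bar>s - t\<bar>"
    and lo: "\<And>s t. \<lbrakk>s \<in> {a..b}; t \<in> {a..b}\<rbrakk> \<Longrightarrow> \<bar>s - t\<bar> \<le> L * d (g s) (g t)"
    and k: "12 * L\<^sup>2 \<le> 2 ^ k"
    and c: "\<And>s. s \<in> {0..l} \<Longrightarrow> c s \<in> M" "c 0 = g a" "c l = g b" "l \<ge> 0"
      "\<And>s t. \<lbrakk>s \<in> {0..l}; t \<in> {0..l}\<rbrakk> \<Longrightarrow> d (c s) (c t) = \<bar>s - t\<bar>"
    and s: "s \<in> {0..l}"
  shows "\<exists>t\<in>{a..b}. d (c s) (g t) \<le> 4 * \<delta> + 2 * real k * \<delta> + 4"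
proof -
  have ab: "a \<in> {a..b}" "b \<in> {a..b}" using \<open>a \<le> b\<close> by auto
  define h where "h s = (INF t\<in>{a..b}. d (c s) (g t))" for s
  have hle: "h s \<le> d (c s) (g t)" if "t \<in> {a..b}" for s t
    unfolding h_def by (rule cINF_lower[OF _ that]) (auto intro: bdd_belowI[of _ 0])
  have hbd: "h s \<le> l" if "s \<in> {0..l}" for s
    using hle[OF ab(1), of s] c(5)[OF that, of 0] c(2,4) that by auto
  define D where "D = (SUP s\<in>{0..l}. h s)"
  have hD: "h s \<le> D" if "s \<in> {0..l}" for s
    unfolding D_def by (rule cSUP_upper[OF that]) (use hbd in \<open>auto intro: bdd_aboveI[of _ l]\<close>)
  have "h s \<ge> 0" for s unfolding h_def by (rule cINF_greatest) (use ab in auto)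
  then have "D \<ge> 0" using hD[OF s] by (meson order_trans)
  have near: "\<exists>t\<in>{a..b}. d (c s) (g t) < D + 1" if "s \<in> {0..l}" for s
  proof -
    have "h s < D + 1" using hD[OF that] by simp
    then show ?thesis unfolding h_def
      by (subst (asm) cINF_less_iff) (use ab in \<open>auto intro: bdd_belowI[of _ 0]\<close>)
  qed
  have "D \<le> 4 * \<delta> + 2 * real k * \<delta> + 3"
  proof (cases "D - 1 \<le> 2 * \<delta>")
    case True
    have "0 \<le> real k * \<delta>" using \<delta>_nonneg by simp
    then show ?thesis using True \<delta>_nonneg by linarith
  next
    case False
    \<comment> \<open>Neither the supremum nor the infimum need be attained; hence
      \<open>D - 1\<close> here and \<open>D + 1\<close> in \<open>near\<close>.\<close>
    have "D - 1 < D" by simp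
    then obtain s where s: "s \<in> {0..l}" "D - 1 < h s"
      unfolding D_def by (subst (asm) less_cSUP_iff) (use hbd \<open>l \<ge> 0\<close> in \<open>auto intro: bdd_aboveI[of _ l]\<close>)
    let ?p = "c s"
    have pM: "?p \<in> M" using c(1) s by auto
    have far: "D - 1 < d ?p (g t)" if "t \<in> {a..b}" for t using hle[OF that, of s] s by linarith
    \<comment> \<open>At distance \<open>2 * D\<close> from \<open>?p\<close>, a detour of length
      \<open>D + 1\<close> to the quasi-geodesic keeps the Gromov product at \<open>?p\<close> above
      \<open>D - 1\<close>. If the geodesic ends earlier, its end point already lies on the
      quasi-geodesic.\<close>
    have side: "\<exists>s'\<in>{0..l}. \<exists>t\<in>{a..b}. (if up then s \<le> s' else s' \<le> s) \<and> \<bar>s - s'\<bar> \<le> 2 * D \<and> d (c s') (g t) \<le> D + 1 \<and>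
        gromov_product d ?p (c s') (g t) \<ge> D - 1" for up
    proof -
      define s' where "s' = (if up then s + 2 * D else s - 2 * D)"
      define e where "e = (if up then l else 0)"
      define te where "te = (if up then b else a)"
      have e: "e \<in> {0..l}" "te \<in> {a..b}" "c e = g te" using c ab by (auto simp: e_def te_def)
      show ?thesis
      proof (cases "s' \<in> {0..l}")
        case True
        obtain t where t: "t \<in> {a..b}" "d (c s') (g t) < D + 1" using near[OF True] by blast
        have "d (c s') ?p = 2 * D" using c(5)[OF True s(1)] \<open>D \<ge> 0\<close> by (auto simp: s'_def split: if_splits)
        then have "gromov_product d ?p (c s') (g t) \<ge> D - 1"
          using t far[OF t(1)] unfolding gromov_product_def by simp
        then show ?thesis using True t \<open>D \<ge> 0\<close>
          by (intro bexI[of _ s'] bexI[of _ t]) (auto simp: s'_def)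
      next
        case False
        have eM: "c e \<in> M" by (rule c(1)[OF e(1)])
        have "gromov_product d ?p (c e) (g te) = d ?p (c e)"
          using e(3) eM commute[of ?p "c e"] by (simp add: gromov_product_def e(3)[symmetric])
        then have "gromov_product d ?p (c e) (g te) \<ge> D - 1"
          using far[OF e(2)] e(3) by simp
        moreover have "\<bar>s - e\<bar> \<le> 2 * D" "if up then s \<le> e else e \<le> s"
          using False s(1) \<open>D \<ge> 0\<close> by (auto simp: s'_def e_def split: if_splits)
        moreover have "d (c e) (g te) \<le> D + 1" using e(3) eM \<open>D \<ge> 0\<close> by (simp add: e(3)[symmetric])
        ultimately show ?thesis using e by blast
      qed
    qed
    obtain s1 t1 where 1: "s1 \<in> {0..l}" "t1 \<in> {a..b}" "s1 \<le> s" "\<bar>s - s1\<bar> \<le> 2 * D" "d (c s1) (g t1) \<le> D + 1"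
        "gromov_product d ?p (c s1) (g t1) \<ge> D - 1"
      using side[of False] by auto
    obtain s2 t2 where 2: "s2 \<in> {0..l}" "t2 \<in> {a..b}" "s \<le> s2" "\<bar>s - s2\<bar> \<le> 2 * D" "d (c s2) (g t2) \<le> D + 1"
        "gromov_product d ?p (c s2) (g t2) \<ge> D - 1"
      using side[of True] by auto
    have M: "c s1 \<in> M" "c s2 \<in> M" "g t1 \<in> M" "g t2 \<in> M" using c(1) g 1 2 by auto
    have "gromov_product d ?p (c s1) (c s2) = 0"
      using c(5)[OF 1(1) s(1)] c(5)[OF s(1) 2(1)] c(5)[OF 1(1) 2(1)] 1(3) 2(3)
      by (simp add: gromov_product_def)
    moreover have "gromov_product d ?p (c s1) (c s2) \<ge>
       min (gromov_product d ?p (c s1) (g t1)) (gromov_product d ?p (g t1) (c s2)) - \<delta>"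
      by (intro hyperbolic pM M)
    moreover have "gromov_product d ?p (g t1) (c s2) \<ge>
       min (gromov_product d ?p (g t1) (g t2)) (gromov_product d ?p (g t2) (c s2)) - \<delta>"
      by (intro hyperbolic pM M)
    moreover have "gromov_product d ?p (g t2) (c s2) \<ge> D - 1" using 2(6) gromov_product_commute by metis
    \<comment> \<open>The outer products exceed \<open>2 * \<delta>\<close> while the product of
      \<open>c s1\<close> and \<open>c s2\<close> vanishes, so in both minima it is the middle
      product that must be small.\<close>
    ultimately have gp: "gromov_product d ?p (g t1) (g t2) \<le> 2 * \<delta>"
      using 1(6) False \<delta>_nonneg by linarith
    have "d (g t1) (g t2) \<le> d (g t1) (c s1) + (d (c s1) (c s2) + d (c s2) (g t2))"
      using triangle[OF M(3,1,4)] triangle[OF M(1,2,4)] by linarith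
    also have "\<dots> \<le> (D + 1) + (4 * D + (D + 1))"
      using 1 2 c(5)[OF 1(1) 2(1)] commute[of "g t1" "c s1"] by (intro add_mono) auto
    finally have "d (g t1) (g t2) \<le> 6 * D + 2" by simp
    then have "L * d (g t1) (g t2) \<le> L * (6 * D + 2)" using \<open>L \<ge> 1\<close> by (intro mult_left_mono) auto
    then have tt: "\<bar>t1 - t2\<bar> \<le> L * (6 * D + 2)" using lo[OF 1(2) 2(2)] by linarith
    define u v where "u = min t1 t2" and "v = max t1 t2"
    have uv: "u \<le> v" "{u..v} \<subseteq> {a..b}" "v - u = \<bar>t1 - t2\<bar>" using 1 2 by (auto simp: u_def v_def)
    have "gromov_product d ?p (g u) (g v) \<le> 2 * \<delta>"
      using gp gromov_product_commute[of ?p "g t1" "g t2"] by (auto simp: u_def v_def min_def max_def)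
    moreover have "\<exists>t\<in>{u..v}. d ?p (g t) \<le> gromov_product d ?p (g u) (g v) + real k * \<delta> + L * (v - u) / 2 ^ k"
      by (rule Lipschitz_path_near_point[OF pM uv(1)]) (use g up uv(2) in auto)
    ultimately obtain t where t: "t \<in> {u..v}" "d ?p (g t) \<le> 2 * \<delta> + real k * \<delta> + L * (v - u) / 2 ^ k"
      by force
    \<comment> \<open>The factor 12 in the choice of \<open>k\<close> makes a single step at most
      \<open>D / 2 + 1 / 6\<close>, so that half of \<open>D\<close> can be absorbed on the
      left.\<close>
    have "L * (v - u) \<le> L * (L * (6 * D + 2))"
      unfolding uv(3) using tt \<open>L \<ge> 1\<close> by (intro mult_left_mono) auto
    also have "\<dots> = L\<^sup>2 * (6 * D + 2)" by (simp add: power2_eq_square)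
    also have "\<dots> \<le> 2 ^ k / 12 * (6 * D + 2)"
      using k \<open>D \<ge> 0\<close> by (intro mult_right_mono) auto
    finally have "L * (v - u) / 2 ^ k \<le> (6 * D + 2) / 12" by (simp add: field_simps)
    moreover have "D - 1 < d ?p (g t)" using far t uv by blast
    moreover have "2 * real k * \<delta> = 2 * (real k * \<delta>)" "(6 * D + 2) / 12 = D / 2 + 1 / 6" by simp_all
    ultimately show ?thesis using t(2) by linarith
  qed
  then show ?thesis using near[OF s] by force
qed

text \<open>A point \<open>g t\<close> near a geodesic from \<open>g a\<close> to \<open>g b\<close>
  has a small Gromov product at \<open>g t\<close>, and only this form is used later. The geodesic
  stays near \<open>g\<close>; moving along it, one passes from points near \<open>g\<close> before
  time \<open>t\<close> to points near \<open>g\<close> after time \<open>t\<close>. Where this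
  happens, the two parameters are close to each other and hence to \<open>t\<close>.\<close>

lemma quasi_geodesic_stability:
  assumes "L \<ge> 1"
  shows "\<exists>C\<ge>0. \<forall>a b g t. a \<le> b \<and> t \<in> {a..b} \<and> (\<forall>s\<in>{a..b}. g s \<in> M) \<and>
      (\<forall>s\<in>{a..b}. \<forall>t\<in>{a..b}. d (g s) (g t) \<le> L * \<bar>s - t\<bar> \<and> \<bar>s - t\<bar> \<le> L * d (g s) (g t)) \<longrightarrow>
      gromov_product d (g t) (g a) (g b) \<le> C"
proof -
  obtain k :: nat where k: "12 * L\<^sup>2 \<le> 2 ^ k"
    using real_arch_pow[of 2 "12 * L\<^sup>2"] by (auto intro: less_imp_le)
  define R where "R = 4 * \<delta> + 2 * real k * \<delta> + 4"
  have "R \<ge> 0" using \<delta>_nonneg by (simp add: R_def)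
  show ?thesis
  \<comment> \<open>\<open>2 * R + 1\<close> bounds the distance of the two points of
    \<open>g\<close> on either side of \<open>t\<close>, the factors \<open>L\<close> convert it to
    parameters and back, and the last \<open>R\<close> leads to the geodesic.\<close>
  proof (intro exI[of _ "L * (L * (2 * R + 1)) + R"] conjI allI impI, goal_cases)
    case 1
    show ?case using \<open>L \<ge> 1\<close> \<open>R \<ge> 0\<close> by simp
  next
    case (2 a b g t)
    then have "a \<le> b" and t: "t \<in> {a..b}" and g: "\<And>s. s \<in> {a..b} \<Longrightarrow> g s \<in> M"
      and up: "\<And>s t. \<lbrakk>s \<in> {a..b}; t \<in> {a..b}\<rbrakk> \<Longrightarrow> d (g s) (g t) \<le> L * \<bar>s - t\<bar>"
      and lo: "\<And>s t. \<lbrakk>s \<in> {a..b}; t \<in> {a..b}\<rbrakk> \<Longrightarrow> \<bar>s - t\<bar> \<le> L * d (g s) (g t)" by auto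
    have ab: "a \<in> {a..b}" "b \<in> {a..b}" using \<open>a \<le> b\<close> by auto
    define l where "l = d (g a) (g b)"
    have "l \<ge> 0" by (simp add: l_def)
    obtain c where c0: "c ` {0..l} \<subseteq> M" "c 0 = g a" "c l = g b"
      "\<forall>s\<in>{0..l}. \<forall>t\<in>{0..l}. d (c s) (c t) = \<bar>s - t\<bar>"
      using geodesic g ab unfolding geodesic_metric_def l_def by meson
    then have c: "\<And>s. s \<in> {0..l} \<Longrightarrow> c s \<in> M"
      "\<And>s t. \<lbrakk>s \<in> {0..l}; t \<in> {0..l}\<rbrakk> \<Longrightarrow> d (c s) (c t) = \<bar>s - t\<bar>" by auto
    have near: "\<exists>t\<in>{a..b}. d (c s) (g t) \<le> R" if "s \<in> {0..l}" for s
      unfolding R_def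
      by (rule geodesic_near_quasi_geodesic[OF \<open>L \<ge> 1\<close> \<open>a \<le> b\<close> g up lo k c(1) c0(2,3) \<open>l \<ge> 0\<close> c(2) that])
    \<comment> \<open>The supremum of \<open>A\<close> replaces a connectedness argument: just
      before it the geodesic is near the part of \<open>g\<close> up to \<open>t\<close>, just after
      it near the part from \<open>t\<close> on.\<close>
    define A where "A = {s \<in> {0..l}. \<exists>t'\<in>{a..t}. d (c s) (g t') \<le> R}"
    have "0 \<in> A" using c0(2) g[OF ab(1)] t \<open>R \<ge> 0\<close> \<open>l \<ge> 0\<close> unfolding A_def by (auto intro!: bexI[of _ a])
    have bdd: "bdd_above A" by (auto simp: A_def intro: bdd_aboveI[of _ l])
    obtain s1 where s1: "s1 \<in> A" "Sup A - 1/2 < s1"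
      using less_cSup_iff[of A "Sup A - 1/2"] \<open>0 \<in> A\<close> bdd by auto
    have SA: "s \<le> Sup A" if "s \<in> A" for s using cSup_upper[OF that bdd] .
    have "\<exists>s2\<in>{0..l}. \<bar>s1 - s2\<bar> \<le> 1 \<and> (\<exists>t'\<in>{t..b}. d (c s2) (g t') \<le> R)"
    proof (cases "Sup A + 1/2 \<le> l")
      case True
      let ?s = "Sup A + 1/2"
      have s: "?s \<in> {0..l}" using True SA[OF \<open>0 \<in> A\<close>] by auto
      have "?s \<notin> A" using SA[of ?s] by auto
      moreover obtain t' where "t' \<in> {a..b}" "d (c ?s) (g t') \<le> R" using near[OF s] by blast
      ultimately have "t' \<in> {t..b}" using s unfolding A_def by force
      then show ?thesis using \<open>d (c ?s) (g t') \<le> R\<close> s s1 SA[OF s1(1)] by (intro bexI[of _ ?s]) auto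
    next
      case False
      have "s1 \<le> l" using s1 by (auto simp: A_def)
      then show ?thesis
        using False s1 \<open>l \<ge> 0\<close> c0(3) g[OF ab(2)] t \<open>R \<ge> 0\<close> by (intro bexI[of _ l]) (auto intro!: bexI[of _ b])
    qed
    then obtain s2 t2 where 2: "s2 \<in> {0..l}" "\<bar>s1 - s2\<bar> \<le> 1" "t2 \<in> {t..b}" "d (c s2) (g t2) \<le> R" by blast
    obtain t1 where 1: "s1 \<in> {0..l}" "t1 \<in> {a..t}" "d (c s1) (g t1) \<le> R" using s1 by (auto simp: A_def)
    have tt: "t1 \<in> {a..b}" "t2 \<in> {a..b}" using 1 2 t by auto
    have M: "c s1 \<in> M" "c s2 \<in> M" "g t1 \<in> M" "g t2 \<in> M" "g t \<in> M" "g a \<in> M" "g b \<in> M"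
      using c g 1 2 tt t ab by auto
    have "d (g t1) (g t2) \<le> d (g t1) (c s1) + (d (c s1) (c s2) + d (c s2) (g t2))"
      using triangle[OF M(3,1,4)] triangle[OF M(1,2,4)] by linarith
    also have "\<dots> \<le> R + (1 + R)"
      using 1 2 c(2)[OF 1(1) 2(1)] commute[of "g t1" "c s1"] by (intro add_mono) auto
    finally have "L * d (g t1) (g t2) \<le> L * (2 * R + 1)" using \<open>L \<ge> 1\<close> by (intro mult_left_mono) auto
    then have "\<bar>t - t1\<bar> \<le> L * (2 * R + 1)" using lo[OF tt] 1(2) 2(3) by auto
    then have "L * \<bar>t - t1\<bar> \<le> L * (L * (2 * R + 1))" using \<open>L \<ge> 1\<close> by (intro mult_left_mono) auto
    then have "d (g t) (g t1) \<le> L * (L * (2 * R + 1))" using up[OF t tt(1)] by linarith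
    then have "d (g t) (c s1) \<le> L * (L * (2 * R + 1)) + R"
      using triangle[OF M(5,3,1)] 1(3) commute[of "g t1" "c s1"] by linarith
    moreover have "gromov_product d (c s1) (g a) (g b) = 0"
    proof -
      have "0 \<in> {0..l}" "l \<in> {0..l}" using \<open>l \<ge> 0\<close> by auto
      then show ?thesis
        using c(2)[OF _ 1(1), of 0] c(2)[OF 1(1), of l] c(2)[of 0 l] c0(2,3) 1(1)
        by (simp add: gromov_product_def)
    qed
    ultimately show ?case using gromov_product_base_change[OF M(5,1,6,7)] by linarith
  qed
qed

end

section \<open>Estimates for the Kobayashi metric of a bounded convex domain\<close>

text \<open>The Hermitian inner product, linear in \<open>x\<close>. Its real part is the real inner
  product, so a real supporting hyperplane gives a complex linear map of \<Omega> into a half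
  plane.\<close>

definition cform :: "complex ^ 'n \<Rightarrow> complex ^ 'n \<Rightarrow> complex" where
  "cform a x = (\<Sum>i\<in>UNIV. cnj (a $ i) * x $ i)"

lemma norm_vector_scalar_mult: "norm (\<zeta> *s x) = cmod \<zeta> * norm (x :: complex ^ 'n)"
  by (simp add: norm_vec_def norm_mult L2_set_right_distrib)

lemma Re_cform: "Re (cform a x) = a \<bullet> x"
  by (simp add: cform_def inner_vec_def inner_complex_def)

lemma cform_simps:
  "cform a (x + y) = cform a x + cform a y" "cform a (x - y) = cform a x - cform a y" "cform a (- x) = - cform a x"
  "cform a (\<zeta> *s x) = \<zeta> * cform a x" "cform a (c *\<^sub>R x) = c *\<^sub>R cform a x" "cform a 0 = 0"
  by (simp_all add: cform_def sum.distrib sum_subtractf sum_negf algebra_simps sum_distrib_left scaleR_sum_right)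

text \<open>A unimodular factor on \<open>x\<close> makes the value real and non-negative, and then
  the real Cauchy-Schwarz inequality applies.\<close>

lemma norm_cform_le: "cmod (cform a x) \<le> norm a * norm x"
proof (cases "cform a x = 0")
  case False
  define \<zeta> where "\<zeta> = cnj (sgn (cform a x))"
  have "cmod \<zeta> = 1" using False by (simp add: \<zeta>_def norm_sgn)
  have "\<zeta> * cform a x = of_real (cmod (cform a x))"
    using False by (simp add: \<zeta>_def sgn_eq complex_norm_square[symmetric] power2_eq_square mult.commute)
  then have "cmod (cform a x) = Re (cform a (\<zeta> *s x))" by (simp add: cform_simps)
  also have "\<dots> \<le> norm a * norm (\<zeta> *s x)" unfolding Re_cform by (rule norm_cauchy_schwarz)
  finally show ?thesis using \<open>cmod \<zeta> = 1\<close> by (simp add: norm_vector_scalar_mult)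
qed simp

lemma bounded_linear_cform: "bounded_linear (cform a)"
  by (rule bounded_linear_intro[of _ "norm a"]) (use norm_cform_le[of a] in \<open>simp_all add: mult.commute cform_simps\<close>)

text \<open>The Cayley transform that sends \<open>h 0\<close> to 0 reduces this to the Schwarz
  lemma; its derivative at \<open>h 0\<close> is \<open>1 / (2 * Re (h 0))\<close>.\<close>

lemma Schwarz_half_plane:
  assumes hol: "h holomorphic_on ball 0 1" and pos: "\<And>z. cmod z < 1 \<Longrightarrow> Re (h z) > 0"
  shows "cmod (deriv h 0) \<le> 2 * Re (h 0)"
proof -
  define w where "w = h 0"
  have w: "Re w > 0" using pos[of 0] by (simp add: w_def)
  define g where "g z = (h z - w) / (h z + cnj w)" for z
  have nz: "h z + cnj w \<noteq> 0" if "cmod z < 1" for z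
  proof
    assume "h z + cnj w = 0"
    then have "Re (h z + cnj w) = 0" by simp
    then have "Re (h z) + Re w = 0" by simp
    then show False using pos[OF that] w by simp
  qed
  have "g holomorphic_on ball 0 1"
    unfolding g_def using hol nz by (intro holomorphic_intros) auto
  moreover have "g 0 = 0" by (simp add: g_def w_def)
  moreover have "cmod (g z) < 1" if "cmod z < 1" for z
  proof -
    have "(cmod (h z - w))\<^sup>2 < (cmod (h z + cnj w))\<^sup>2"
      using mult_pos_pos[OF pos[OF that] w] unfolding cmod_power2 by (simp add: power2_eq_square algebra_simps)
    then have "cmod (h z - w) < cmod (h z + cnj w)" by (rule power2_less_imp_less) simp
    then show ?thesis using nz[OF that] by (simp add: g_def norm_divide)
  qed
  ultimately have 1: "cmod (deriv g 0) \<le> 1"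
    by (rule Schwarz_Lemma(2)[of g 0]) auto
  have "(h has_field_derivative deriv h 0) (at 0)"
    using hol by (intro holomorphic_derivI[of _ "ball 0 1"]) auto
  then have "(g has_field_derivative (deriv h 0 * (h 0 + cnj w) - (h 0 - w) * deriv h 0) / ((h 0 + cnj w) * (h 0 + cnj w))) (at 0)"
    unfolding g_def using nz[of 0] by (auto intro!: derivative_eq_intros)
  then have "deriv g 0 = deriv h 0 / (w + cnj w)"
    using nz[of 0] by (auto simp: w_def dest: DERIV_imp_deriv)
  also have "w + cnj w = of_real (2 * Re w)" by (simp add: complex_add_cnj)
  finally show ?thesis using 1 w by (simp add: norm_divide w_def field_simps)
qed

text \<open>Membership in the set whose infimum is the metric serves twice: for the upper bound, and
  for the non-emptiness required by the lower bound.\<close>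

lemma affine_disc_admissible:
  fixes \<Omega> :: "(complex ^ 'n) set"
  assumes "r > 0" and disc: "\<And>\<zeta>. cmod \<zeta> < r \<Longrightarrow> x + \<zeta> *s v \<in> \<Omega>"
  shows "1 / r \<in> {norm \<xi> | \<xi>. \<exists>f :: complex \<Rightarrow> complex ^ 'n.
            (\<forall>i. (\<lambda>z. f z $ i) holomorphic_on ball 0 1) \<and> f ` ball 0 1 \<subseteq> \<Omega> \<and> f 0 = x \<and>
            (\<chi> i. \<xi> * deriv (\<lambda>z. f z $ i) 0) = v}"
proof -
  define f where "f z = x + (z * of_real r) *s v" for z :: complex
  have "(\<lambda>z. f z $ i) holomorphic_on ball 0 1" for i
    unfolding f_def by (simp add: vector_scalar_mult_def) (intro holomorphic_intros)
  moreover have "f ` ball 0 1 \<subseteq> \<Omega>"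
    using disc \<open>r > 0\<close> by (auto simp: f_def norm_mult)
  moreover have "f 0 = x" by (simp add: f_def vec_eq_iff)
  moreover have "deriv (\<lambda>z. f z $ i) 0 = of_real r * v $ i" for i
    by (rule DERIV_imp_deriv) (auto simp: f_def intro!: derivative_eq_intros)
  then have "(\<chi> i. of_real (1 / r) * deriv (\<lambda>z. f z $ i) 0) = v" using \<open>r > 0\<close> by (simp add: vec_eq_iff)
  moreover have "1 / r = norm (of_real (1 / r) :: complex)" using \<open>r > 0\<close> by (simp add: norm_divide)
  ultimately show ?thesis by blast
qed

lemma kobayashi_metric_upper:
  assumes "r > 0" and disc: "\<And>\<zeta>. cmod \<zeta> < r \<Longrightarrow> x + \<zeta> *s v \<in> \<Omega>"
  shows "kobayashi_metric \<Omega> x v \<le> 1 / r"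
  unfolding kobayashi_metric_def
  by (rule cInf_lower[OF affine_disc_admissible[OF assms]]) (auto intro!: bdd_belowI[of _ 0])

text \<open>\<open>r\<close> is independent of \<open>p\<close>, so that one radius serves a whole
  segment.\<close>

lemma small_disc_in_ball:
  assumes "e > 0"
  obtains r where "r > 0" "\<And>p \<zeta>. cmod \<zeta> < r \<Longrightarrow> p + \<zeta> *s v \<in> ball p e"
proof
  have n: "norm v + 1 > 0" using norm_ge_zero[of v] by linarith
  then show "e / (norm v + 1) > 0" using assms by simp
  fix p and \<zeta> :: complex assume "cmod \<zeta> < e / (norm v + 1)"
  then have "cmod \<zeta> * (norm v + 1) < e" using n by (simp only: pos_less_divide_eq)
  moreover have "cmod \<zeta> * norm v \<le> cmod \<zeta> * (norm v + 1)" by (intro mult_left_mono) auto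
  ultimately have "norm (\<zeta> *s v) < e" unfolding norm_vector_scalar_mult by linarith
  then show "p + \<zeta> *s v \<in> ball p e" by (simp only: mem_ball dist_norm) (simp add: norm_minus_commute)
qed

text \<open>Followed by \<open>cform a\<close>, every competing disc becomes a holomorphic function
  into the right half plane, to which the Schwarz lemma applies.\<close>

lemma kobayashi_metric_lower:
  fixes \<Omega> :: "(complex ^ 'n) set"
  assumes "open \<Omega>" "x \<in> \<Omega>" and pos: "\<And>y. y \<in> \<Omega> \<Longrightarrow> Re (cform a (y - q)) > 0"
  shows "cmod (cform a v) / (2 * Re (cform a (x - q))) \<le> kobayashi_metric \<Omega> x v"
  unfolding kobayashi_metric_def
proof (rule cInf_greatest)
  obtain e where e: "e > 0" "ball x e \<subseteq> \<Omega>" using assms(1,2) by (meson open_contains_ball)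
  obtain r where "r > 0" "\<And>p \<zeta>. cmod \<zeta> < r \<Longrightarrow> p + \<zeta> *s v \<in> ball p e"
    using small_disc_in_ball[OF e(1)] by blast
  then have "1 / r \<in> {norm \<xi> | \<xi>. \<exists>f :: complex \<Rightarrow> complex ^ 'n.
            (\<forall>i. (\<lambda>z. f z $ i) holomorphic_on ball 0 1) \<and> f ` ball 0 1 \<subseteq> \<Omega> \<and> f 0 = x \<and>
            (\<chi> i. \<xi> * deriv (\<lambda>z. f z $ i) 0) = v}"
    using e(2) by (intro affine_disc_admissible) auto
  then show "{norm \<xi> | \<xi>. \<exists>f :: complex \<Rightarrow> complex ^ 'n.
            (\<forall>i. (\<lambda>z. f z $ i) holomorphic_on ball 0 1) \<and> f ` ball 0 1 \<subseteq> \<Omega> \<and> f 0 = x \<and>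
            (\<chi> i. \<xi> * deriv (\<lambda>z. f z $ i) 0) = v} \<noteq> {}" by blast
next
  fix r assume "r \<in> {norm \<xi> | \<xi>. \<exists>f :: complex \<Rightarrow> complex ^ 'n.
            (\<forall>i. (\<lambda>z. f z $ i) holomorphic_on ball 0 1) \<and> f ` ball 0 1 \<subseteq> \<Omega> \<and> f 0 = x \<and>
            (\<chi> i. \<xi> * deriv (\<lambda>z. f z $ i) 0) = v}"
  then obtain \<xi> f where r: "r = norm \<xi>" and hol: "\<And>i. (\<lambda>z. f z $ i) holomorphic_on ball 0 1"
    and f: "f ` ball 0 1 \<subseteq> \<Omega>" "f 0 = x" and v: "(\<chi> i. \<xi> * deriv (\<lambda>z. f z $ i) 0) = v" by blast
  define h where "h z = cform a (f z - q)" for z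
  have h_hol: "h holomorphic_on ball 0 1"
    unfolding h_def cform_def using hol by (auto intro!: holomorphic_intros)
  have "((\<lambda>z. f z $ i) has_field_derivative deriv (\<lambda>z. f z $ i) 0) (at 0)" for i
    using hol[of i] by (intro holomorphic_derivI[of _ "ball 0 1"]) auto
  then have "(h has_field_derivative (\<Sum>i\<in>UNIV. cnj (a $ i) * deriv (\<lambda>z. f z $ i) 0)) (at 0)"
    unfolding h_def cform_def by (auto intro!: derivative_eq_intros simp: mult.commute)
  then have "deriv h 0 = (\<Sum>i\<in>UNIV. cnj (a $ i) * deriv (\<lambda>z. f z $ i) 0)" by (rule DERIV_imp_deriv)
  then have "cform a v = \<xi> * deriv h 0"
    unfolding v[symmetric] cform_def by (simp add: sum_distrib_left mult_ac)
  moreover have "cmod (deriv h 0) \<le> 2 * Re (h 0)"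
  proof (rule Schwarz_half_plane[OF h_hol])
    fix z :: complex assume "cmod z < 1"
    then have "f z \<in> \<Omega>" using f(1) by (auto simp: image_subset_iff)
    then show "Re (h z) > 0" unfolding h_def by (rule pos)
  qed
  ultimately have "cmod (cform a v) \<le> cmod \<xi> * (2 * Re (h 0))"
    by (simp add: norm_mult mult_left_mono)
  moreover have "Re (h 0) > 0" "h 0 = cform a (x - q)" using pos[OF assms(2)] f by (simp_all add: h_def)
  ultimately show "cmod (cform a v) / (2 * Re (cform a (x - q))) \<le> r" using r by (simp add: field_simps)
qed

section \<open>From the infinitesimal metric to length and distance\<close>

text \<open>A gauge integrable function need not be absolutely integrable. If the right-hand side is
  infinite there is nothing to show; otherwise \<open>f\<close> is Lebesgue integrable and both
  integrals agree.\<close>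

lemma has_integral_le_nn_integral_norm:
  fixes f :: "real \<Rightarrow> real"
  assumes f: "(f has_integral c) S"
  shows "ennreal c \<le> (\<integral>\<^sup>+t\<in>S. ennreal \<bar>f t\<bar> \<partial>lebesgue)"
proof -
  define g where "g t = (if t \<in> S then f t else 0)" for t
  have g: "(g has_integral c) UNIV" unfolding g_def using f by (simp add: has_integral_restrict_UNIV)
  have eq: "(\<integral>\<^sup>+t\<in>S. ennreal \<bar>f t\<bar> \<partial>lebesgue) = (\<integral>\<^sup>+t. ennreal (norm (g t)) \<partial>lebesgue)"
    by (intro nn_integral_cong) (auto simp: g_def)
  show ?thesis
  proof (cases "(\<integral>\<^sup>+t. ennreal (norm (g t)) \<partial>lebesgue) < \<infinity>")
    case True
    have "g \<in> borel_measurable lebesgue"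
      using has_integral_implies_lebesgue_measurable[OF g] by simp
    then have int: "integrable lebesgue g" using True by (rule integrableI_bounded)
    then have "(g has_integral (LINT t|lebesgue. g t)) UNIV" by (rule has_integral_integral_lebesgue)
    then have "(LINT t|lebesgue. g t) = c" using g has_integral_unique by blast
    then have "ennreal (norm c) \<le> (\<integral>\<^sup>+t. ennreal (norm (g t)) \<partial>lebesgue)"
      using integral_norm_bound_ennreal[OF int] by simp
    moreover have "ennreal c \<le> ennreal (norm c)" by (intro ennreal_leI) simp
    ultimately show ?thesis unfolding eq by (rule order_trans[rotated])
  next
    case False
    then show ?thesis unfolding eq by (simp add: not_less top.extremum_unique)
  qed
qed

text \<open>\<open>F\<close> is any function with differential bounded by the hyperbolic metric
  \<open>cmod w / (2 * Re z)\<close> of the right half plane. By compactness the curve stays where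
  \<open>Re z \<ge> m > 0\<close>; there \<open>F\<close> is Lipschitz, so \<open>F\<close> along
  the curve is absolutely continuous and the fundamental theorem applies.\<close>

lemma kobayashi_length_lower:
  fixes F :: "complex \<Rightarrow> real"
  assumes "open \<Omega>" and pos: "\<And>y. y \<in> \<Omega> \<Longrightarrow> Re (cform a (y - q)) > 0"
    and F: "\<And>z. Re z > 0 \<Longrightarrow> (F has_derivative F' z) (at z)"
    and F': "\<And>z w. Re z > 0 \<Longrightarrow> \<bar>F' z w\<bar> \<le> cmod w / (2 * Re z)"
    and "s \<le> t" and ac: "absolutely_continuous_curve s t \<sigma>" and \<sigma>: "\<sigma> ` {s..t} \<subseteq> \<Omega>"
  shows "ennreal (F (cform a (\<sigma> t - q)) - F (cform a (\<sigma> s - q))) \<le> kobayashi_length \<Omega> s t \<sigma>"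
proof -
  let ?l = "\<lambda>\<tau>. cform a (\<sigma> \<tau> - q)"
  have posl: "Re (?l \<tau>) > 0" if "\<tau> \<in> {s..t}" for \<tau> using that \<sigma> pos by blast
  have cont: "continuous_on {s..t} (\<lambda>\<tau>. Re (?l \<tau>))"
    using absolutely_continuous_curve_imp_continuous_on[OF ac] unfolding Re_cform
    by (intro continuous_intros)
  obtain \<tau>0 where \<tau>0: "\<tau>0 \<in> {s..t}" "\<forall>\<tau>\<in>{s..t}. Re (?l \<tau>0) \<le> Re (?l \<tau>)"
    using continuous_attains_inf[OF _ _ cont] \<open>s \<le> t\<close> by auto
  define m where "m = Re (?l \<tau>0)"
  have "m > 0" using posl \<tau>0 by (simp add: m_def)
  define \<phi> where "\<phi> \<tau> = F (?l \<tau>)" for \<tau>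
  have ac\<phi>: "absolutely_continuous_curve s t \<phi>"
  proof (rule absolutely_continuous_curve_Lipschitz[OF ac, of "1 / m * norm a"])
    fix \<tau> \<rho> assume \<tau>\<rho>: "\<tau> \<in> {s..t}" "\<rho> \<in> {s..t}"
    have "norm (F (?l \<tau>) - F (?l \<rho>)) \<le> 1 / m * norm (?l \<tau> - ?l \<rho>)"
    proof (rule differentiable_bound[of "{z. Re z \<ge> m}" F F'])
      show "convex {z. m \<le> Re z}" by (rule convex_halfspace_Re_ge)
      fix z assume z: "z \<in> {z. m \<le> Re z}"
      then have "Re z > 0" using \<open>m > 0\<close> by simp
      then show "(F has_derivative F' z) (at z within {z. m \<le> Re z})"
        by (rule has_derivative_at_withinI[OF F])
      show "onorm (F' z) \<le> 1 / m"
      proof (rule onorm_bound)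
        fix w
        have "norm (F' z w) \<le> cmod w / (2 * Re z)" using F'[OF \<open>Re z > 0\<close>] by simp
        also have "\<dots> \<le> cmod w / m" using z \<open>m > 0\<close> by (intro divide_left_mono) auto
        finally show "norm (F' z w) \<le> 1 / m * norm w" by simp
      qed (use \<open>m > 0\<close> in simp)
    qed (use \<tau>0(2) \<tau>\<rho> in \<open>auto simp: m_def\<close>)
    also have "?l \<tau> - ?l \<rho> = cform a (\<sigma> \<tau> - \<sigma> \<rho>)" by (simp add: cform_simps)
    also have "1 / m * cmod (cform a (\<sigma> \<tau> - \<sigma> \<rho>)) \<le> 1 / m * (norm a * norm (\<sigma> \<tau> - \<sigma> \<rho>))"
      using \<open>m > 0\<close> by (intro mult_left_mono norm_cform_le) auto
    finally show "dist (\<phi> \<tau>) (\<phi> \<rho>) \<le> 1 / m * norm a * dist (\<sigma> \<tau>) (\<sigma> \<rho>)"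
      by (simp add: dist_norm \<phi>_def)
  qed (use \<open>m > 0\<close> in auto)
  \<comment> \<open>The end points are added because almost everywhere differentiability is known on
    the open interval only.\<close>
  define N where "N = {s, t} \<union> {\<tau> \<in> {s<..<t}. \<not> \<sigma> differentiable at \<tau>}"
  have N: "negligible N" unfolding N_def
    using absolutely_continuous_differentiable_ae[OF ac] by (intro negligible_Un) auto
  define \<phi>' where "\<phi>' \<tau> = (if \<tau> \<in> N then 0 else F' (?l \<tau>) (cform a (vector_derivative \<sigma> (at \<tau>))))" for \<tau>
  have "(\<phi>' has_integral (\<phi> t - \<phi> s)) {s..t}"
  proof (rule absolutely_continuous_fundamental_theorem[OF ac\<phi> \<open>s \<le> t\<close> N])
    fix \<tau> assume \<tau>: "\<tau> \<in> {s..t} - N"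
    then have "\<sigma> differentiable at \<tau>" by (auto simp: N_def)
    then have "(\<sigma> has_vector_derivative vector_derivative \<sigma> (at \<tau>)) (at \<tau>)"
      by (simp add: vector_derivative_works)
    then have "((\<lambda>\<tau>. \<sigma> \<tau> - q) has_vector_derivative vector_derivative \<sigma> (at \<tau>)) (at \<tau>)"
      by (auto intro!: derivative_eq_intros)
    then have "(?l has_vector_derivative cform a (vector_derivative \<sigma> (at \<tau>))) (at \<tau>)"
      by (rule bounded_linear.has_vector_derivative[OF bounded_linear_cform])
    moreover have F\<tau>: "(F has_derivative F' (?l \<tau>)) (at (?l \<tau>))" using posl[of \<tau>] \<tau> by (intro F) auto
    ultimately have "((F \<circ> ?l) has_derivative (F' (?l \<tau>) \<circ> (\<lambda>h. h *\<^sub>R cform a (vector_derivative \<sigma> (at \<tau>))))) (at \<tau>)"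
      unfolding has_vector_derivative_def by (rule diff_chain_at)
    moreover have "F' (?l \<tau>) \<circ> (\<lambda>h. h *\<^sub>R cform a (vector_derivative \<sigma> (at \<tau>)))
        = (\<lambda>h. h *\<^sub>R F' (?l \<tau>) (cform a (vector_derivative \<sigma> (at \<tau>))))"
      using linear_scale[OF has_derivative_linear[OF F\<tau>]] by (simp only: o_def)
    ultimately show "(\<phi> has_real_derivative \<phi>' \<tau>) (at \<tau>)"
      using \<tau> unfolding has_real_derivative_iff_has_vector_derivative has_vector_derivative_def
      by (simp add: \<phi>_def[abs_def] \<phi>'_def o_def)
  qed (simp add: \<phi>'_def)
  then have "ennreal (\<phi> t - \<phi> s) \<le> (\<integral>\<^sup>+\<tau>\<in>{s..t}. ennreal \<bar>\<phi>' \<tau>\<bar> \<partial>lebesgue)"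
    by (rule has_integral_le_nn_integral_norm)
  also have "\<dots> \<le> kobayashi_length \<Omega> s t \<sigma>"
    unfolding kobayashi_length_def
  proof (rule nn_integral_mono)
    fix \<tau> :: real
    show "ennreal \<bar>\<phi>' \<tau>\<bar> * indicator {s..t} \<tau>
      \<le> ennreal (kobayashi_metric \<Omega> (\<sigma> \<tau>) (vector_derivative \<sigma> (at \<tau>))) * indicator {s..t} \<tau>"
    proof (cases "\<tau> \<in> {s..t} - N")
      case True
      let ?v = "vector_derivative \<sigma> (at \<tau>)"
      have "\<bar>\<phi>' \<tau>\<bar> \<le> cmod (cform a ?v) / (2 * Re (?l \<tau>))"
        using True posl[of \<tau>] by (simp add: \<phi>'_def F')
      also have "\<dots> \<le> kobayashi_metric \<Omega> (\<sigma> \<tau>) ?v"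
        using True \<sigma> by (intro kobayashi_metric_lower[OF assms(1) _ pos]) auto
      finally show ?thesis by (intro mult_right_mono ennreal_leI) auto
    next
      case False
      then show ?thesis by (auto simp: \<phi>'_def indicator_def)
    qed
  qed
  finally show ?thesis by (simp add: \<phi>_def)
qed

lemma absolutely_continuous_segment:
  fixes x v :: "'a::real_normed_vector"
  shows "absolutely_continuous_curve 0 1 (\<lambda>t. x + t *\<^sub>R v)"
proof (rule absolutely_continuous_curve_Lipschitz[of _ _ "\<lambda>t. t"])
  show "absolutely_continuous_curve 0 1 (\<lambda>t::real. t)"
    unfolding absolutely_continuous_curve_def
  proof (intro allI impI)
    fix \<epsilon> :: real assume "\<epsilon> > 0"
    have "(\<Sum>i<N. dist (s i) (t i)) < \<epsilon>"
      if *: "(\<forall>i<N. 0 \<le> s i \<and> s i \<le> t i \<and> t i \<le> 1) \<and>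
        (\<forall>i<N. \<forall>j<N. i \<noteq> j \<longrightarrow> {s i<..<t i} \<inter> {s j<..<t j} = {}) \<and> (\<Sum>i<N. t i - s i) < \<epsilon>"
      for N :: nat and s t :: "nat \<Rightarrow> real"
    proof -
      have "(\<Sum>i<N. dist (s i) (t i)) = (\<Sum>i<N. t i - s i)"
        by (intro sum.cong refl) (use * in \<open>auto simp: dist_real_def\<close>)
      then show ?thesis using * by simp
    qed
    then show "\<exists>\<delta>>0. \<forall>(N::nat) (s :: nat \<Rightarrow> real) t. (\<forall>i<N. 0 \<le> s i \<and> s i \<le> t i \<and> t i \<le> 1) \<and>
        (\<forall>i<N. \<forall>j<N. i \<noteq> j \<longrightarrow> {s i<..<t i} \<inter> {s j<..<t j} = {}) \<and>
        (\<Sum>i<N. t i - s i) < \<delta> \<longrightarrow> (\<Sum>i<N. dist (s i) (t i)) < \<epsilon>"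
      by (intro exI[of _ \<epsilon>] conjI \<open>\<epsilon> > 0\<close>) simp
  qed
  fix s t :: real
  show "dist (x + s *\<^sub>R v) (x + t *\<^sub>R v) \<le> norm v * dist s t"
    by (simp add: dist_norm scaleR_left_diff_distrib[symmetric] mult.commute)
qed simp

text \<open>Stated for the infimum in \<open>ennreal\<close>, since the lower bounds need its
  finiteness before \<open>enn2real\<close> can be applied.\<close>

lemma kobayashi_length_segment:
  assumes "r > 0" and disc: "\<And>p \<zeta>. \<lbrakk>p \<in> closed_segment x y; cmod \<zeta> < r\<rbrakk> \<Longrightarrow> p + \<zeta> *s (y - x) \<in> \<Omega>"
  shows "Inf {kobayashi_length \<Omega> a b \<sigma> | a b \<sigma>.
       a \<le> b \<and> absolutely_continuous_curve a b \<sigma> \<and> \<sigma> ` {a..b} \<subseteq> \<Omega> \<and> \<sigma> a = x \<and> \<sigma> b = y} \<le> ennreal (1 / r)"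
    (is "Inf ?S \<le> _")
proof -
  define \<sigma> where "\<sigma> t = x + t *\<^sub>R (y - x)" for t :: real
  have seg: "\<sigma> t \<in> closed_segment x y" if "t \<in> {0..1}" for t
    using that by (auto simp: \<sigma>_def in_segment algebra_simps intro!: exI[of _ t])
  have der: "vector_derivative \<sigma> (at t) = y - x" for t
    unfolding \<sigma>_def by (rule vector_derivative_at) (auto intro!: derivative_eq_intros)
  have "\<sigma> t \<in> \<Omega>" if "t \<in> {0..1}" for t using disc[OF seg[OF that], of 0] \<open>r > 0\<close> by (simp add: vec_eq_iff)
  then have "kobayashi_length \<Omega> 0 1 \<sigma> \<in> ?S"
    using absolutely_continuous_segment[of x "y - x"]
    by (intro CollectI exI[of _ "0::real"] exI[of _ "1::real"] exI[of _ \<sigma>] conjI refl)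
      (simp_all add: \<sigma>_def[abs_def] image_subset_iff)
  then have "Inf ?S \<le> kobayashi_length \<Omega> 0 1 \<sigma>" by (rule Inf_lower)
  also have "\<dots> \<le> (\<integral>\<^sup>+t\<in>{0..1::real}. ennreal (1 / r) \<partial>lebesgue)"
    unfolding kobayashi_length_def der
  proof (rule nn_integral_mono)
    fix t :: real
    show "ennreal (kobayashi_metric \<Omega> (\<sigma> t) (y - x)) * indicator {0..1} t \<le> ennreal (1 / r) * indicator {0..1} t"
    proof (cases "t \<in> {0..1}")
      case True
      then have "kobayashi_metric \<Omega> (\<sigma> t) (y - x) \<le> 1 / r"
        using kobayashi_metric_upper[OF \<open>r > 0\<close>] disc[OF seg[OF True]] by blast
      then show ?thesis by (intro mult_right_mono ennreal_leI) auto
    qed simp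
  qed
  also have "\<dots> = ennreal (1 / r)" by (simp add: nn_integral_cmult_indicator)
  finally show ?thesis .
qed

lemma kobayashi_dist_segment:
  assumes "r > 0" and disc: "\<And>p \<zeta>. \<lbrakk>p \<in> closed_segment x y; cmod \<zeta> < r\<rbrakk> \<Longrightarrow> p + \<zeta> *s (y - x) \<in> \<Omega>"
  shows "kobayashi_dist \<Omega> x y \<le> 1 / r"
  unfolding kobayashi_dist_def
  using enn2real_mono[OF kobayashi_length_segment[OF assms]] \<open>r > 0\<close> by simp

lemma kobayashi_dist_lower:
  fixes F :: "complex \<Rightarrow> real"
  assumes "open \<Omega>" "convex \<Omega>" and pos: "\<And>y. y \<in> \<Omega> \<Longrightarrow> Re (cform a (y - q)) > 0"
    and F: "\<And>z. Re z > 0 \<Longrightarrow> (F has_derivative F' z) (at z)"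
    and F': "\<And>z w. Re z > 0 \<Longrightarrow> \<bar>F' z w\<bar> \<le> cmod w / (2 * Re z)"
    and "x \<in> \<Omega>" "y \<in> \<Omega>"
  shows "F (cform a (y - q)) - F (cform a (x - q)) \<le> kobayashi_dist \<Omega> x y"
proof -
  let ?S = "{kobayashi_length \<Omega> a b \<sigma> | a b \<sigma>.
       a \<le> b \<and> absolutely_continuous_curve a b \<sigma> \<and> \<sigma> ` {a..b} \<subseteq> \<Omega> \<and> \<sigma> a = x \<and> \<sigma> b = y}"
  have "closed_segment x y \<subseteq> \<Omega>" using assms by (simp add: closed_segment_subset)
  then obtain e where e: "e > 0" "(\<Union>p\<in>closed_segment x y. ball p e) \<subseteq> \<Omega>"
    using compact_subset_open_imp_ball_epsilon_subset[OF compact_segment assms(1)] by blast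
  obtain r where "r > 0" and r: "\<And>p \<zeta>. cmod \<zeta> < r \<Longrightarrow> p + \<zeta> *s (y - x) \<in> ball p e"
    using small_disc_in_ball[OF e(1)] by blast
  \<comment> \<open>\<open>enn2real\<close> sends infinity to 0, so monotonicity requires a finite
    infimum.\<close>
  have fin: "Inf ?S \<le> ennreal (1 / r)"
    using e(2) r by (intro kobayashi_length_segment \<open>r > 0\<close>) blast
  define c where "c = F (cform a (y - q)) - F (cform a (x - q))"
  have "ennreal c \<le> Inf ?S"
  proof (rule Inf_greatest)
    fix l assume "l \<in> ?S"
    then obtain s t \<sigma> where "l = kobayashi_length \<Omega> s t \<sigma>" "s \<le> t" "absolutely_continuous_curve s t \<sigma>"
      "\<sigma> ` {s..t} \<subseteq> \<Omega>" "\<sigma> s = x" "\<sigma> t = y" by blast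
    then show "ennreal c \<le> l"
      using kobayashi_length_lower[OF assms(1) pos F F', of s t \<sigma>] by (simp only: c_def)
  qed
  moreover have "Inf ?S < top"
    by (rule le_less_trans[OF fin]) simp
  ultimately have "enn2real (ennreal c) \<le> kobayashi_dist \<Omega> x y"
    unfolding kobayashi_dist_def by (rule enn2real_mono)
  moreover have "c \<le> enn2real (ennreal c)" by (cases "c \<ge> 0") (simp_all add: ennreal_neg)
  ultimately show ?thesis unfolding c_def by linarith
qed

lemma kobayashi_dist_lower_ln_Re:
  assumes "open \<Omega>" "convex \<Omega>" and pos: "\<And>y. y \<in> \<Omega> \<Longrightarrow> Re (cform a (y - q)) > 0"
    and "x \<in> \<Omega>" "y \<in> \<Omega>"
  shows "ln (Re (cform a (y - q)) / Re (cform a (x - q))) \<le> 2 * kobayashi_dist \<Omega> x y"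
proof -
  have "ln (Re (cform a (y - q))) / 2 - ln (Re (cform a (x - q))) / 2 \<le> kobayashi_dist \<Omega> x y"
  proof (rule kobayashi_dist_lower[OF assms(1,2) pos _ _ assms(4,5), of "\<lambda>z. ln (Re z) / 2" "\<lambda>z w. Re w / (2 * Re z)"])
    fix z :: complex assume "Re z > 0"
    then show "((\<lambda>z. ln (Re z) / 2) has_derivative (\<lambda>w. Re w / (2 * Re z))) (at z)"
      by (auto intro!: derivative_eq_intros simp: field_simps)
    show "\<bar>Re w / (2 * Re z)\<bar> \<le> cmod w / (2 * Re z)" for w
      using \<open>Re z > 0\<close> abs_Re_le_cmod[of w] by (simp add: divide_right_mono)
  qed
  then show ?thesis using pos[OF assms(4)] pos[OF assms(5)] by (simp add: ln_div)
qed

text \<open>The factor \<open>u\<close> rotates the difference of logarithms onto the positive axis,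
  so that one real function \<open>Re (u * Ln z) / 2\<close>, chosen for the two end points, detects
  its modulus. The bound on the differential holds because \<open>cmod z \<ge> Re z\<close>.\<close>

lemma kobayashi_dist_lower_Ln:
  assumes "open \<Omega>" "convex \<Omega>" and pos: "\<And>y. y \<in> \<Omega> \<Longrightarrow> Re (cform a (y - q)) > 0"
    and "x \<in> \<Omega>" "y \<in> \<Omega>"
  shows "cmod (Ln (cform a (y - q)) - Ln (cform a (x - q))) \<le> 2 * kobayashi_dist \<Omega> x y"
proof -
  define D where "D = Ln (cform a (y - q)) - Ln (cform a (x - q))"
  define u where "u = cnj (sgn D)"
  have u1: "cmod u \<le> 1" by (simp add: u_def norm_sgn)
  have uD: "Re (u * D) = cmod D"
  proof (cases "D = 0")
    case False
    then have "u * D = of_real (cmod D)"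
      by (simp add: u_def sgn_eq complex_norm_square[symmetric] power2_eq_square mult.commute)
    then show ?thesis by simp
  qed simp
  have "Re (u * Ln (cform a (y - q))) / 2 - Re (u * Ln (cform a (x - q))) / 2 \<le> kobayashi_dist \<Omega> x y"
  proof (rule kobayashi_dist_lower[OF assms(1,2) pos _ _ assms(4,5), of "\<lambda>z. Re (u * Ln z) / 2" "\<lambda>z w. Re (u * (inverse z * w)) / 2"])
    fix z :: complex assume z: "Re z > 0"
    then have "z \<notin> \<real>\<^sub>\<le>\<^sub>0" by (auto simp: complex_nonpos_Reals_iff)
    then have "(Ln has_derivative (*) (inverse z)) (at z)"
      by (rule has_field_derivative_Ln[unfolded has_field_derivative_def])
    then have "((\<lambda>z. Re (u * Ln z)) has_derivative (\<lambda>w. Re (u * (inverse z * w)))) (at z)"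
      by (intro has_derivative_Re has_derivative_mult_right)
    then show "((\<lambda>z. Re (u * Ln z) / 2) has_derivative (\<lambda>w. Re (u * (inverse z * w)) / 2)) (at z)"
      by (rule bounded_linear.has_derivative[OF bounded_linear_divide])
    fix w
    have "\<bar>Re (u * (inverse z * w)) / 2\<bar> \<le> cmod (u * (inverse z * w)) / 2"
      using abs_Re_le_cmod[of "u * (inverse z * w)"] by (simp only: abs_divide abs_numeral divide_right_mono zero_le_numeral)
    also have "\<dots> \<le> 1 * cmod (inverse z * w) / 2"
      unfolding norm_mult[of u] by (intro divide_right_mono mult_right_mono u1) auto
    also have "\<dots> = cmod w / (2 * cmod z)" by (simp add: norm_mult norm_inverse inverse_eq_divide norm_divide)
    also have "\<dots> \<le> cmod w / (2 * Re z)"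
      using z less_le_trans[OF z complex_Re_le_cmod] complex_Re_le_cmod[of z]
      by (intro divide_left_mono mult_pos_pos) auto
    finally show "\<bar>Re (u * (inverse z * w)) / 2\<bar> \<le> cmod w / (2 * Re z)" .
  qed
  then have "Re (u * D) / 2 \<le> kobayashi_dist \<Omega> x y"
    by (simp only: D_def right_diff_distrib minus_complex.sel diff_divide_distrib)
  then show ?thesis unfolding uD by (simp only: D_def)
qed

lemma kobayashi_dist_lower_ln_norm:
  assumes "open \<Omega>" "convex \<Omega>" and pos: "\<And>y. y \<in> \<Omega> \<Longrightarrow> Re (cform a (y - q)) > 0"
    and "x \<in> \<Omega>" "y \<in> \<Omega>"
  shows "ln (cmod (cform a (y - q)) / cmod (cform a (x - q))) \<le> 2 * kobayashi_dist \<Omega> x y"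
proof -
  have nz: "cform a (x - q) \<noteq> 0" "cform a (y - q) \<noteq> 0" using pos assms(4,5) by fastforce+
  have "ln (cmod (cform a (y - q))) - ln (cmod (cform a (x - q))) = Re (Ln (cform a (y - q)) - Ln (cform a (x - q)))"
    using nz by simp
  also have "\<dots> \<le> cmod (Ln (cform a (y - q)) - Ln (cform a (x - q)))" by (rule complex_Re_le_cmod)
  also have "\<dots> \<le> 2 * kobayashi_dist \<Omega> x y" by (rule kobayashi_dist_lower_Ln[OF assms])
  finally show ?thesis using nz by (simp add: ln_div)
qed

section \<open>Hyperbolic convex domains\<close>

text \<open>Allows estimates that hold for short steps only to be added up: \<open>D\<close>
  satisfies the triangle inequality, and the increments of \<open>\<Phi>\<close> telescope.\<close>

lemma local_increment_bound_imp_global: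
  fixes D :: "real \<Rightarrow> real \<Rightarrow> real" and \<Phi> :: "real \<Rightarrow> real"
  assumes "h > 0"
    and tri: "\<And>s t u. \<lbrakk>a \<le> s; s \<le> t; t \<le> u; u \<le> b\<rbrakk> \<Longrightarrow> D s u \<le> D s t + D t u"
    and loc: "\<And>s t. \<lbrakk>a \<le> s; s \<le> t; t \<le> b; t - s \<le> h\<rbrakk> \<Longrightarrow> D s t \<le> \<Phi> t - \<Phi> s"
    and st: "a \<le> s" "s \<le> t" "t \<le> b"
  shows "D s t \<le> \<Phi> t - \<Phi> s"
proof -
  have main: "D s t \<le> \<Phi> t - \<Phi> s" if "t - s \<le> real n * h" "s \<le> t" "t \<le> b" for n t
    using that
  proof (induction n arbitrary: t)
    case 0
    then have "t = s" by simp
    then show ?case using loc[of s s] st \<open>h > 0\<close> by simp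
  next
    case (Suc n)
    show ?case
    proof (cases "t - s \<le> h")
      case True
      then show ?thesis using loc st Suc.prems by auto
    next
      case False
      have "D s (t - h) \<le> \<Phi> (t - h) - \<Phi> s"
        by (rule Suc.IH) (use Suc.prems False \<open>h > 0\<close> in \<open>auto simp: algebra_simps\<close>)
      moreover have "D (t - h) t \<le> \<Phi> t - \<Phi> (t - h)"
        by (rule loc) (use Suc.prems False \<open>h > 0\<close> st in auto)
      moreover have "D s t \<le> D s (t - h) + D (t - h) t"
        by (rule tri) (use Suc.prems False \<open>h > 0\<close> st in auto)
      ultimately show ?thesis by linarith
    qed
  qed
  obtain n :: nat where "t - s < real n * h"
    using ex_less_of_nat_mult[OF \<open>h > 0\<close>] by blast
  then show ?thesis using st by (intro main[of t n]) auto
qed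

lemma exp_minus_one_le:
  fixes d :: real
  assumes "0 \<le> d" "d \<le> 1" shows "exp d - 1 \<le> 2 * d"
proof -
  have "exp d \<le> 1 + d + d\<^sup>2" using assms by (intro exp_bound) auto
  moreover have "d\<^sup>2 \<le> d" using mult_right_mono[OF assms(2,1)] by (simp add: power2_eq_square)
  ultimately show ?thesis by linarith
qed

lemma norm_exp_minus_one_le: "cmod (exp z - 1) \<le> exp (cmod z) * cmod z"
proof -
  have "cmod (exp z - exp 0) \<le> exp (cmod z) * cmod (z - 0)"
  proof (rule field_differentiable_bound[of "cball 0 (cmod z)" exp exp])
    fix x :: complex assume x: "x \<in> cball 0 (cmod z)"
    show "(exp has_field_derivative exp x) (at x within cball 0 (cmod z))"
      by (auto intro!: derivative_eq_intros)
    have "Re x \<le> cmod z" using x complex_Re_le_cmod[of x] by simp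
    then show "cmod (exp x) \<le> exp (cmod z)" by simp
  qed auto
  then show ?thesis by simp
qed

text \<open>\<open>infdist\<close> to the empty set is 0, so the boundary distance needs a non-empty
  complement. The constants \<open>c\<close> and \<open>dm\<close> play the roles of inner radius
  and diameter.\<close>

locale hyperbolic_convex_domain = hyperbolic_geodesic_space \<Omega> "kobayashi_dist \<Omega>" \<delta>
  for \<Omega> :: "(complex ^ 'n) set" and \<delta> +
  fixes z0 :: "complex ^ 'n" and c dm :: real
  assumes open_domain: "open \<Omega>" and convex_domain: "convex \<Omega>"
    and c_pos: "c > 0" and ball_z0: "ball z0 c \<subseteq> \<Omega>"
    and diam: "\<lbrakk>x \<in> \<Omega>; y \<in> \<Omega>\<rbrakk> \<Longrightarrow> norm (x - y) \<le> dm"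
    and compl_nonempty: "- \<Omega> \<noteq> {}"
begin

section \<open>Boundary distance and supporting half planes\<close>

abbreviation K :: "complex ^ 'n \<Rightarrow> complex ^ 'n \<Rightarrow> real" where
  "K \<equiv> kobayashi_dist \<Omega>"

definition bd :: "complex ^ 'n \<Rightarrow> real" where
  "bd x = infdist x (- \<Omega>)"

definition ray :: "complex ^ 'n \<Rightarrow> real \<Rightarrow> complex ^ 'n" where
  "ray x s = x + s *\<^sub>R (z0 - x)"

definition disc_in :: "complex ^ 'n \<Rightarrow> complex ^ 'n \<Rightarrow> real \<Rightarrow> bool" where
  "disc_in z v R \<longleftrightarrow> (\<forall>\<zeta>. cmod \<zeta> < R \<longrightarrow> z + \<zeta> *s v \<in> \<Omega>)"

lemma z0_in: "z0 \<in> \<Omega>"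
  using ball_z0 c_pos by auto

lemma dm_pos: "dm > 0"
proof -
  obtain b :: "complex ^ 'n" where b: "b \<in> Basis" using nonempty_Basis by blast
  have "z0 + (c / 2) *\<^sub>R b \<in> ball z0 c" using b c_pos by (simp add: dist_norm)
  then have "z0 + (c / 2) *\<^sub>R b \<in> \<Omega>" using ball_z0 by blast
  from diam[OF this z0_in] show ?thesis using b c_pos by simp
qed

lemma bd_nonneg: "bd x \<ge> 0"
  by (simp add: bd_def infdist_nonneg)

lemma in_domain_if_dist_less_bd:
  assumes "dist x y < bd x" shows "y \<in> \<Omega>"
proof (rule ccontr)
  assume "y \<notin> \<Omega>"
  then have "infdist x (- \<Omega>) \<le> dist x y" by (intro infdist_le) simp
  then show False using assms by (simp add: bd_def)
qed

lemma ball_bd_subset: "ball x (bd x) \<subseteq> \<Omega>"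
  using in_domain_if_dist_less_bd by auto

lemma bd_pos: "x \<in> \<Omega> \<Longrightarrow> bd x > 0"
  using in_closed_iff_infdist_zero[of "- \<Omega>" x] open_domain compl_nonempty bd_nonneg[of x]
  by (auto simp: bd_def closed_Compl less_le)

lemma bd_le_add_dist: "bd x \<le> bd y + dist x y"
  unfolding bd_def by (rule infdist_triangle)

lemma bd_bounded: "x \<in> \<Omega> \<Longrightarrow> bd x \<le> bd z0 + dm"
  using bd_le_add_dist[of x z0] diam[OF _ z0_in, of x] by (simp add: dist_norm)

lemma bd_ge: "ball x r \<subseteq> \<Omega> \<Longrightarrow> bd x \<ge> r"
proof (rule ccontr)
  assume r: "ball x r \<subseteq> \<Omega>" "\<not> r \<le> bd x"
  have cl: "closed (- \<Omega>)" using open_domain by (simp add: closed_def)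
  obtain q where "q \<in> - \<Omega>" "infdist x (- \<Omega>) = dist x q"
    using infdist_attains_inf[OF cl compl_nonempty] by blast
  then have "q \<in> ball x r" "q \<notin> \<Omega>" using r(2) by (simp_all add: bd_def)
  then show False using r by blast
qed

text \<open>\<open>q\<close> is not tied to the boundary: it will be a point outside \<Omega> that
  shows where an affine disc leaves the domain.\<close>

definition supports :: "complex ^ 'n \<Rightarrow> complex ^ 'n \<Rightarrow> bool" where
  "supports a q \<longleftrightarrow> norm a = 1 \<and> (\<forall>y\<in>\<Omega>. Re (cform a (y - q)) > 0)"

lemma supportsD:
  assumes "supports a q"
  shows "norm a = 1" "\<And>y. y \<in> \<Omega> \<Longrightarrow> Re (cform a (y - q)) > 0" "cmod (cform a x) \<le> norm x"
  using assms norm_cform_le[of a x] by (simp_all add: supports_def)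

text \<open>Moving from \<open>x\<close> by \<open>Re (cform a (x - q))\<close> in direction
  \<open>- a\<close> reaches the hyperplane, which the ball cannot meet.\<close>

lemma supports_ball:
  assumes s: "supports a q" and "x \<in> \<Omega>" and r: "ball x r \<subseteq> \<Omega>"
  shows "r \<le> Re (cform a (x - q))"
proof (rule ccontr)
  define t where "t = Re (cform a (x - q))"
  assume "\<not> r \<le> Re (cform a (x - q))"
  then have "t < r" by (simp add: t_def)
  have "t > 0" using supportsD(2)[OF s \<open>x \<in> \<Omega>\<close>] by (simp add: t_def)
  have "x - t *\<^sub>R a \<in> ball x r" using \<open>t < r\<close> \<open>t > 0\<close> supportsD(1)[OF s] by (simp add: dist_norm)
  then have "x - t *\<^sub>R a \<in> \<Omega>" using r by blast
  then have "Re (cform a (x - t *\<^sub>R a - q)) > 0" by (rule supportsD(2)[OF s])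
  moreover have "Re (cform a (x - t *\<^sub>R a - q)) = t - t * (a \<bullet> a)"
    by (simp add: t_def Re_cform inner_diff_right)
  ultimately show False using supportsD(1)[OF s] by (simp add: dot_square_norm)
qed

text \<open>Separation gives a weak inequality; openness of \<Omega> makes it strict.\<close>

lemma supports_exists:
  assumes "q \<notin> \<Omega>" obtains a where "supports a q"
proof -
  have "\<exists>a b. a \<noteq> 0 \<and> (\<forall>x\<in>{q}. a \<bullet> x \<le> b) \<and> (\<forall>x\<in>\<Omega>. b \<le> a \<bullet> x)"
    by (rule separating_hyperplane_sets) (use convex_domain z0_in assms in auto)
  then obtain a b where a: "a \<noteq> 0" "a \<bullet> q \<le> b" "\<And>x. x \<in> \<Omega> \<Longrightarrow> b \<le> a \<bullet> x" by auto
  have pos: "a \<bullet> (y - q) > 0" if y: "y \<in> \<Omega>" for y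
  proof -
    obtain e where e: "e > 0" "ball y e \<subseteq> \<Omega>" using open_domain y by (meson open_contains_ball)
    define t where "t = e / (2 * norm a)"
    have "t > 0" using e a by (simp add: t_def)
    have "norm (t *\<^sub>R a) < e" using e a by (simp add: t_def)
    then have "y - t *\<^sub>R a \<in> \<Omega>" using e by (intro subsetD[OF e(2)]) (simp add: dist_norm)
    then have "b \<le> a \<bullet> (y - t *\<^sub>R a)" by (rule a(3))
    moreover have "t * (a \<bullet> a) > 0" using \<open>t > 0\<close> a by simp
    ultimately show ?thesis using a(2) by (simp add: inner_diff_right)
  qed
  have "supports (a /\<^sub>R norm a) q"
    unfolding supports_def
  proof (intro conjI ballI)
    show "norm (a /\<^sub>R norm a) = 1" using a by simp
    fix y assume "y \<in> \<Omega>"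
    have "Re (cform (a /\<^sub>R norm a) (y - q)) = (a \<bullet> (y - q)) / norm a"
      unfolding Re_cform by (simp add: divide_inverse mult.commute)
    then show "Re (cform (a /\<^sub>R norm a) (y - q)) > 0" using pos[OF \<open>y \<in> \<Omega>\<close>] a by simp
  qed
  then show thesis by (rule that)
qed

text \<open>For a nearest point \<open>q\<close> of the complement, the ball
  \<open>ball x (bd x)\<close> forces the hyperplane through \<open>q\<close> to have distance
  exactly \<open>bd x\<close> from \<open>x\<close>.\<close>

lemma nearest_support:
  assumes "x \<in> \<Omega>"
  obtains a q where "supports a q" "q \<notin> \<Omega>" "norm (x - q) = bd x" "Re (cform a (x - q)) = bd x"
proof -
  have cl: "closed (- \<Omega>)" using open_domain by (simp add: closed_def)
  obtain q where q: "q \<in> - \<Omega>" "infdist x (- \<Omega>) = dist x q"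
    using infdist_attains_inf[OF cl compl_nonempty] by blast
  obtain a where a: "supports a q" using supports_exists[of q] q by auto
  have n: "norm (x - q) = bd x" using q by (simp add: bd_def dist_norm)
  have "Re (cform a (x - q)) \<le> norm (x - q)"
    using complex_Re_le_cmod supportsD(3)[OF a] by (rule order_trans)
  moreover have "bd x \<le> Re (cform a (x - q))" by (rule supports_ball[OF a assms ball_bd_subset])
  ultimately show thesis using that[OF a _ n] q n by simp
qed

lemmas K_lower_Re = kobayashi_dist_lower_ln_Re[OF open_domain convex_domain]
lemmas K_lower_norm = kobayashi_dist_lower_ln_norm[OF open_domain convex_domain]
lemmas K_lower_Ln = kobayashi_dist_lower_Ln[OF open_domain convex_domain]

lemma K_ge_ln_bd:
  assumes "x \<in> \<Omega>" "y \<in> \<Omega>" shows "ln (bd y / bd x) \<le> 2 * K x y"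
proof -
  obtain a q where a: "supports a q" "Re (cform a (x - q)) = bd x" using nearest_support[OF assms(1)] .
  have "bd y \<le> Re (cform a (y - q))" by (rule supports_ball[OF a(1) assms(2) ball_bd_subset])
  then have "ln (bd y / bd x) \<le> ln (Re (cform a (y - q)) / Re (cform a (x - q)))"
    unfolding a(2) using bd_pos[OF assms(1)] bd_pos[OF assms(2)]
    by (intro ln_mono divide_right_mono divide_pos_pos) auto
  also have "\<dots> \<le> 2 * K x y" by (rule K_lower_Re[OF supportsD(2)[OF a(1)] assms])
  finally show ?thesis .
qed

lemma bd_le_exp_K:
  assumes "x \<in> \<Omega>" "y \<in> \<Omega>" shows "bd y \<le> exp (2 * K x y) * bd x"
proof -
  have "exp (ln (bd y / bd x)) \<le> exp (2 * K x y)"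
    using K_ge_ln_bd[OF assms] by (simp only: exp_le_cancel_iff)
  then have "bd y / bd x \<le> exp (2 * K x y)" using bd_pos assms by simp
  then show ?thesis using bd_pos[OF assms(1)] by (simp add: field_simps)
qed

lemma K_upper_balls:
  assumes "x \<in> \<Omega>" "y \<in> \<Omega>" "\<rho> > 0" and b: "\<And>p. p \<in> closed_segment x y \<Longrightarrow> ball p \<rho> \<subseteq> \<Omega>"
  shows "K x y \<le> norm (y - x) / \<rho>"
proof (cases "x = y")
  case True
  then show ?thesis using assms by simp
next
  case False
  then have n: "norm (y - x) > 0" by simp
  have "K x y \<le> 1 / (\<rho> / norm (y - x))"
  proof (rule kobayashi_dist_segment)
    fix p and \<zeta> :: complex assume p: "p \<in> closed_segment x y" and "cmod \<zeta> < \<rho> / norm (y - x)"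
    then have "norm (\<zeta> *s (y - x)) < \<rho>" using n by (simp only: norm_vector_scalar_mult) (simp add: field_simps)
    then have "p + \<zeta> *s (y - x) \<in> ball p \<rho>" by (simp only: mem_ball dist_norm) (simp add: norm_minus_commute)
    then show "p + \<zeta> *s (y - x) \<in> \<Omega>" using b[OF p] by blast
  qed (use \<open>\<rho> > 0\<close> n in simp)
  then show ?thesis by simp
qed

text \<open>The displacement \<open>w\<close> from the new centre is split between the two balls in
  proportion to their radii.\<close>

lemma ball_convex_combination:
  assumes x: "ball x r \<subseteq> \<Omega>" "r > 0" and y: "ball y r' \<subseteq> \<Omega>" "r' > 0" and s: "0 \<le> s" "s \<le> 1"
  shows "ball ((1 - s) *\<^sub>R x + s *\<^sub>R y) ((1 - s) * r + s * r') \<subseteq> \<Omega>"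
proof
  fix p assume p: "p \<in> ball ((1 - s) *\<^sub>R x + s *\<^sub>R y) ((1 - s) * r + s * r')"
  define R where "R = (1 - s) * r + s * r'"
  define w where "w = p - ((1 - s) *\<^sub>R x + s *\<^sub>R y)"
  have w: "norm w < R" using p by (simp add: w_def R_def dist_norm norm_minus_commute)
  then have "R > 0" using norm_ge_zero[of w] by linarith
  have "norm ((r / R) *\<^sub>R w) < r" "norm ((r' / R) *\<^sub>R w) < r'"
    using w \<open>R > 0\<close> x y by (simp_all add: field_simps)
  then have "x + (r / R) *\<^sub>R w \<in> \<Omega>" "y + (r' / R) *\<^sub>R w \<in> \<Omega>"
    by (intro subsetD[OF x(1)] subsetD[OF y(1)]; simp add: dist_norm)+
  then have "(1 - s) *\<^sub>R (x + (r / R) *\<^sub>R w) + s *\<^sub>R (y + (r' / R) *\<^sub>R w) \<in> \<Omega>"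
    using s by (intro convexD[OF convex_domain]) auto
  moreover have "(1 - s) *\<^sub>R (x + (r / R) *\<^sub>R w) + s *\<^sub>R (y + (r' / R) *\<^sub>R w)
      = ((1 - s) *\<^sub>R x + s *\<^sub>R y) + (((1 - s) * r + s * r') / R) *\<^sub>R w"
    by (simp add: algebra_simps add_divide_distrib diff_divide_distrib)
  moreover have "((1 - s) * r + s * r') / R = 1" using \<open>R > 0\<close> by (simp add: R_def)
  ultimately show "p \<in> \<Omega>" by (simp add: w_def)
qed

section \<open>Rays towards the base point\<close>

lemma ray_eq: "ray x s = (1 - s) *\<^sub>R x + s *\<^sub>R z0"
  by (simp add: ray_def algebra_simps)

lemma ray_simps [simp]: "ray x 0 = x" "ray x 1 = z0"
  by (simp_all add: ray_def)

lemma ray_ball: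
  assumes "ball x r \<subseteq> \<Omega>" "r > 0" "0 \<le> s" "s \<le> 1"
  shows "ball (ray x s) ((1 - s) * r + s * c) \<subseteq> \<Omega>"
  unfolding ray_eq by (rule ball_convex_combination[OF assms(1,2) ball_z0 c_pos assms(3,4)])

lemma ray_in: "\<lbrakk>x \<in> \<Omega>; 0 \<le> s; s \<le> 1\<rbrakk> \<Longrightarrow> ray x s \<in> \<Omega>"
  unfolding ray_eq using convexD[OF convex_domain _ z0_in, of x "1 - s" s] by simp

lemma bd_ray_ge: "\<lbrakk>x \<in> \<Omega>; 0 \<le> s; s \<le> 1\<rbrakk> \<Longrightarrow> bd (ray x s) \<ge> (1 - s) * bd x + s * c"
  by (intro bd_ge ray_ball ball_bd_subset bd_pos)

lemma norm_ray_diff: "x \<in> \<Omega> \<Longrightarrow> norm (ray x t - ray x s) \<le> \<bar>t - s\<bar> * dm"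
proof -
  assume "x \<in> \<Omega>"
  have "ray x t - ray x s = (t - s) *\<^sub>R (z0 - x)" by (simp add: ray_def algebra_simps)
  then show ?thesis using diam[OF z0_in \<open>x \<in> \<Omega>\<close>] by (simp add: mult_left_mono)
qed

lemma segment_ray:
  assumes "p \<in> closed_segment (ray x s) (ray x t)" "s \<le> t"
  obtains u where "s \<le> u" "u \<le> t" "p = ray x u"
proof -
  obtain w where w: "0 \<le> w" "w \<le> 1" "p = (1 - w) *\<^sub>R ray x s + w *\<^sub>R ray x t"
    using assms by (auto simp: in_segment)
  have "p = ray x (s + w * (t - s))" unfolding w ray_def by (simp add: algebra_simps)
  moreover have "w * (t - s) \<le> 1 * (t - s)" using w assms by (intro mult_right_mono) auto
  moreover have "0 \<le> w * (t - s)" using w assms by simp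
  ultimately show thesis using that[of "s + w * (t - s)"] by simp
qed

lemma K_ray_le:
  assumes x: "x \<in> \<Omega>" "ball x r \<subseteq> \<Omega>" "r > 0" and st: "0 \<le> s" "s \<le> t" "t \<le> 1" and \<rho>: "\<rho> > 0"
    and le: "\<And>u. \<lbrakk>s \<le> u; u \<le> t\<rbrakk> \<Longrightarrow> \<rho> \<le> (1 - u) * r + u * c"
  shows "K (ray x s) (ray x t) \<le> (t - s) * dm / \<rho>"
proof -
  have "K (ray x s) (ray x t) \<le> norm (ray x t - ray x s) / \<rho>"
  proof (rule K_upper_balls[OF _ _ \<rho>])
    fix p assume "p \<in> closed_segment (ray x s) (ray x t)"
    then obtain u where u: "s \<le> u" "u \<le> t" "p = ray x u" using segment_ray st by metis
    then have "ball p ((1 - u) * r + u * c) \<subseteq> \<Omega>" using ray_ball[OF x(2,3)] st by simp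
    then show "ball p \<rho> \<subseteq> \<Omega>" using le[OF u(1,2)] by (meson order_trans subset_ball)
  qed (use x st ray_in in auto)
  also have "\<dots> \<le> (t - s) * dm / \<rho>"
    using norm_ray_diff[OF x(1), of t s] st \<rho> by (intro divide_right_mono) auto
  finally show ?thesis .
qed

text \<open>Covers the starting points for which \<open>c - bd x\<close> may be small or negative,
  where \<open>ray_param\<close> is of no use; their rays are bounded in \<open>K\<close>.\<close>

lemma K_ray_le_of_deep:
  assumes x: "x \<in> \<Omega>" "c / 2 < bd x" and st: "0 \<le> s" "s \<le> t" "t \<le> 1"
  shows "K (ray x s) (ray x t) \<le> 2 * dm / c"
proof -
  have b: "ball x (c / 2) \<subseteq> \<Omega>" using ball_bd_subset[of x] x subset_ball[of "c / 2" "bd x" x] by auto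
  have "K (ray x s) (ray x t) \<le> (t - s) * dm / (c / 2)"
  proof (rule K_ray_le[OF x(1) b _ st])
    fix u assume "s \<le> u" "u \<le> t"
    then have "u * c \<ge> 0" using st c_pos by simp
    moreover have "(1 - u) * (c / 2) + u * c = c / 2 + u * c / 2" by (simp add: field_simps)
    ultimately show "c / 2 \<le> (1 - u) * (c / 2) + u * c" by linarith
  qed (use c_pos in auto)
  also have "\<dots> \<le> 1 * dm / (c / 2)"
    using st dm_pos c_pos by (intro divide_right_mono mult_right_mono) auto
  finally show ?thesis by (simp add: mult.commute)
qed

text \<open>The functional supporting \<Omega> next to \<open>x\<close> is affine along the ray,
  with value \<open>bd x\<close> at \<open>x\<close> and some \<open>b \<ge> c\<close> at
  \<open>z0\<close>. The quotient of its values at \<open>t\<close> and \<open>s\<close> increases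
  with \<open>b\<close>, so \<open>b\<close> may be replaced by \<open>c\<close>.\<close>

lemma K_ray_ge:
  assumes x: "x \<in> \<Omega>" and st: "0 \<le> s" "s \<le> t" "t \<le> 1"
  shows "ln (((1 - t) * bd x + t * c) / ((1 - s) * bd x + s * c)) \<le> 2 * K (ray x s) (ray x t)"
proof -
  obtain a q where a: "supports a q" "Re (cform a (x - q)) = bd x" using nearest_support[OF x] .
  define b where "b = Re (cform a (z0 - q))"
  have bc: "b \<ge> c" unfolding b_def by (rule supports_ball[OF a(1) z0_in ball_z0])
  have r: "bd x > 0" by (rule bd_pos[OF x])
  have l: "Re (cform a (ray x u - q)) = (1 - u) * bd x + u * b" for u
  proof -
    have "ray x u - q = (1 - u) *\<^sub>R (x - q) + u *\<^sub>R (z0 - q)" by (simp add: ray_def algebra_simps)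
    then show ?thesis
      unfolding b_def a(2)[symmetric] by (simp only: cform_simps(1,5) plus_complex.sel scaleR_complex.sel)
  qed
  have pos: "(1 - u) * bd x + u * m > 0" if "0 \<le> u" "u \<le> 1" "m \<ge> c" for u m
  proof (cases "u = 0")
    case False
    then have "u * m > 0" using that c_pos by simp
    moreover have "(1 - u) * bd x \<ge> 0" using that r by simp
    ultimately show ?thesis by linarith
  qed (use r in simp)
  have "bd x * (b - c) * (t - s) = ((1 - t) * bd x + t * b) * ((1 - s) * bd x + s * c) - ((1 - s) * bd x + s * b) * ((1 - t) * bd x + t * c)"
    by (simp add: algebra_simps)
  moreover have "0 \<le> bd x * (b - c) * (t - s)" using r bc st by simp
  ultimately have "((1 - t) * bd x + t * c) * ((1 - s) * bd x + s * b) - ((1 - t) * bd x + t * b) * ((1 - s) * bd x + s * c) \<le> 0"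
    by (simp add: mult.commute)
  then have "((1 - t) * bd x + t * c) / ((1 - s) * bd x + s * c) \<le> ((1 - t) * bd x + t * b) / ((1 - s) * bd x + s * b)"
    using pos[of s c] pos[of s b] st bc by (subst frac_le_eq) (auto intro!: divide_nonpos_pos mult_pos_pos)
  then have "ln (((1 - t) * bd x + t * c) / ((1 - s) * bd x + s * c)) \<le> ln (Re (cform a (ray x t - q)) / Re (cform a (ray x s - q)))"
    unfolding l using pos[of s c] pos[of t c] st by (intro ln_mono) auto
  also have "\<dots> \<le> 2 * K (ray x s) (ray x t)"
    by (rule K_lower_Re[OF supportsD(2)[OF a(1)]]) (use ray_in x st in auto)
  finally show ?thesis .
qed

text \<open>With this parameter the bound \<open>(1 - s) * bd x + s * c\<close> of \<open>ray_ball\<close> becomes \<open>exp \<tau>\<close>, which makes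
  the ray a quasi-geodesic.\<close>

definition ray_param :: "complex ^ 'n \<Rightarrow> real \<Rightarrow> real" where
  "ray_param x \<tau> = (exp \<tau> - bd x) / (c - bd x)"

lemma ray_param:
  assumes x: "x \<in> \<Omega>" "bd x \<le> c / 2"
  shows "(1 - ray_param x \<tau>) * bd x + ray_param x \<tau> * c = exp \<tau>"
    and "ray_param x (ln (bd x)) = 0" "ray_param x (ln c) = 1"
    and "\<lbrakk>ln (bd x) \<le> \<tau>; \<tau> \<le> \<tau>'; \<tau>' \<le> ln c\<rbrakk> \<Longrightarrow> 0 \<le> ray_param x \<tau> \<and> ray_param x \<tau> \<le> ray_param x \<tau>' \<and> ray_param x \<tau>' \<le> 1"
proof -
  have r: "bd x > 0" "c - bd x > 0" using bd_pos x c_pos by auto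
  have "(1 - ray_param x \<tau>) * bd x + ray_param x \<tau> * c = bd x + ray_param x \<tau> * (c - bd x)" by (simp add: algebra_simps)
  then show "(1 - ray_param x \<tau>) * bd x + ray_param x \<tau> * c = exp \<tau>" using r by (simp add: ray_param_def)
  show "ray_param x (ln (bd x)) = 0" "ray_param x (ln c) = 1" using r c_pos by (simp_all add: ray_param_def)
  assume t: "ln (bd x) \<le> \<tau>" "\<tau> \<le> \<tau>'" "\<tau>' \<le> ln c"
  have "exp (ln (bd x)) \<le> exp \<tau>" "exp \<tau> \<le> exp \<tau>'" "exp \<tau>' \<le> exp (ln c)" using t by (simp_all only: exp_le_cancel_iff)
  then show "0 \<le> ray_param x \<tau> \<and> ray_param x \<tau> \<le> ray_param x \<tau>' \<and> ray_param x \<tau>' \<le> 1"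
    using r c_pos by (simp add: ray_param_def divide_right_mono divide_le_eq)
qed

lemma K_ray_param:
  assumes x: "x \<in> \<Omega>" "bd x \<le> c / 2" and t: "ln (bd x) \<le> \<tau>" "\<tau> \<le> \<tau>'" "\<tau>' \<le> ln c"
  shows "K (ray x (ray_param x \<tau>)) (ray x (ray_param x \<tau>')) \<le> 4 * dm / c * (\<tau>' - \<tau>)"
    and "\<tau>' - \<tau> \<le> 2 * K (ray x (ray_param x \<tau>)) (ray x (ray_param x \<tau>'))"
proof -
  let ?g = "\<lambda>\<tau>. ray x (ray_param x \<tau>)"
  have in\<Omega>: "?g \<tau> \<in> \<Omega>" if "ln (bd x) \<le> \<tau>" "\<tau> \<le> ln c" for \<tau>
    using ray_in[OF x(1)] ray_param(4)[OF x that(1) order_refl that(2)] by auto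
  \<comment> \<open>The factor 2 from \<open>c - bd x \<ge> c / 2\<close> and the one in
    \<open>exp d - 1 \<le> 2 * d\<close> make up the constant \<open>4 * dm / c\<close>.\<close>
  have r: "bd x > 0" "c - bd x \<ge> c / 2" using bd_pos x c_pos by auto
  show "K (?g \<tau>) (?g \<tau>') \<le> 4 * dm / c * (\<tau>' - \<tau>)"
    unfolding right_diff_distrib
  proof (rule local_increment_bound_imp_global[of 1 "ln (bd x)" "ln c" "\<lambda>s t. K (?g s) (?g t)"])
    fix s t u assume "ln (bd x) \<le> s" "s \<le> t" "t \<le> u" "u \<le> ln c"
    then show "K (?g s) (?g u) \<le> K (?g s) (?g t) + K (?g t) (?g u)"
      by (intro triangle in\<Omega>) auto
  next
    fix s t assume st: "ln (bd x) \<le> s" "s \<le> t" "t \<le> ln c" "t - s \<le> 1"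
    let ?p = "ray_param x"
    have p: "0 \<le> ?p s" "?p s \<le> ?p t" "?p t \<le> 1" using ray_param(4)[OF x st(1-3)] by auto
    have "K (?g s) (?g t) \<le> (?p t - ?p s) * dm / exp s"
    proof (rule K_ray_le[OF x(1) ball_bd_subset r(1) p])
      fix u assume u: "?p s \<le> u" "u \<le> ?p t"
      have "exp s = bd x + ?p s * (c - bd x)" using ray_param(1)[OF x, of s] by (simp add: algebra_simps)
      also have "\<dots> \<le> bd x + u * (c - bd x)" using u r c_pos by (intro add_left_mono mult_right_mono) auto
      finally show "exp s \<le> (1 - u) * bd x + u * c" by (simp add: algebra_simps)
    qed simp
    also have "?p t - ?p s = (exp t - exp s) / (c - bd x)" by (simp add: ray_param_def diff_divide_distrib)
    also have "(exp t - exp s) / (c - bd x) * dm / exp s \<le> (exp t - exp s) / (c / 2) * dm / exp s"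
      using r c_pos st dm_pos by (intro divide_right_mono mult_right_mono divide_left_mono) auto
    also have "\<dots> = 2 * dm / c * (exp (t - s) - 1)" by (simp add: exp_diff field_simps)
    also have "\<dots> \<le> 2 * dm / c * (2 * (t - s))"
      using st dm_pos c_pos by (intro mult_left_mono exp_minus_one_le) auto
    finally show "K (?g s) (?g t) \<le> 4 * dm / c * t - 4 * dm / c * s" by (simp add: algebra_simps)
  qed (use t in auto)
  have p: "0 \<le> ray_param x \<tau>" "ray_param x \<tau> \<le> ray_param x \<tau>'" "ray_param x \<tau>' \<le> 1" using ray_param(4)[OF x t] by auto
  show "\<tau>' - \<tau> \<le> 2 * K (?g \<tau>) (?g \<tau>')"
    using K_ray_ge[OF x(1) p] unfolding ray_param(1)[OF x] exp_diff[symmetric] by simp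
qed

text \<open>In the logarithmic parameter the ray is a quasi-geodesic with constant
  \<open>max 2 (4 * dm / c)\<close>, and stability applies. For deep starting points boundedness of
  the ray suffices.\<close>

lemma ray_stability:
  "\<exists>C\<ge>0. \<forall>x\<in>\<Omega>. \<forall>s. 0 \<le> s \<and> s \<le> 1 \<longrightarrow> gromov_product K (ray x s) x z0 \<le> C"
proof -
  define L where "L = max 2 (4 * dm / c)"
  have "L \<ge> 1" "L \<ge> 2" "L \<ge> 4 * dm / c" by (auto simp: L_def)
  obtain C where "C \<ge> 0" and C: "\<And>a b g t. a \<le> b \<and> t \<in> {a..b} \<and> (\<forall>s\<in>{a..b}. g s \<in> \<Omega>) \<and>
      (\<forall>s\<in>{a..b}. \<forall>t\<in>{a..b}. K (g s) (g t) \<le> L * \<bar>s - t\<bar> \<and> \<bar>s - t\<bar> \<le> L * K (g s) (g t)) \<Longrightarrow>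
      gromov_product K (g t) (g a) (g b) \<le> C"
    using quasi_geodesic_stability[OF \<open>L \<ge> 1\<close>] by blast
  have dc: "2 * dm / c \<ge> 0" using dm_pos c_pos by simp
  show ?thesis
  proof (intro exI[of _ "max C (2 * dm / c)"] conjI ballI allI impI)
    fix x s assume x: "x \<in> \<Omega>" and s: "0 \<le> s \<and> s \<le> (1::real)"
    show "gromov_product K (ray x s) x z0 \<le> max C (2 * dm / c)"
    proof (cases "bd x \<le> c / 2")
      case False
      then have "K x (ray x s) \<le> 2 * dm / c" "K (ray x s) z0 \<le> 2 * dm / c"
        using K_ray_le_of_deep[OF x, of 0 s] K_ray_le_of_deep[OF x, of s 1] s by auto
      moreover have "K x z0 \<ge> 0" by simp
      moreover have "2 * dm / c \<le> max C (2 * dm / c)" by simp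
      ultimately show ?thesis unfolding gromov_product_def by argo
    next
      case True
      note xb = x True
      let ?g = "\<lambda>\<tau>. ray x (ray_param x \<tau>)"
      have r: "bd x > 0" by (rule bd_pos[OF x])
      \<comment> \<open>The inverse of \<open>ray_param x\<close> at \<open>s\<close>.\<close>
      define \<tau> where "\<tau> = ln ((1 - s) * bd x + s * c)"
      have e: "(1 - s) * bd x + s * c = bd x + s * (c - bd x)" by (simp add: algebra_simps)
      have ge: "bd x \<le> (1 - s) * bd x + s * c" unfolding e using s True c_pos by simp
      have le: "(1 - s) * bd x + s * c \<le> c"
        using mult_left_mono[of "bd x" c "1 - s"] s True c_pos by (simp add: algebra_simps)
      have \<tau>: "ln (bd x) \<le> \<tau>" "\<tau> \<le> ln c" unfolding \<tau>_def using ge le r by (intro ln_mono; simp)+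
      have ps: "ray_param x \<tau> = s" using ge r True c_pos by (simp add: ray_param_def \<tau>_def e)
      have KK: "K (?g s) (?g t) \<le> L * \<bar>s - t\<bar> \<and> \<bar>s - t\<bar> \<le> L * K (?g s) (?g t)"
        if "s \<le> t" "ln (bd x) \<le> s" "t \<le> ln c" for s t
      proof
        have "K (?g s) (?g t) \<le> 4 * dm / c * (t - s)" using K_ray_param(1)[OF xb] that by simp
        also have "\<dots> \<le> L * (t - s)" using \<open>L \<ge> 4 * dm / c\<close> that by (intro mult_right_mono) auto
        finally show "K (?g s) (?g t) \<le> L * \<bar>s - t\<bar>" using that by simp
        have "t - s \<le> 2 * K (?g s) (?g t)" using K_ray_param(2)[OF xb] that by simp
        also have "\<dots> \<le> L * K (?g s) (?g t)" using \<open>L \<ge> 2\<close> by (intro mult_right_mono) auto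
        finally show "\<bar>s - t\<bar> \<le> L * K (?g s) (?g t)" using that by simp
      qed
      have "gromov_product K (?g \<tau>) (?g (ln (bd x))) (?g (ln c)) \<le> C"
      proof (rule C[of "ln (bd x)" "ln c" \<tau> ?g], intro conjI ballI)
        fix s t assume st: "s \<in> {ln (bd x)..ln c}" "t \<in> {ln (bd x)..ln c}"
        have "K (?g s) (?g t) \<le> L * \<bar>s - t\<bar> \<and> \<bar>s - t\<bar> \<le> L * K (?g s) (?g t)"
        proof (cases "s \<le> t")
          case False
          then show ?thesis using KK[of t s] st commute[of "?g s" "?g t"] by (simp add: abs_minus_commute)
        qed (use KK st in auto)
        then show "K (?g s) (?g t) \<le> L * \<bar>s - t\<bar>" "\<bar>s - t\<bar> \<le> L * K (?g s) (?g t)" by auto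
      next
        fix t assume "t \<in> {ln (bd x)..ln c}"
        then show "?g t \<in> \<Omega>" using ray_in[OF x] ray_param(4)[OF xb, of t t] by auto
      qed (use \<tau> in auto)
      then show ?thesis using ray_param(2,3)[OF xb] ps by simp
    qed
  qed (use \<open>C \<ge> 0\<close> in simp)
qed

text \<open>The ray gives \<open>K x z0 \<le> 4 * dm / c * (ln c - ln (bd x))\<close>; solving for
  \<open>bd x\<close> makes \<kappa> the inverse of the constant.\<close>

lemma bd_le_exp_K_z0: "\<exists>C>0. \<exists>\<kappa>>0. \<forall>x\<in>\<Omega>. bd x \<le> C * exp (- \<kappa> * K x z0)"
proof -
  define \<kappa> where "\<kappa> = c / (4 * dm)"
  have "\<kappa> > 0" using c_pos dm_pos by (simp add: \<kappa>_def)
  define M where "M = bd z0 + dm"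
  have "M > 0" using dm_pos bd_nonneg[of z0] by (simp add: M_def)
  have main: "bd x \<le> max c (M * exp (\<kappa> * (2 * dm / c))) * exp (- \<kappa> * K x z0)" if x: "x \<in> \<Omega>" for x
  proof -
    show "bd x \<le> max c (M * exp (\<kappa> * (2 * dm / c))) * exp (- \<kappa> * K x z0)"
    proof (cases "bd x \<le> c / 2")
      case True
      have r: "bd x > 0" by (rule bd_pos[OF x])
      have "ln (bd x) \<le> ln c" using True r c_pos by simp
      then have "K x z0 \<le> 4 * dm / c * (ln c - ln (bd x))"
        using K_ray_param(1)[OF x True, of "ln (bd x)" "ln c"] ray_param(2,3)[OF x True] by simp
      then have "\<kappa> * K x z0 \<le> \<kappa> * (4 * dm / c * (ln c - ln (bd x)))" using \<open>\<kappa> > 0\<close> by (intro mult_left_mono) auto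
      also have "\<dots> = ln c - ln (bd x)" using c_pos dm_pos by (simp add: \<kappa>_def)
      finally have "ln (bd x) \<le> ln c + - \<kappa> * K x z0" by simp
      then have "exp (ln (bd x)) \<le> exp (ln c + - \<kappa> * K x z0)" by (simp only: exp_le_cancel_iff)
      then have "bd x \<le> c * exp (- \<kappa> * K x z0)" using r c_pos by (simp only: exp_add exp_ln)
      also have "\<dots> \<le> max c (M * exp (\<kappa> * (2 * dm / c))) * exp (- \<kappa> * K x z0)" by (intro mult_right_mono) auto
      finally show ?thesis .
    next
      case False
      then have "K x z0 \<le> 2 * dm / c" using K_ray_le_of_deep[OF x, of 0 1] by simp
      then have "\<kappa> * K x z0 \<le> \<kappa> * (2 * dm / c)" using \<open>\<kappa> > 0\<close> by (intro mult_left_mono) auto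
      then have "1 \<le> exp (\<kappa> * (2 * dm / c) + - \<kappa> * K x z0)" by simp
      then have "M * 1 \<le> M * exp (\<kappa> * (2 * dm / c) + - \<kappa> * K x z0)" using \<open>M > 0\<close> by (intro mult_left_mono) auto
      also have "\<dots> = M * exp (\<kappa> * (2 * dm / c)) * exp (- \<kappa> * K x z0)" by (simp only: exp_add mult.assoc)
      also have "\<dots> \<le> max c (M * exp (\<kappa> * (2 * dm / c))) * exp (- \<kappa> * K x z0)" by (intro mult_right_mono) auto
      finally show ?thesis using bd_bounded[OF x] by (simp add: M_def)
    qed
  qed
  moreover have "max c (M * exp (\<kappa> * (2 * dm / c))) > 0" using c_pos by simp
  ultimately show ?thesis using \<open>\<kappa> > 0\<close> by blast
qed

end

context hyperbolic_convex_domain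
begin

section \<open>Affine discs and their growth along rays\<close>

lemma disc_inD: "\<lbrakk>disc_in z v R; cmod \<zeta> < R\<rbrakk> \<Longrightarrow> z + \<zeta> *s v \<in> \<Omega>"
  by (simp add: disc_in_def)

text \<open>Around every point of the segment there is room for \<eta> times the vector
  \<open>\<zeta> *s v\<close> in all complex directions, because
  \<open>(1 + \<eta>) * (1 - \<eta>) < 1\<close>.\<close>

lemma K_disc_le:
  assumes d: "disc_in z v R" and \<eta>: "0 < \<eta>" "\<eta> < 1" and \<zeta>: "cmod \<zeta> \<le> (1 - \<eta>) * R" and "R > 0"
  shows "K z (z + \<zeta> *s v) \<le> 1 / \<eta>"
proof (rule kobayashi_dist_segment[OF \<eta>(1)])
  fix p and \<xi> :: complex assume p: "p \<in> closed_segment z (z + \<zeta> *s v)" and \<xi>: "cmod \<xi> < \<eta>"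
  obtain u where u: "0 \<le> u" "u \<le> 1" "p = (1 - u) *\<^sub>R z + u *\<^sub>R (z + \<zeta> *s v)"
    using p by (auto simp: in_segment)
  have eq: "p + \<xi> *s (z + \<zeta> *s v - z) = z + (complex_of_real u * \<zeta> + \<xi> * \<zeta>) *s v"
    unfolding u vec_eq_iff by (auto simp: algebra_simps scaleR_conv_of_real[where 'a=complex])
  have lt: "cmod (of_real u * \<zeta> + \<xi> * \<zeta>) < R"
  proof -
    have "cmod (of_real u * \<zeta> + \<xi> * \<zeta>) \<le> u * cmod \<zeta> + cmod \<xi> * cmod \<zeta>"
      using norm_triangle_ineq[of "of_real u * \<zeta>" "\<xi> * \<zeta>"] u by (simp add: norm_mult)
    also have "\<dots> = (u + cmod \<xi>) * cmod \<zeta>" by (simp add: algebra_simps)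
    also have "\<dots> \<le> (1 + \<eta>) * ((1 - \<eta>) * R)" using u \<xi> \<zeta> \<eta> by (intro mult_mono) auto
    also have "\<dots> = R - \<eta> * \<eta> * R" by (simp add: algebra_simps)
    also have "\<dots> < R" using \<eta> \<open>R > 0\<close> by simp
    finally show ?thesis .
  qed
  show "p + \<xi> *s (z + \<zeta> *s v - z) \<in> \<Omega>" unfolding eq by (rule disc_inD[OF d lt])
qed

text \<open>Choosing the argument of \<zeta> suitably lowers the functional by the full modulus of
  \<open>\<zeta> * cform a v\<close>, so otherwise the disc would cross the hyperplane.\<close>

lemma supports_disc:
  assumes s: "supports a q" and d: "disc_in z v R" and "R > 0"
  shows "R * cmod (cform a v) \<le> Re (cform a (z - q))"
proof (rule ccontr)
  define X where "X = Re (cform a (z - q))"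
  define l where "l = cform a v"
  assume "\<not> R * cmod (cform a v) \<le> Re (cform a (z - q))"
  then have lt: "X < R * cmod l" by (simp add: X_def l_def)
  have "z \<in> \<Omega>" using disc_inD[OF d, of 0] \<open>R > 0\<close> by simp
  then have "X > 0" using supportsD(2)[OF s] by (simp add: X_def)
  then have "l \<noteq> 0" using lt by auto
  define \<zeta> where "\<zeta> = - of_real (X / cmod l) * cnj (sgn l)"
  have "cmod \<zeta> = X / cmod l" using \<open>l \<noteq> 0\<close> \<open>X > 0\<close> by (simp add: \<zeta>_def norm_mult norm_divide norm_sgn)
  also have "\<dots> < R" using lt \<open>l \<noteq> 0\<close> by (simp add: field_simps)
  finally have "z + \<zeta> *s v \<in> \<Omega>" by (rule disc_inD[OF d])
  then have "Re (cform a (z + \<zeta> *s v - q)) > 0" by (rule supportsD(2)[OF s])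
  moreover have "cform a (z + \<zeta> *s v - q) = cform a (z - q) + \<zeta> * l" by (simp add: cform_simps l_def)
  moreover have "cnj (sgn l) * l = of_real (cmod l)"
    using \<open>l \<noteq> 0\<close> by (simp add: sgn_eq complex_norm_square[symmetric] power2_eq_square mult.commute)
  then have "\<zeta> * l = - of_real (X / cmod l) * of_real (cmod l)" unfolding \<zeta>_def by (simp only: mult.assoc)
  then have "\<zeta> * l = - of_real X" using \<open>l \<noteq> 0\<close> by simp
  ultimately show False by (simp add: X_def)
qed

text \<open>The Gromov products at \<open>z0\<close> of consecutive points in the chain
  \<open>ray z s\<close>, \<open>z\<close>, \<open>w\<close>, \<open>ray w s'\<close> are all at
  least \<open>k - C\<close>, so hyperbolicity, applied twice, bounds that of the ends. The
  hypothesis \<open>far\<close> ensures this for the pair \<open>z\<close>,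
  \<open>w\<close>.\<close>

lemma rays_fellow_travel:
  assumes C: "\<And>x s. \<lbrakk>x \<in> \<Omega>; 0 \<le> s; s \<le> 1\<rbrakk> \<Longrightarrow> gromov_product K (ray x s) x z0 \<le> C" and "C \<ge> 0"
    and zw: "z \<in> \<Omega>" "w \<in> \<Omega>" "K z w \<le> D" and s: "0 \<le> s" "s \<le> 1" and far: "D + 2 * C \<le> K z (ray z s)"
  shows "\<exists>s'\<ge>0. s' \<le> 1 \<and> K (ray z s) (ray w s') \<le> 2 * C + 4 * \<delta>"
proof -
  have zs: "ray z s \<in> \<Omega>" by (rule ray_in[OF zw(1) s])
  define k where "k = K (ray z s) z0"
  have "K z (ray z s) + k - K z z0 \<le> 2 * C"
    using C[OF zw(1) s] by (simp add: gromov_product_def k_def)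
  then have k_le: "k + D \<le> K z z0" using far by linarith
  have wz: "K w z \<le> D" using zw commute[of w z] by simp
  have "K z z0 \<le> K z w + K w z0" by (intro triangle z0_in zw)
  then have kw: "k \<le> K w z0" using k_le zw by linarith
  have cont: "continuous_on {0..1} (\<lambda>t. K (ray w t) z0)"
  proof -
    define r where "r = min (bd w) (c / 2)"
    have r: "r > 0" "ball w r \<subseteq> \<Omega>" "r \<le> c"
      using bd_pos[OF zw(2)] c_pos ball_bd_subset[of w] subset_ball[of r "bd w" w] by (auto simp: r_def)
    have lip: "K (ray w t1) (ray w t2) \<le> dm / r * (t2 - t1)" if "0 \<le> t1" "t1 \<le> t2" "t2 \<le> 1" for t1 t2
    proof -
      have "K (ray w t1) (ray w t2) \<le> (t2 - t1) * dm / r"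
      proof (rule K_ray_le[OF zw(2) r(2,1) that r(1)])
        fix u assume "t1 \<le> u" "u \<le> t2"
        then have "u * r \<le> u * c" using that r by (intro mult_left_mono) auto
        then show "r \<le> (1 - u) * r + u * c" by (simp add: algebra_simps)
      qed
      then show ?thesis by (simp add: mult.commute)
    qed
    have "(dm / r)-lipschitz_on {0..1} (\<lambda>t. K (ray w t) z0)"
    proof (rule lipschitz_onI)
      fix t1 t2 :: real assume t: "t1 \<in> {0..1}" "t2 \<in> {0..1}"
      have in\<Omega>: "ray w t1 \<in> \<Omega>" "ray w t2 \<in> \<Omega>" using t ray_in[OF zw(2)] by auto
      have "K (ray w t1) (ray w t2) \<le> dm / r * \<bar>t2 - t1\<bar>"
      proof (cases "t1 \<le> t2")
        case False
        then show ?thesis using lip[of t2 t1] t commute[of "ray w t1"] by simp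
      qed (use lip[of t1 t2] t in auto)
      then show "dist (K (ray w t1) z0) (K (ray w t2) z0) \<le> dm / r * dist t1 t2"
        using triangle[OF in\<Omega> z0_in] triangle[OF in\<Omega>(2,1) z0_in] commute[of "ray w t1" "ray w t2"]
        by (simp add: dist_real_def abs_le_iff abs_minus_commute)
    qed (use dm_pos r in simp)
    then show ?thesis by (rule lipschitz_on_continuous_on)
  qed
  \<comment> \<open>The partner on the other ray is chosen at the same distance \<open>k\<close>
    from \<open>z0\<close>, so that a large Gromov product means a small distance.\<close>
  have "\<exists>t. 0 \<le> t \<and> t \<le> 1 \<and> K (ray w t) z0 = k"
    by (rule IVT2') (use cont kw z0_in in \<open>auto simp: k_def\<close>)
  then obtain s' where s': "0 \<le> s'" "s' \<le> 1" "K (ray w s') z0 = k" by blast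
  have ws: "ray w s' \<in> \<Omega>" by (rule ray_in[OF zw(2) s'(1,2)])
  have "gromov_product K z0 (ray z s) z \<ge> k - C"
    using C[OF zw(1) s] commute[of z0 "ray z s"] commute[of z0 z] commute[of z "ray z s"]
    unfolding gromov_product_def k_def by (simp add: field_simps)
  moreover have "gromov_product K z0 w (ray w s') \<ge> k - C"
    using C[OF zw(2) s'(1,2)] s'(3) commute[of z0 "ray w s'"] commute[of w z0] commute[of w "ray w s'"]
    unfolding gromov_product_def by (simp add: field_simps)
  moreover have "gromov_product K z0 z w \<ge> k"
    using k_le kw triangle[OF zw(1,2) z0_in] triangle[OF zw(2,1) z0_in] zw(3) commute[of z0 w] commute[of z w]
    unfolding gromov_product_def by (simp add: field_simps)
  moreover have "gromov_product K z0 z (ray w s') \<ge> min (gromov_product K z0 z w) (gromov_product K z0 w (ray w s')) - \<delta>"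
    by (intro hyperbolic z0_in zw ws)
  moreover have "gromov_product K z0 (ray z s) (ray w s') \<ge> min (gromov_product K z0 (ray z s) z) (gromov_product K z0 z (ray w s')) - \<delta>"
    by (intro hyperbolic z0_in zw ws zs)
  ultimately have "gromov_product K z0 (ray z s) (ray w s') \<ge> k - C - 2 * \<delta>"
    using \<delta>_nonneg \<open>C \<ge> 0\<close> by linarith
  then have "K (ray z s) (ray w s') \<le> 2 * C + 4 * \<delta>"
    using s'(3) commute[of z0 "ray w s'"] unfolding gromov_product_def k_def by (simp add: field_simps)
  then show ?thesis using s' by blast
qed

text \<open>If the disc did not grow, the hyperplane supporting \<open>\<Omega>\<close> at a point of \<open>ray z s + \<complex> v\<close> would
  be nearly parallel to the ray.  It would then still be much closer to \<open>w\<close> than to \<open>z\<close> after both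
  points have moved along their rays by more than their mutual distance, so that the rays could not
  fellow travel.\<close>

lemma disc_growth:
  "\<exists>\<eta>>0. \<exists>A\<ge>2 / c. \<forall>z\<in>\<Omega>. \<forall>v R. R > 0 \<and> disc_in z v R \<and> A * bd z \<le> \<eta> \<longrightarrow>
     A * bd z \<le> 1 \<and> disc_in (ray z (A * bd z)) v ((1 + \<eta>) * R)"
proof -
  obtain C where "C \<ge> 0" and C: "\<And>x s. \<lbrakk>x \<in> \<Omega>; 0 \<le> s; s \<le> 1\<rbrakk> \<Longrightarrow> gromov_product K (ray x s) x z0 \<le> C"
    using ray_stability by blast
  \<comment> \<open>\<open>C1\<close> is the fellow travelling distance, \<open>C2\<close> gives
    \<open>s' \<le> C2 * s\<close>, and \<open>C3\<close> collects the error terms. \<eta> is small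
    enough to refute \<open>1 \<le> \<eta> * (4 * C3 * exp (2 * C1))\<close>, and \<open>A\<close>
    is large enough for the move along the ray to exceed \<open>1 / \<eta> + 2 * C\<close>.\<close>
  define C1 where "C1 = 2 * C + 4 * \<delta>"
  define C2 where "C2 = (dm + 2) * exp (2 * C1) / c"
  define C3 where "C3 = 2 * dm * (1 + C2) / c + 2"
  define \<eta> where "\<eta> = min (1 / 2) (1 / (8 * C3 * exp (2 * C1)))"
  define A where "A = max (max 1 (2 / c)) (exp (2 * (1 / \<eta> + 2 * C)) / c)"
  have "C2 > 0" using dm_pos c_pos by (simp add: C2_def)
  define E where "E = dm * (1 + C2) / c"
  have E: "E \<ge> 0" "C3 = 2 * E + 2" using dm_pos c_pos \<open>C2 > 0\<close> by (simp_all add: E_def C3_def)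
  then have "C3 > 0" by simp
  then have \<eta>: "0 < \<eta>" "\<eta> \<le> 1 / 2" "\<eta> \<le> 1 / (8 * C3 * exp (2 * C1))" by (auto simp: \<eta>_def)
  have A: "A \<ge> 1" "A \<ge> 2 / c" "A \<ge> exp (2 * (1 / \<eta> + 2 * C)) / c" by (auto simp: A_def)
  have main: "z' + \<zeta>0 *s v \<in> \<Omega>"
    if z: "z \<in> \<Omega>" and R: "R > 0" and d: "disc_in z v R" and s: "s = A * bd z" "s \<le> \<eta>" and z': "z' = ray z s"
      and \<zeta>0: "cmod \<zeta>0 < (1 + \<eta>) * R" for z v R s z' \<zeta>0
  proof (rule ccontr)
    define q where "q = z' + \<zeta>0 *s v"
    assume "z' + \<zeta>0 *s v \<notin> \<Omega>"
    then obtain a where a: "supports a q" using supports_exists[of q] by (auto simp: q_def)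
    have r: "bd z > 0" by (rule bd_pos[OF z])
    then have s01: "0 < s" "s \<le> 1" using s \<eta> A by auto
    have z'in: "z' \<in> \<Omega>" unfolding z' by (rule ray_in) (use z s01 in auto)
    \<comment> \<open>\<theta> shrinks \<open>\<zeta>0\<close> from modulus below
      \<open>(1 + \<eta>) * R\<close> to at most \<open>(1 - \<eta>) * R\<close>. Hence
      \<open>w\<close> lies in the given disc at distance at most \<open>1 / \<eta>\<close> from
      \<open>z\<close>, while \<open>\<theta> * \<zeta>0\<close> is still close to
      \<open>\<zeta>0\<close>.\<close>
    define \<theta> where "\<theta> = (1 - \<eta>) / (1 + \<eta>)"
    define w where "w = z + (of_real \<theta> * \<zeta>0) *s v"
    have \<theta>: "0 \<le> \<theta>" "1 - \<theta> \<le> 2 * \<eta>" "0 \<le> 1 - \<theta>"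
      using \<eta> by (auto simp: \<theta>_def field_simps)
    have "\<theta> * cmod \<zeta>0 \<le> \<theta> * ((1 + \<eta>) * R)" using \<theta> \<zeta>0 by (intro mult_left_mono) auto
    also have "\<dots> = (1 - \<eta>) * R" using \<eta> by (simp add: \<theta>_def)
    finally have th: "cmod (of_real \<theta> * \<zeta>0) \<le> (1 - \<eta>) * R" using \<theta> by (simp add: norm_mult)
    also have "(1 - \<eta>) * R < R" using \<eta> R by (simp add: algebra_simps)
    finally have w: "w \<in> \<Omega>" unfolding w_def by (rule disc_inD[OF d])
    have Kzw: "K z w \<le> 1 / \<eta>" unfolding w_def by (rule K_disc_le[OF d \<eta>(1) _ th R]) (use \<eta> in simp)
    have "exp (2 * (1 / \<eta> + 2 * C)) \<le> A * c" using A(3) c_pos by (simp add: field_simps)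
    also have "\<dots> \<le> ((1 - s) * bd z + s * c) / bd z"
      using r s s01 by (simp add: field_simps)
    finally have "2 * (1 / \<eta> + 2 * C) \<le> ln (((1 - s) * bd z + s * c) / bd z)"
      using r s01 c_pos by (subst ln_ge_iff) (auto intro!: divide_pos_pos add_nonneg_pos)
    also have "\<dots> \<le> 2 * K z z'"
      using K_ray_ge[OF z, of 0 s] s01 by (simp add: z')
    finally have far: "1 / \<eta> + 2 * C \<le> K z z'" by simp
    have "\<exists>s'\<ge>0. s' \<le> 1 \<and> K (ray z s) (ray w s') \<le> 2 * C + 4 * \<delta>"
    proof (rule rays_fellow_travel)
      show "gromov_product K (ray x t) x z0 \<le> C" if "x \<in> \<Omega>" "0 \<le> t" "t \<le> 1" for x t
        using C that .
    qed (use \<open>C \<ge> 0\<close> z w Kzw s01 far z' in auto)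
    then obtain s' where s': "0 \<le> s'" "s' \<le> 1" "K z' (ray w s') \<le> C1"
      unfolding C1_def z' by blast
    have ws: "ray w s' \<in> \<Omega>" by (rule ray_in[OF w s'(1,2)])
    \<comment> \<open>The functional supporting \<Omega> at the boundary point nearest to
      \<open>z\<close> is at most \<open>s * (dm + 2)\<close> at \<open>z'\<close>, since
      \<open>bd z \<le> s\<close>, and at least \<open>s' * c\<close> at \<open>ray w s'\<close>. At
      distance \<open>C1\<close> the two values are comparable.\<close>
    have s'_le: "s' \<le> C2 * s"
    proof -
      obtain b p where b: "supports b p" "Re (cform b (z - p)) = bd z" using nearest_support[OF z] .
      have ray_b: "Re (cform b (ray x t - p)) = (1 - t) * Re (cform b (x - p)) + t * Re (cform b (z0 - p))" for x t
      proof -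
        have eq: "ray x t - p = (1 - t) *\<^sub>R (x - p) + t *\<^sub>R (z0 - p)" by (simp add: ray_def algebra_simps)
        show ?thesis unfolding eq by (simp only: cform_simps(1,5) plus_complex.sel scaleR_complex.sel)
      qed
      have "Re (cform b (z0 - p)) = Re (cform b (z - p)) + Re (cform b (z0 - z))" by (simp add: cform_simps)
      also have "\<dots> \<le> bd z + dm"
        using b(2) order_trans[OF complex_Re_le_cmod order_trans[OF supportsD(3)[OF b(1)] diam[OF z0_in z]]] by simp
      finally have o_le: "Re (cform b (z0 - p)) \<le> bd z + dm" .
      have "1 * bd z \<le> s" using A(1) r unfolding s(1) by (intro mult_right_mono) auto
      have "Re (cform b (z' - p)) \<le> 1 * bd z + s * (bd z + dm)"
        unfolding z' ray_b b(2) using s01 r o_le by (intro add_mono mult_right_mono mult_left_mono) auto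
      also have "\<dots> \<le> 1 * s + s * (1 + dm)"
        using \<open>1 * bd z \<le> s\<close> s01 by (intro add_mono mult_left_mono) auto
      finally have z'_le: "Re (cform b (z' - p)) \<le> s * (dm + 2)" by (simp add: algebra_simps)
      have "0 \<le> (1 - s') * Re (cform b (w - p))" using supportsD(2)[OF b(1) w] s' by simp
      moreover have "s' * c \<le> s' * Re (cform b (z0 - p))"
        using s' supports_ball[OF b(1) z0_in ball_z0] by (intro mult_left_mono) auto
      ultimately have "s' * c \<le> (1 - s') * Re (cform b (w - p)) + s' * Re (cform b (z0 - p))" by linarith
      also have "\<dots> = Re (cform b (ray w s' - p))" by (simp add: ray_b)
      also have "\<dots> \<le> exp (2 * C1) * Re (cform b (z' - p))"
      proof -
        have pos: "Re (cform b (z' - p)) > 0" "Re (cform b (ray w s' - p)) > 0"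
          using supportsD(2)[OF b(1)] z'in ws by auto
        have "ln (Re (cform b (ray w s' - p)) / Re (cform b (z' - p))) \<le> 2 * K z' (ray w s')"
          by (rule K_lower_Re[OF supportsD(2)[OF b(1)] z'in ws])
        then have "ln (Re (cform b (ray w s' - p)) / Re (cform b (z' - p))) \<le> 2 * C1" using s'(3) by linarith
        then have "exp (ln (Re (cform b (ray w s' - p)) / Re (cform b (z' - p)))) \<le> exp (2 * C1)" by (simp only: exp_le_cancel_iff)
        then show ?thesis using pos by (simp add: pos_divide_le_eq)
      qed
      also have "\<dots> \<le> exp (2 * C1) * (s * (dm + 2))" using z'_le by (intro mult_left_mono) auto
      finally have "s' \<le> exp (2 * C1) * (s * (dm + 2)) / c" using c_pos by (simp only: pos_le_divide_eq)
      also have "\<dots> = C2 * s" by (simp add: C2_def)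
      finally show ?thesis .
    qed
    define X where "X = Re (cform a (z - q))"
    define P where "P = cform a (z' - q)"
    have "X > 0" unfolding X_def by (rule supportsD(2)[OF a z])
    have P_eq: "P = - \<zeta>0 * cform a v" by (simp add: P_def q_def cform_simps)
    have "cmod P = cmod \<zeta>0 * cmod (cform a v)" by (simp add: P_eq norm_mult)
    also have "\<dots> \<le> (1 + \<eta>) * R * cmod (cform a v)" using \<zeta>0 by (intro mult_right_mono) auto
    also have "\<dots> = (1 + \<eta>) * (R * cmod (cform a v))" by simp
    also have "\<dots> \<le> (1 + \<eta>) * X" unfolding X_def using \<eta> by (intro mult_left_mono supports_disc[OF a d R]) auto
    finally have P_le: "cmod P \<le> (1 + \<eta>) * X" .
    \<comment> \<open>The modulus of \<open>P\<close> is at most \<open>(1 + \<eta>) * X\<close>, so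
      the contribution of \<open>z0\<close> to \<open>Re P\<close> is small. This is the near
      parallelism of ray and hyperplane, and yields
      \<open>s * c \<le> 2 * \<eta> * X\<close>.\<close>
    have ReP: "Re P = (1 - s) * X + s * Re (cform a (z0 - q))"
    proof -
      have eq: "z' - q = (1 - s) *\<^sub>R (z - q) + s *\<^sub>R (z0 - q)" by (simp add: z' ray_def algebra_simps)
      show ?thesis unfolding P_def X_def eq by (simp only: cform_simps(1,5) plus_complex.sel scaleR_complex.sel)
    qed
    have "c \<le> Re (cform a (z0 - q))" by (rule supports_ball[OF a z0_in ball_z0])
    then have sc: "s * c \<le> s * Re (cform a (z0 - q))" using s01 by (intro mult_left_mono) auto
    moreover have "Re P \<le> (1 + \<eta>) * X" using complex_Re_le_cmod P_le by (rule order_trans)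
    moreover have "(s + \<eta>) * X \<le> 2 * \<eta> * X" using s(2) \<open>X > 0\<close> by (intro mult_right_mono) auto
    ultimately have sc_le: "s * c \<le> 2 * \<eta> * X" using ReP by (simp add: algebra_simps)
    have "s * c \<ge> 0" using s01 c_pos by simp
    have "X / 2 \<le> (1 - s) * X" using s(2) \<eta>(2) \<open>X > 0\<close> by simp
    also have "\<dots> \<le> Re P" using ReP sc \<open>s * c \<ge> 0\<close> by linarith
    also have "\<dots> \<le> cmod P" by (rule complex_Re_le_cmod)
    finally have P_ge: "X / 2 \<le> cmod P" .
    \<comment> \<open>As \<open>P = - \<zeta>0 * cform a v\<close>, the multiple
      \<open>\<theta> * \<zeta>0\<close> leaves the fraction \<open>1 - \<theta>\<close> of
      \<open>P\<close>. Each of the three terms is at most a constant times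
      \<open>\<eta> * X\<close>.\<close>
    have "cform a (ray w s' - q) = cform a (ray w s' - ray w 0) + cform a (z - z') + (cform a (z' - q) + of_real \<theta> * \<zeta>0 * cform a v)"
      by (simp add: w_def cform_simps)
    also have "cform a (z' - q) + of_real \<theta> * \<zeta>0 * cform a v = of_real (1 - \<theta>) * P"
      unfolding P_def[symmetric] by (simp add: P_eq algebra_simps)
    finally have split: "cform a (ray w s' - q) = cform a (ray w s' - ray w 0) + cform a (z - z') + of_real (1 - \<theta>) * P" .
    have tri: "cmod (x + y + t) \<le> cmod x + cmod y + cmod t" for x y t :: complex
      using norm_triangle_ineq[of "x + y" t] norm_triangle_ineq[of x y] by linarith
    have "cmod (cform a (ray w s' - q)) \<le> cmod (cform a (ray w s' - ray w 0)) + cmod (cform a (z - z')) + cmod (of_real (1 - \<theta>) * P)"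
      unfolding split by (rule tri)
    also have "\<dots> \<le> s' * dm + s * dm + 2 * \<eta> * (2 * X)"
    proof (intro add_mono)
      show "cmod (cform a (ray w s' - ray w 0)) \<le> s' * dm"
        using order_trans[OF supportsD(3)[OF a] norm_ray_diff[OF w, of s' 0]] s' by simp
      show "cmod (cform a (z - z')) \<le> s * dm"
        using order_trans[OF supportsD(3)[OF a] norm_ray_diff[OF z, of 0 s]] s01 by (simp add: z')
      have "(1 + \<eta>) * X \<le> 2 * X" using \<eta> \<open>X > 0\<close> by (intro mult_right_mono) auto
      then have "(1 - \<theta>) * cmod P \<le> 2 * \<eta> * (2 * X)" using \<theta> P_le \<eta> by (intro mult_mono) auto
      moreover have "cmod (of_real (1 - \<theta>) * P) = (1 - \<theta>) * cmod P" using \<theta> by (simp only: norm_mult norm_of_real abs_of_nonneg)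
      ultimately show "cmod (of_real (1 - \<theta>) * P) \<le> 2 * \<eta> * (2 * X)" by simp
    qed
    also have "\<dots> \<le> C2 * s * dm + s * dm + 4 * \<eta> * X" using s'_le dm_pos by (simp add: mult_right_mono)
    also have "\<dots> = s * c * E + 4 * \<eta> * X" using c_pos by (simp add: E_def field_simps)
    also have "\<dots> \<le> 2 * \<eta> * X * E + 4 * \<eta> * X"
      using sc_le E by (intro add_right_mono mult_right_mono) auto
    also have "\<dots> = \<eta> * X * (2 * E + 4)" by (simp add: algebra_simps)
    also have "\<dots> \<le> \<eta> * X * (2 * C3)"
      using \<eta> \<open>X > 0\<close> E by (intro mult_left_mono) auto
    finally have small: "cmod (cform a (ray w s' - q)) \<le> \<eta> * X * (2 * C3)" .
    have posw: "cmod (cform a (ray w s' - q)) > 0"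
      using less_le_trans[OF supportsD(2)[OF a ws] complex_Re_le_cmod] .
    have "ln (cmod P / cmod (cform a (ray w s' - q))) \<le> 2 * K (ray w s') z'"
      unfolding P_def by (rule K_lower_norm[OF supportsD(2)[OF a] ws z'in])
    also have "\<dots> \<le> 2 * C1" using s'(3) commute[of z' "ray w s'"] by simp
    finally have le: "ln (cmod P / cmod (cform a (ray w s' - q))) \<le> 2 * C1" .
    have "cmod P > 0" using P_ge \<open>X > 0\<close> by linarith
    then have "cmod P / cmod (cform a (ray w s' - q)) = exp (ln (cmod P / cmod (cform a (ray w s' - q))))"
      using posw by (intro exp_ln[symmetric] divide_pos_pos)
    also have "\<dots> \<le> exp (2 * C1)" using le by (simp only: exp_le_cancel_iff)
    finally have "cmod P \<le> exp (2 * C1) * cmod (cform a (ray w s' - q))"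
      using posw by (simp only: pos_divide_le_eq)
    also have "\<dots> \<le> exp (2 * C1) * (\<eta> * X * (2 * C3))" using small by (intro mult_left_mono) auto
    also have "\<dots> = X * (\<eta> * (4 * C3 * exp (2 * C1))) / 2" by simp
    finally have "X \<le> X * (\<eta> * (4 * C3 * exp (2 * C1)))" using P_ge by linarith
    then have "1 \<le> \<eta> * (4 * C3 * exp (2 * C1))" using \<open>X > 0\<close> by simp
    moreover have "\<eta> * (8 * C3 * exp (2 * C1)) \<le> 1"
      using \<eta>(3) \<open>C3 > 0\<close> by (simp add: pos_le_divide_eq)
    moreover have "\<eta> * (8 * C3 * exp (2 * C1)) = 2 * (\<eta> * (4 * C3 * exp (2 * C1)))" by simp
    ultimately show False by linarith
  qed
  have "A * bd z \<le> 1 \<and> disc_in (ray z (A * bd z)) v ((1 + \<eta>) * R)"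
    if "z \<in> \<Omega>" "R > 0 \<and> disc_in z v R \<and> A * bd z \<le> \<eta>" for z v R
    using main[of z R v "A * bd z" "ray z (A * bd z)"] that \<eta>(2) unfolding disc_in_def by simp
  with \<eta>(1) A(2) show ?thesis by blast
qed

end

section \<open>Euclidean length of quasi-geodesics\<close>

lemma curve_length_le_of_increments:
  fixes g :: "real \<Rightarrow> 'a::metric_space"
  assumes inc: "\<And>s t. \<lbrakk>a \<le> s; s \<le> t; t \<le> b\<rbrakk> \<Longrightarrow> dist (g s) (g t) \<le> \<Phi> t - \<Phi> s" and M: "\<Phi> b - \<Phi> a \<le> M"
  shows "curve_length a b g \<le> ennreal M"
  unfolding curve_length_def
proof (rule Sup_least)
  fix l assume "l \<in> {(\<Sum>i<N. ennreal (dist (g (t i)) (g (t (Suc i))))) | (N::nat) t.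
            mono_on {..N} t \<and> t ` {..N} \<subseteq> {a..b}}"
  then obtain N :: nat and t where l: "l = (\<Sum>i<N. ennreal (dist (g (t i)) (g (t (Suc i)))))"
    and t: "mono_on {..N} t" "t ` {..N} \<subseteq> {a..b}" by blast
  have tab: "a \<le> t i" "t i \<le> b" if "i \<le> N" for i using t(2) that by (auto simp: image_subset_iff)
  have "(\<Sum>i<N. dist (g (t i)) (g (t (Suc i)))) \<le> (\<Sum>i<N. \<Phi> (t (Suc i)) - \<Phi> (t i))"
  proof (rule sum_mono)
    fix i assume i: "i \<in> {..<N}"
    have "t i \<le> t (Suc i)" by (rule mono_onD[OF t(1)]) (use i in auto)
    then show "dist (g (t i)) (g (t (Suc i))) \<le> \<Phi> (t (Suc i)) - \<Phi> (t i)"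
      using i tab by (intro inc) auto
  qed
  also have "\<dots> = \<Phi> (t N) - \<Phi> (t 0)"
    by (rule sum_lessThan_telescope)
  \<comment> \<open>A partition need not contain \<open>a\<close> and \<open>b\<close>;
    \<open>\<Phi>\<close> is increasing because its increments dominate distances.\<close>
  also have "\<dots> \<le> \<Phi> b - \<Phi> a"
  proof -
    have "0 \<le> \<Phi> b - \<Phi> (t N)" using inc[of "t N" b] tab[of N] by (intro order_trans[OF zero_le_dist]) auto
    moreover have "0 \<le> \<Phi> (t 0) - \<Phi> a" using inc[of a "t 0"] tab[of 0] by (intro order_trans[OF zero_le_dist]) auto
    ultimately show ?thesis by linarith
  qed
  finally have "(\<Sum>i<N. dist (g (t i)) (g (t (Suc i)))) \<le> M" using M by linarith
  then show "l \<le> ennreal M" unfolding l by (simp add: ennreal_leI)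
qed

text \<open>By the mean value theorem; the constant 3 comes from
  \<open>1 + \<xi>^2 \<le> 3 * (1 + u^2)\<close> for \<xi> within 1 of \<open>u\<close>. In this
  form \<open>arctan\<close> sums increments weighted by the value at the left end point.\<close>

lemma arctan_increment_ge:
  assumes "u \<le> w" "w - u \<le> 1"
  shows "(w - u) / (3 * (1 + u\<^sup>2)) \<le> arctan w - arctan u"
proof (cases "u = w")
  case False
  then have "u < w" using assms by simp
  then obtain \<xi> where \<xi>: "u < \<xi>" "\<xi> < w" "arctan w - arctan u = (w - u) * inverse (1 + \<xi>\<^sup>2)"
    using MVT2[of u w arctan "\<lambda>x. inverse (1 + x\<^sup>2)"] DERIV_arctan by blast
  define e where "e = \<xi> - u"
  have e: "0 \<le> e" "e \<le> 1" "\<xi> = u + e" using \<xi> assms by (auto simp: e_def)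
  have "e\<^sup>2 \<le> 1" using e by (simp add: power_le_one)
  moreover have "3 * (1 + u\<^sup>2) - (1 + \<xi>\<^sup>2) = (u - e)\<^sup>2 + u\<^sup>2 + 2 * (1 - e\<^sup>2)"
    unfolding e(3) by (simp add: power2_eq_square algebra_simps)
  moreover have "A \<le> B" if "t \<le> 1" "B - A = v + w + 2 * (1 - t)" "0 \<le> v" "0 \<le> w" for A B t v w :: real
    using that by argo
  ultimately have "1 + \<xi>\<^sup>2 \<le> 3 * (1 + u\<^sup>2)" using zero_le_power2 by blast
  moreover have "0 < 1 + \<xi>\<^sup>2" by (simp add: add_pos_nonneg)
  ultimately have "(w - u) / (3 * (1 + u\<^sup>2)) \<le> (w - u) / (1 + \<xi>\<^sup>2)"
    using \<open>u < w\<close> by (intro divide_left_mono) (auto intro!: mult_pos_pos add_pos_nonneg)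
  then show ?thesis using \<xi>(3) by (simp add: divide_inverse)
qed simp

text \<open>Trades exponential decay for a weight whose bounded primitive \<open>arctan\<close> is
  given by one formula on both sides of the peak. The quadratic term of the exponential series
  suffices.\<close>

lemma exp_minus_le_quadratic:
  fixes \<mu> u :: real
  assumes "\<mu> > 0" "u \<ge> 0"
  shows "exp (- \<mu> * u) \<le> max 1 (2 / \<mu>\<^sup>2) / (1 + u\<^sup>2)"
proof -
  define C where "C = max 1 (2 / \<mu>\<^sup>2)"
  have "C \<ge> 1" "C * \<mu>\<^sup>2 \<ge> 2" using assms by (auto simp: C_def max_def field_simps split: if_splits)
  have "1 + \<mu> * u + (\<mu> * u)\<^sup>2 / 2 \<le> exp (\<mu> * u)"
    using assms by (intro exp_lower_Taylor_quadratic) simp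
  then have "1 + (\<mu> * u)\<^sup>2 / 2 \<le> exp (\<mu> * u)" using assms mult_nonneg_nonneg[of \<mu> u] by linarith
  then have "C * (1 + (\<mu> * u)\<^sup>2 / 2) \<le> C * exp (\<mu> * u)" using \<open>C \<ge> 1\<close> by (intro mult_left_mono) auto
  moreover have "2 * u\<^sup>2 \<le> C * \<mu>\<^sup>2 * u\<^sup>2" using \<open>C * \<mu>\<^sup>2 \<ge> 2\<close> by (intro mult_right_mono) auto
  ultimately have "1 + u\<^sup>2 \<le> C * exp (\<mu> * u)" using \<open>C \<ge> 1\<close> by (simp add: algebra_simps power_mult_distrib)
  moreover have "0 < 1 + u\<^sup>2" by (simp add: add_pos_nonneg)
  ultimately show ?thesis unfolding C_def[symmetric] by (simp add: exp_minus field_simps)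
qed

context hyperbolic_convex_domain
begin

section \<open>Radii of affine discs and the Euclidean distance\<close>

lemma disc_radius_le_dm:
  assumes "norm v = 1" "R > 0" and d: "disc_in z v R"
  shows "R \<le> dm"
proof (rule ccontr)
  assume "\<not> R \<le> dm"
  define t where "t = (dm + R) / 2"
  have t: "dm < t" "t < R" "t > 0" using \<open>\<not> R \<le> dm\<close> dm_pos by (auto simp: t_def)
  have "z + of_real t *s v \<in> \<Omega>" "z \<in> \<Omega>"
    using disc_inD[OF d, of "of_real t"] disc_inD[OF d, of 0] t assms by auto
  from diam[OF this] have "norm (of_real t *s v) \<le> dm" by simp
  then show False using t assms(1) by (simp add: norm_vector_scalar_mult)
qed

text \<open>Zimmer's theorem that a Gromov hyperbolic bounded convex domain is \<open>m\<close>-convex for some \<open>m\<close>,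
  with \<open>\<epsilon> = 1 / m\<close>.\<close>

lemma disc_radius_le_powr:
  "\<exists>C>0. \<exists>\<epsilon>>0. \<epsilon> \<le> 1 \<and> (\<forall>z\<in>\<Omega>. \<forall>v R. norm v = 1 \<and> R > 0 \<and> disc_in z v R \<longrightarrow> R \<le> C * bd z powr \<epsilon>)"
proof -
  obtain \<eta> A where \<eta>: "\<eta> > 0" and A: "A \<ge> 2 / c"
    and grow: "\<And>z v R. \<lbrakk>z \<in> \<Omega>; R > 0; disc_in z v R; A * bd z \<le> \<eta>\<rbrakk> \<Longrightarrow>
     A * bd z \<le> 1 \<and> disc_in (ray z (A * bd z)) v ((1 + \<eta>) * R)"
    using disc_growth by blast
  have "A > 0" using A c_pos by (intro less_le_trans[OF _ A]) simp
  have Ac: "A * c \<ge> 2" using A c_pos by (simp add: pos_divide_le_eq)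
  define B where "B = 1 + A * dm"
  have "B > 1" using \<open>A > 0\<close> dm_pos by (simp add: B_def)
  \<comment> \<open>Chosen such that \<open>B powr \<epsilon> \<le> 1 + \<eta>\<close>: growth of
    \<open>bd\<close> by at most \<open>B\<close> is compensated by growth of the radius by
    \<open>1 + \<eta>\<close>. The cap 1 later turns \<open>r \<le> bd (g a)\<close> into
    \<open>r * bd (g a) powr (\<epsilon> - 1) \<le> r powr \<epsilon>\<close>.\<close>
  define \<epsilon> where "\<epsilon> = min 1 (ln (1 + \<eta>) / ln B)"
  have \<epsilon>: "\<epsilon> > 0" "\<epsilon> \<le> 1" using \<eta> \<open>B > 1\<close> by (auto simp: \<epsilon>_def)
  have "\<epsilon> * ln B \<le> ln (1 + \<eta>) / ln B * ln B" using \<open>B > 1\<close> by (intro mult_right_mono) (auto simp: \<epsilon>_def)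
  then have "\<epsilon> * ln B \<le> ln (1 + \<eta>)" using \<open>B > 1\<close> by simp
  then have "exp (\<epsilon> * ln B) \<le> exp (ln (1 + \<eta>))" by (simp only: exp_le_cancel_iff)
  then have B\<epsilon>: "B powr \<epsilon> \<le> 1 + \<eta>" using \<open>B > 1\<close> \<eta> by (simp add: powr_def)
  define C where "C = dm * (A / \<eta>) powr \<epsilon>"
  have "C > 0" using dm_pos \<open>A > 0\<close> \<eta> by (simp add: C_def)
  have deep: "R \<le> C * bd z powr \<epsilon>" if "norm v = 1" "R > 0" "disc_in z v R" "\<eta> < A * bd z" for z v R
  proof -
    have "1 \<le> A / \<eta> * bd z" using that \<eta> by (simp add: field_simps)
    then have "1 \<le> (A / \<eta> * bd z) powr \<epsilon>" using \<epsilon> by (intro ge_one_powr_ge_zero) auto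
    also have "\<dots> = (A / \<eta>) powr \<epsilon> * bd z powr \<epsilon>" by (rule powr_mult)
    finally have "dm * 1 \<le> dm * ((A / \<eta>) powr \<epsilon> * bd z powr \<epsilon>)" using dm_pos by (intro mult_left_mono) auto
    then show ?thesis using disc_radius_le_dm[OF that(1-3)] by (simp add: C_def)
  qed
  \<comment> \<open>\<open>n\<close> bounds the number of moves towards \<open>z0\<close>: each at
    least doubles \<open>bd\<close> because \<open>A * c \<ge> 2\<close>, until
    \<open>A * bd z\<close> exceeds \<eta> and the diameter bounds the radius.\<close>
  have main: "R \<le> C * bd z powr \<epsilon>"
    if "z \<in> \<Omega>" "norm v = 1" "R > 0" "disc_in z v R" "\<eta> < A * 2 ^ n * bd z" for n z v R
    using that
  proof (induction n arbitrary: z R)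
    case 0
    then show ?case using deep by simp
  next
    case (Suc n)
    show ?case
    proof (cases "\<eta> < A * bd z")
      case True
      then show ?thesis using deep Suc.prems by blast
    next
      case False
      define s where "s = A * bd z"
      have r: "bd z > 0" by (rule bd_pos[OF Suc.prems(1)])
      have s1: "s \<le> 1" "disc_in (ray z s) v ((1 + \<eta>) * R)"
        using grow[OF Suc.prems(1,3,4)] False by (auto simp: s_def)
      have s0: "0 \<le> s" using \<open>A > 0\<close> r by (simp add: s_def)
      have z': "ray z s \<in> \<Omega>" by (rule ray_in[OF Suc.prems(1) s0 s1(1)])
      have "2 * bd z \<le> A * c * bd z" using Ac r by (intro mult_right_mono) auto
      also have "\<dots> = s * c" by (simp add: s_def)
      also have "\<dots> \<le> (1 - s) * bd z + s * c" using s1 r by simp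
      also have "\<dots> \<le> bd (ray z s)" by (rule bd_ray_ge[OF Suc.prems(1) s0 s1(1)])
      finally have "A * 2 ^ n * (2 * bd z) \<le> A * 2 ^ n * bd (ray z s)" using \<open>A > 0\<close> by (intro mult_left_mono) auto
      then have "\<eta> < A * 2 ^ n * bd (ray z s)" using Suc.prems(5) by (simp add: mult_ac)
      then have "(1 + \<eta>) * R \<le> C * bd (ray z s) powr \<epsilon>"
        using Suc.IH[OF z' Suc.prems(2) _ s1(2)] \<eta> Suc.prems(3) by simp
      also have "bd (ray z s) \<le> B * bd z"
        using bd_le_add_dist[of "ray z s" z] norm_ray_diff[OF Suc.prems(1), of s 0] s0
        by (simp add: dist_norm B_def s_def algebra_simps)
      then have "bd (ray z s) powr \<epsilon> \<le> (B * bd z) powr \<epsilon>" using \<epsilon> bd_nonneg by (intro powr_mono2) auto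
      then have "C * bd (ray z s) powr \<epsilon> \<le> C * (B * bd z) powr \<epsilon>" using \<open>C > 0\<close> by (intro mult_left_mono) auto
      also have "\<dots> = C * (B powr \<epsilon> * bd z powr \<epsilon>)" using \<open>B > 1\<close> bd_nonneg by (subst powr_mult) auto
      also have "\<dots> \<le> C * ((1 + \<eta>) * bd z powr \<epsilon>)" using B\<epsilon> \<open>C > 0\<close> by (intro mult_left_mono mult_right_mono) auto
      finally have "(1 + \<eta>) * R \<le> (1 + \<eta>) * (C * bd z powr \<epsilon>)" by (simp add: mult_ac)
      then show ?thesis using \<eta> by simp
    qed
  qed
  have "R \<le> C * bd z powr \<epsilon>" if "z \<in> \<Omega>" "norm v = 1 \<and> R > 0 \<and> disc_in z v R" for z v R
  proof -
    have "A * bd z > 0" using bd_pos[OF that(1)] \<open>A > 0\<close> by simp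
    obtain n where "\<eta> / (A * bd z) < 2 ^ n" using real_arch_pow[of 2 "\<eta> / (A * bd z)"] by auto
    then have "\<eta> < A * 2 ^ n * bd z" using \<open>A * bd z > 0\<close> by (simp add: pos_divide_less_eq mult_ac)
    then show ?thesis using main that by blast
  qed
  with \<open>C > 0\<close> \<epsilon> show ?thesis by blast
qed

text \<open>A disc about \<open>x\<close> of twice the permitted radius leaves \<Omega> at some
  \<open>q = x + \<zeta> *s v\<close> on the complex line through \<open>x\<close> and
  \<open>y\<close>. A functional supporting at \<open>q\<close> vanishes there and is affine on the
  line, so its quotient at \<open>y\<close> and \<open>x\<close> is \<open>1 - n / \<zeta>\<close>.
  The logarithm of this quotient is at most \<open>2 * K x y\<close> in modulus, which bounds
  \<open>n / cmod \<zeta>\<close>.\<close>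

lemma norm_diff_le_K:
  "\<exists>C>0. \<exists>\<epsilon>>0. \<epsilon> \<le> 1 \<and> (\<forall>x\<in>\<Omega>. \<forall>y\<in>\<Omega>. norm (y - x) \<le> C * bd x powr \<epsilon> * (exp (2 * K x y) * K x y))"
proof -
  obtain C \<epsilon> where "C > 0" and \<epsilon>: "\<epsilon> > 0" "\<epsilon> \<le> 1"
    and rad: "\<And>z v R. \<lbrakk>z \<in> \<Omega>; norm v = 1; R > 0; disc_in z v R\<rbrakk> \<Longrightarrow> R \<le> C * bd z powr \<epsilon>"
    using disc_radius_le_powr by blast
  have "norm (y - x) \<le> 4 * C * bd x powr \<epsilon> * (exp (2 * K x y) * K x y)" if x: "x \<in> \<Omega>" and y: "y \<in> \<Omega>" for x y
  proof (cases "x = y")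
    case False
    define n where "n = norm (y - x)"
    have n: "n > 0" using False by (simp add: n_def)
    define v where "v = (y - x) /\<^sub>R n"
    have v: "norm v = 1" "y = x + of_real n *s v"
    proof -
      show "norm v = 1" using n by (simp add: v_def n_def)
      have "n *\<^sub>R v = of_real n *s v" unfolding vec_eq_iff by (simp add: scaleR_conv_of_real[where 'a=complex])
      then show "y = x + of_real n *s v" using n by (simp add: v_def)
    qed
    define R where "R = 2 * C * bd x powr \<epsilon>"
    have r: "bd x > 0" by (rule bd_pos[OF x])
    have "R > 0" "\<not> R \<le> C * bd x powr \<epsilon>" using \<open>C > 0\<close> r by (simp_all add: R_def)
    then have "\<not> disc_in x v R" using rad[OF x v(1)] by blast
    then obtain \<zeta> where \<zeta>: "cmod \<zeta> < R" "x + \<zeta> *s v \<notin> \<Omega>" unfolding disc_in_def by blast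
    define q where "q = x + \<zeta> *s v"
    obtain a where a: "supports a q" using supports_exists[of q] \<zeta> by (auto simp: q_def)
    have px: "cform a (x - q) \<noteq> 0" and py: "cform a (y - q) \<noteq> 0"
      using supportsD(2)[OF a x] supportsD(2)[OF a y] by auto
    have lx: "cform a (x - q) = - \<zeta> * cform a v" by (simp add: q_def cform_simps)
    have ly: "cform a (y - q) = (of_real n - \<zeta>) * cform a v"
      by (simp add: q_def v(2) cform_simps algebra_simps)
    have "\<zeta> \<noteq> 0" "cform a v \<noteq> 0" using px lx by auto
    define D where "D = Ln (cform a (y - q)) - Ln (cform a (x - q))"
    have "exp D = cform a (y - q) / cform a (x - q)" unfolding D_def using px py by (simp add: exp_diff)
    also have "\<dots> = 1 - of_real n / \<zeta>" unfolding lx ly using \<open>\<zeta> \<noteq> 0\<close> \<open>cform a v \<noteq> 0\<close> by (simp add: field_simps)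
    finally have "cmod (exp D - 1) = n / cmod \<zeta>" using n by (simp add: norm_divide)
    then have "n / cmod \<zeta> \<le> exp (cmod D) * cmod D" using norm_exp_minus_one_le[of D] by simp
    also have D: "cmod D \<le> 2 * K x y" unfolding D_def by (rule K_lower_Ln[OF supportsD(2)[OF a] x y])
    then have "exp (cmod D) * cmod D \<le> exp (2 * K x y) * (2 * K x y)" by (intro mult_mono) auto
    finally have "n \<le> cmod \<zeta> * (exp (2 * K x y) * (2 * K x y))" using \<open>\<zeta> \<noteq> 0\<close> by (simp add: pos_divide_le_eq mult.commute)
    also have "\<dots> \<le> R * (exp (2 * K x y) * (2 * K x y))" using \<zeta> by (intro mult_right_mono) auto
    finally show ?thesis by (simp add: n_def R_def)
  qed (use \<open>C > 0\<close> in simp)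
  then show ?thesis using \<open>C > 0\<close> \<epsilon> by (intro exI[of _ "4 * C"] conjI exI[of _ \<epsilon>]) auto
qed

section \<open>The length estimate for close and for distant end points\<close>

definition quasi_geodesic :: "real \<Rightarrow> real \<Rightarrow> real \<Rightarrow> (real \<Rightarrow> complex ^ 'n) \<Rightarrow> bool" where
  "quasi_geodesic L a b g \<longleftrightarrow> (\<forall>s\<in>{a..b}. g s \<in> \<Omega>) \<and>
    (\<forall>s\<in>{a..b}. \<forall>t\<in>{a..b}. K (g s) (g t) \<le> L * \<bar>s - t\<bar> \<and> \<bar>s - t\<bar> \<le> L * K (g s) (g t))"

text \<open>The speed is at most a constant times \<open>bd (g a) powr \<epsilon>\<close>, and the
  parameter interval has length at most \<open>L * (2 * r / bd (g a))\<close>. Since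
  \<open>r \<le> bd (g a)\<close> and \<open>\<epsilon> \<le> 1\<close>, the product is at most a
  constant times \<open>r powr \<epsilon>\<close>.\<close>

lemma curve_length_near:
  assumes "L \<ge> 1"
  shows "\<exists>C>0. \<exists>\<epsilon>>0. \<forall>a b g. a \<le> b \<and> quasi_geodesic L a b g \<and> 2 * norm (g a - g b) \<le> bd (g a) \<longrightarrow>
    curve_length a b g \<le> ennreal (C * norm (g a - g b) powr \<epsilon>)"
proof -
  obtain C \<epsilon> where "C > 0" and \<epsilon>: "\<epsilon> > 0" "\<epsilon> \<le> 1"
    and nd: "\<And>x y. \<lbrakk>x \<in> \<Omega>; y \<in> \<Omega>\<rbrakk> \<Longrightarrow> norm (y - x) \<le> C * bd x powr \<epsilon> * (exp (2 * K x y) * K x y)"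
    using norm_diff_le_K by blast
  define L2 where "L2 = L * L"
  define W where "W = C * exp (2 * L2) powr \<epsilon> * (exp (2 * L2) * L)"
  have "W > 0" using \<open>C > 0\<close> \<open>L \<ge> 1\<close> by (simp add: W_def)
  have main: "curve_length a b g \<le> ennreal (W * 2 * L * norm (g a - g b) powr \<epsilon>)"
    if ab: "a \<le> b" and qg: "quasi_geodesic L a b g" and near: "2 * norm (g a - g b) \<le> bd (g a)" for a b g
  proof -
    define r where "r = norm (g a - g b)"
    have g: "g s \<in> \<Omega>" if "s \<in> {a..b}" for s using qg that by (auto simp: quasi_geodesic_def)
    have up: "K (g s) (g t) \<le> L * \<bar>s - t\<bar>" and lo: "\<bar>s - t\<bar> \<le> L * K (g s) (g t)"
      if "s \<in> {a..b}" "t \<in> {a..b}" for s t using qg that by (auto simp: quasi_geodesic_def)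
    have mem: "a \<in> {a..b}" "b \<in> {a..b}" using ab by auto
    have r: "bd (g a) > 0" by (rule bd_pos[OF g[OF mem(1)]])
    have "K (g a) (g b) \<le> norm (g b - g a) / (bd (g a) / 2)"
    proof (rule K_upper_balls)
      fix p assume "p \<in> closed_segment (g a) (g b)"
      then have "norm (p - g a) \<le> norm (g b - g a)" by (rule segment_bound1)
      then have pa: "dist (g a) p \<le> bd (g a) / 2" using near by (simp add: dist_norm norm_minus_commute)
      show "ball p (bd (g a) / 2) \<subseteq> \<Omega>"
      proof
        fix u assume "u \<in> ball p (bd (g a) / 2)"
        then have "dist (g a) u < bd (g a)" using pa dist_triangle[of "g a" u p] by simp
        then show "u \<in> \<Omega>" by (rule in_domain_if_dist_less_bd)
      qed
    qed (use g mem r in auto)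
    also have "\<dots> = 2 * r / bd (g a)" by (simp add: r_def norm_minus_commute)
    finally have Kab: "K (g a) (g b) \<le> 2 * r / bd (g a)" .
    have "2 * r / bd (g a) \<le> 1" using near r by (simp add: r_def)
    have "b - a \<le> L * K (g a) (g b)" using lo[OF mem] ab by simp
    also have "\<dots> \<le> L * (2 * r / bd (g a))" using Kab \<open>L \<ge> 1\<close> by (intro mult_left_mono) auto
    finally have ba: "b - a \<le> L * (2 * r / bd (g a))" .
    also have "\<dots> \<le> L * 1" using \<open>2 * r / bd (g a) \<le> 1\<close> \<open>L \<ge> 1\<close> by (intro mult_left_mono) auto
    finally have baL: "b - a \<le> L" by simp
    have KL2: "K (g s) (g t) \<le> L2" if "s \<in> {a..b}" "t \<in> {a..b}" for s t
    proof -
      have "L * \<bar>s - t\<bar> \<le> L * L" using that baL \<open>L \<ge> 1\<close> by (intro mult_left_mono) auto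
      then show ?thesis using up[OF that] by (simp add: L2_def)
    qed
    have inc: "dist (g s) (g t) \<le> W * bd (g a) powr \<epsilon> * t - W * bd (g a) powr \<epsilon> * s"
      if st: "a \<le> s" "s \<le> t" "t \<le> b" for s t
    proof -
      have m: "s \<in> {a..b}" "t \<in> {a..b}" using st by auto
      have "bd (g s) \<le> exp (2 * K (g a) (g s)) * bd (g a)"
        by (rule bd_le_exp_K) (use g mem m in auto)
      also have "\<dots> \<le> exp (2 * L2) * bd (g a)" using KL2[OF mem(1) m(1)] r by (intro mult_right_mono) auto
      finally have "bd (g s) powr \<epsilon> \<le> (exp (2 * L2) * bd (g a)) powr \<epsilon>" using \<epsilon> bd_nonneg by (intro powr_mono2) auto
      also have "\<dots> = exp (2 * L2) powr \<epsilon> * bd (g a) powr \<epsilon>" by (rule powr_mult)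
      finally have 1: "bd (g s) powr \<epsilon> \<le> exp (2 * L2) powr \<epsilon> * bd (g a) powr \<epsilon>" .
      have 2: "exp (2 * K (g s) (g t)) * K (g s) (g t) \<le> exp (2 * L2) * (L * (t - s))"
        using KL2[OF m] up[OF m] st by (intro mult_mono) auto
      have "dist (g s) (g t) \<le> C * bd (g s) powr \<epsilon> * (exp (2 * K (g s) (g t)) * K (g s) (g t))"
        using nd[OF g[OF m(1)] g[OF m(2)]] by (simp add: dist_norm norm_minus_commute)
      also have "\<dots> \<le> C * (exp (2 * L2) powr \<epsilon> * bd (g a) powr \<epsilon>) * (exp (2 * L2) * (L * (t - s)))"
        by (rule mult_mono[OF mult_left_mono[OF 1] 2]) (use \<open>C > 0\<close> in auto)
      also have "\<dots> = W * bd (g a) powr \<epsilon> * t - W * bd (g a) powr \<epsilon> * s" by (simp add: W_def algebra_simps)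
      finally show ?thesis .
    qed
    show ?thesis
    proof (rule curve_length_le_of_increments[OF inc])
      have "W * bd (g a) powr \<epsilon> * b - W * bd (g a) powr \<epsilon> * a = W * bd (g a) powr \<epsilon> * (b - a)" by (simp add: algebra_simps)
      also have "\<dots> \<le> W * bd (g a) powr \<epsilon> * (L * (2 * r / bd (g a)))" using ba \<open>W > 0\<close> by (intro mult_left_mono) auto
      also have "\<dots> = W * 2 * L * (r * (bd (g a) powr \<epsilon> / bd (g a)))" by simp
      also have "r * (bd (g a) powr \<epsilon> / bd (g a)) \<le> r powr \<epsilon>"
      proof (cases "r = 0")
        case False
        then have "r > 0" by (simp add: r_def)
        have "2 * r \<le> bd (g a)" using near by (simp add: r_def)
        then have "r \<le> bd (g a)" using \<open>r > 0\<close> by linarith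
        have "bd (g a) powr \<epsilon> / bd (g a) = bd (g a) powr (\<epsilon> - 1)" using r by (simp add: powr_diff)
        also have "\<dots> \<le> r powr (\<epsilon> - 1)" using \<open>r \<le> bd (g a)\<close> \<open>r > 0\<close> \<epsilon> by (intro powr_mono2') auto
        finally have "r * (bd (g a) powr \<epsilon> / bd (g a)) \<le> r * r powr (\<epsilon> - 1)" using \<open>r > 0\<close> by (intro mult_left_mono) auto
        also have "\<dots> = r powr \<epsilon>" using \<open>r > 0\<close> by (simp add: powr_diff)
        finally show ?thesis .
      qed simp
      then have "W * 2 * L * (r * (bd (g a) powr \<epsilon> / bd (g a))) \<le> W * 2 * L * r powr \<epsilon>"
        using \<open>W > 0\<close> \<open>L \<ge> 1\<close> by (intro mult_left_mono) auto
      finally show "W * bd (g a) powr \<epsilon> * b - W * bd (g a) powr \<epsilon> * a \<le> W * 2 * L * norm (g a - g b) powr \<epsilon>"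
        by (simp add: r_def)
    qed
  qed
  have "W * 2 * L > 0" using \<open>W > 0\<close> \<open>L \<ge> 1\<close> by simp
  with main \<epsilon> show ?thesis by blast
qed

lemma gromov_product_z0_ge:
  "\<exists>k. \<forall>x\<in>\<Omega>. \<forall>y\<in>\<Omega>. x \<noteq> y \<and> bd x \<le> 2 * norm (x - y) \<longrightarrow> k - ln (norm (x - y)) / 2 \<le> gromov_product K z0 x y"
proof -
  obtain C where "C \<ge> 0" and C: "\<And>x s. \<lbrakk>x \<in> \<Omega>; 0 \<le> s; s \<le> 1\<rbrakk> \<Longrightarrow> gromov_product K (ray x s) x z0 \<le> C"
    using ray_stability by blast
  define k where "k = ln (c / (3 + dm)) / 2 - C - 1 / c - 2 * \<delta>"
  have "k - ln (norm (x - y)) / 2 \<le> gromov_product K z0 x y"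
    if x: "x \<in> \<Omega>" and y: "y \<in> \<Omega>" and xy: "x \<noteq> y \<and> bd x \<le> 2 * norm (x - y)" for x y
  proof -
    define r where "r = norm (x - y)"
    have "r > 0" using xy by (simp add: r_def)
    \<comment> \<open>A ray ends at parameter 1. After the move, balls of radius
      \<open>s * c\<close> about the whole segment fit into \<Omega> and its length is
      \<open>(1 - s) * r\<close>, so the moved points have distance at most
      \<open>1 / c\<close>.\<close>
    define s where "s = min r 1"
    have s: "0 < s" "s \<le> 1" "s \<le> r" using \<open>r > 0\<close> by (auto simp: s_def)
    have bx2: "bd x \<le> 2 * r" using xy by (simp add: r_def)
    then have bx: "bd x \<le> 3 * r" using \<open>r > 0\<close> by linarith
    have "bd y \<le> bd x + dist y x" by (rule bd_le_add_dist)
    then have by': "bd y \<le> 3 * r" using xy by (simp add: r_def dist_norm norm_minus_commute)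
    have in\<Omega>: "ray x s \<in> \<Omega>" "ray y s \<in> \<Omega>" using ray_in x y s by auto
    \<comment> \<open>\<open>bd x \<le> 2 * r\<close> implies \<open>bd y \<le> 3 * r\<close>, and
      the move adds at most \<open>r * dm\<close>; so \<open>bd\<close> is at most
      \<open>(3 + dm) * r\<close> afterwards.\<close>
    have low: "ln (c / (3 + dm)) / 2 - ln r / 2 \<le> K (ray u s) z0" if u: "u \<in> \<Omega>" "bd u \<le> 3 * r" for u
    proof -
      have us: "ray u s \<in> \<Omega>" using ray_in u s by auto
      have "bd (ray u s) \<le> bd u + norm (ray u s - ray u 0)"
        using bd_le_add_dist[of "ray u s" u] by (simp add: dist_norm)
      also have "\<dots> \<le> 3 * r + s * dm" using u norm_ray_diff[OF u(1), of s 0] s by simp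
      also have "\<dots> \<le> 3 * r + r * dm" using s dm_pos by (intro add_left_mono mult_right_mono) auto
      finally have b: "bd (ray u s) \<le> (3 + dm) * r" by (simp add: algebra_simps)
      have pos: "bd (ray u s) > 0" "(3 + dm) * r > 0" using bd_pos[OF us] dm_pos \<open>r > 0\<close> by auto
      have "c / ((3 + dm) * r) \<le> bd z0 / bd (ray u s)"
        using bd_ge[OF ball_z0] b pos c_pos by (intro frac_le) auto
      then have "ln (c / ((3 + dm) * r)) \<le> ln (bd z0 / bd (ray u s))"
        using pos c_pos bd_pos[OF z0_in] by (intro ln_mono) auto
      also have "\<dots> \<le> 2 * K (ray u s) z0" by (rule K_ge_ln_bd[OF us z0_in])
      also have "ln (c / ((3 + dm) * r)) = ln (c / (3 + dm)) - ln r"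
        using c_pos dm_pos \<open>r > 0\<close> by (simp add: ln_div ln_mult)
      finally show ?thesis by simp
    qed
    have Kxy: "K (ray x s) (ray y s) \<le> 1 / c"
    proof -
      have "K (ray x s) (ray y s) \<le> norm (ray y s - ray x s) / (s * c)"
      proof (rule K_upper_balls)
        fix p assume "p \<in> closed_segment (ray x s) (ray y s)"
        then obtain w where w: "0 \<le> w" "w \<le> 1" "p = (1 - w) *\<^sub>R ray x s + w *\<^sub>R ray y s"
          by (auto simp: in_segment)
        define u where "u = (1 - w) *\<^sub>R x + w *\<^sub>R y"
        have u: "u \<in> \<Omega>" unfolding u_def using w by (intro convexD[OF convex_domain x y]) auto
        have p: "p = ray u s" by (simp add: w(3) u_def ray_def algebra_simps)
        have "ball p ((1 - s) * bd u + s * c) \<subseteq> \<Omega>"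
          unfolding p by (rule ray_ball[OF ball_bd_subset bd_pos[OF u]]) (use s in auto)
        moreover have "s * c \<le> (1 - s) * bd u + s * c" using s bd_nonneg[of u] by simp
        ultimately show "ball p (s * c) \<subseteq> \<Omega>" by (meson order_trans subset_ball)
      qed (use in\<Omega> s c_pos in auto)
      also have "norm (ray y s - ray x s) = (1 - s) * r"
      proof -
        have "ray y s - ray x s = (1 - s) *\<^sub>R (y - x)" by (simp add: ray_def algebra_simps)
        then show ?thesis using s by (simp add: r_def norm_minus_commute)
      qed
      also have "(1 - s) * r / (s * c) \<le> 1 / c"
      proof (cases "r \<le> 1")
        case True
        then have "s = r" by (simp add: s_def)
        then show ?thesis using \<open>r > 0\<close> c_pos by (simp add: divide_right_mono)
      next
        case False
        then have "s = 1" by (simp add: s_def)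
        then show ?thesis using c_pos by simp
      qed
      finally show ?thesis .
    qed
    have lx: "ln (c / (3 + dm)) / 2 - ln r / 2 \<le> K (ray x s) z0" and ly: "ln (c / (3 + dm)) / 2 - ln r / 2 \<le> K (ray y s) z0"
      using low x y bx by' by auto
    \<comment> \<open>Hyperbolicity along the chain \<open>x\<close>, \<open>ray x s\<close>,
      \<open>ray y s\<close>, \<open>y\<close>; the three losses are \<open>C\<close>,
      \<open>1 / c\<close>, \<open>C\<close>, and the two applications cost
      \<open>2 * \<delta>\<close>.\<close>
    have "gromov_product K z0 x (ray x s) \<ge> K (ray x s) z0 - C"
      using C[OF x, of s] s commute[of z0 "ray x s"] commute[of x z0] commute[of x "ray x s"]
      unfolding gromov_product_def by (simp add: field_simps)
    moreover have "gromov_product K z0 (ray y s) y \<ge> K (ray y s) z0 - C"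
      using C[OF y, of s] s commute[of z0 "ray y s"] commute[of y z0] commute[of y "ray y s"]
      unfolding gromov_product_def by (simp add: field_simps)
    moreover have "gromov_product K z0 (ray x s) (ray y s) \<ge> K (ray x s) z0 - 1 / c"
      using Kxy triangle[OF in\<Omega> z0_in] commute[of z0 "ray y s"]
      unfolding gromov_product_def by (simp add: field_simps)
    moreover have "gromov_product K z0 x y \<ge> min (gromov_product K z0 x (ray x s)) (gromov_product K z0 (ray x s) y) - \<delta>"
      by (intro hyperbolic z0_in x y in\<Omega>)
    moreover have "gromov_product K z0 (ray x s) y \<ge> min (gromov_product K z0 (ray x s) (ray y s)) (gromov_product K z0 (ray y s) y) - \<delta>"
      by (intro hyperbolic z0_in x y in\<Omega>)
    moreover have "1 / c > 0" using c_pos by simp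
    ultimately show ?thesis
      using lx ly \<open>C \<ge> 0\<close> \<delta>_nonneg unfolding k_def r_def[symmetric] by linarith
  qed
  then show ?thesis by blast
qed

text \<open>\<open>g t0\<close> stands for the centre of the triangle with vertices
  \<open>g a\<close>, \<open>g b\<close>, \<open>z0\<close>: its distance from \<open>g a\<close> is
  the Gromov product of \<open>z0\<close> and \<open>g b\<close> at \<open>g a\<close>. By stability
  the distance from \<open>g a\<close> grows along the curve at rate at least \<open>1 / L\<close>
  up to a constant, so the curve recedes from \<open>z0\<close> on both sides of
  \<open>t0\<close>.\<close>

lemma quasi_geodesic_K_z0_ge:
  assumes "L \<ge> 1"
  shows "\<exists>C. \<forall>a b g. a \<le> b \<and> quasi_geodesic L a b g \<longrightarrow>
    (\<exists>t0. \<forall>t\<in>{a..b}. gromov_product K z0 (g a) (g b) + \<bar>t - t0\<bar> / L - C \<le> K (g t) z0)"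
proof -
  obtain C where "C \<ge> 0" and C: "\<And>a b g t. a \<le> b \<and> t \<in> {a..b} \<and> (\<forall>s\<in>{a..b}. g s \<in> \<Omega>) \<and>
      (\<forall>s\<in>{a..b}. \<forall>t\<in>{a..b}. K (g s) (g t) \<le> L * \<bar>s - t\<bar> \<and> \<bar>s - t\<bar> \<le> L * K (g s) (g t)) \<Longrightarrow>
      gromov_product K (g t) (g a) (g b) \<le> C"
    using quasi_geodesic_stability[OF assms] by blast
  have "\<exists>t0. \<forall>t\<in>{a..b}. gromov_product K z0 (g a) (g b) + \<bar>t - t0\<bar> / L - 4 * C \<le> K (g t) z0"
    if ab: "a \<le> b" and qg: "quasi_geodesic L a b g" for a b g
  proof -
    have g: "g s \<in> \<Omega>" if "s \<in> {a..b}" for s using qg that by (auto simp: quasi_geodesic_def)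
    have up: "K (g s) (g t) \<le> L * \<bar>s - t\<bar>" and lo: "\<bar>s - t\<bar> \<le> L * K (g s) (g t)"
      if "s \<in> {a..b}" "t \<in> {a..b}" for s t using qg that by (auto simp: quasi_geodesic_def)
    have mem: "a \<in> {a..b}" "b \<in> {a..b}" using ab by auto
    have stab: "K (g a) (g s) + K (g s) (g t) - K (g a) (g t) \<le> 2 * C" if st: "a \<le> s" "s \<le> t" "t \<le> b" for s t
    proof -
      have "gromov_product K (g s) (g a) (g t) \<le> C"
        by (rule C[of a t s g]) (use st g up lo in auto)
      then show ?thesis by (simp add: gromov_product_def)
    qed
    define f where "f t = K (g a) (g t)" for t
    define \<sigma> where "\<sigma> = gromov_product K (g a) z0 (g b)"
    have f_inc: "(t - s) / L - 2 * C \<le> f t - f s" if st: "a \<le> s" "s \<le> t" "t \<le> b" for s t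
    proof -
      have "t - s \<le> L * K (g s) (g t)" using lo[of s t] st by auto
      then have "(t - s) / L \<le> K (g s) (g t)" using assms by (simp add: pos_divide_le_eq mult.commute)
      then show ?thesis using stab[OF st] by (simp add: f_def)
    qed
    have "L-lipschitz_on {a..b} f"
    proof (rule lipschitz_onI)
      fix s t assume st: "s \<in> {a..b}" "t \<in> {a..b}"
      show "dist (f s) (f t) \<le> L * dist s t"
        using triangle[OF g[OF mem(1)] g[OF st(1)] g[OF st(2)]] triangle[OF g[OF mem(1)] g[OF st(2)] g[OF st(1)]]
          up[OF st] commute[of "g s" "g t"] by (simp add: f_def dist_real_def abs_le_iff)
    qed (use assms in simp)
    then have "continuous_on {a..b} f" by (rule lipschitz_on_continuous_on)
    moreover have "f a = 0" using g[OF mem(1)] by (simp add: f_def)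
    moreover have "0 \<le> \<sigma>" "\<sigma> \<le> f b"
      using triangle[OF z0_in g[OF mem(1)] g[OF mem(2)]] triangle[OF z0_in g[OF mem(2)] g[OF mem(1)]]
        triangle[OF g[OF mem(1)] z0_in g[OF mem(2)]] commute[of "g a" "g b"] commute[of "g a" z0]
      by (simp_all add: \<sigma>_def f_def gromov_product_def)
    ultimately have "\<exists>t. a \<le> t \<and> t \<le> b \<and> f t = \<sigma>" by (intro IVT') (use ab in auto)
    then obtain t0 where t0: "a \<le> t0" "t0 \<le> b" "f t0 = \<sigma>" by blast
    have "gromov_product K z0 (g a) (g b) + \<bar>t - t0\<bar> / L - 4 * C \<le> K (g t) z0" if t: "t \<in> {a..b}" for t
    proof -
      have "\<bar>t - t0\<bar> / L - 2 * C \<le> \<bar>f t - \<sigma>\<bar>"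
        using f_inc[of t t0] f_inc[of t0 t] t t0 by (cases "t \<le> t0") (auto simp: abs_if)
      \<comment> \<open>With the triangle inequalities below, \<open>K (g t) z0\<close> is at least
        the Gromov product plus \<open>\<sigma> - f t\<close>, and up to \<open>2 * C\<close> also
        plus \<open>f t - \<sigma>\<close>. The other \<open>2 * C\<close> comes from
        \<open>f_inc\<close>.\<close>
      moreover have "f t + K (g t) (g b) - K (g a) (g b) \<le> 2 * C"
        using stab[of t b] t by (simp add: f_def)
      moreover have "K (g a) z0 \<le> f t + K (g t) z0" unfolding f_def
        by (intro triangle g mem t z0_in)
      moreover have "K (g b) z0 \<le> K (g t) (g b) + K (g t) z0"
        using triangle[OF g[OF mem(2)] g[OF t] z0_in] commute[of "g b" "g t"] by simp
      ultimately show ?thesis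
        using \<open>C \<ge> 0\<close> commute[of z0 "g a"] commute[of z0 "g b"]
        unfolding \<sigma>_def gromov_product_def by (auto simp: abs_if field_simps split: if_splits)
    qed
    then show ?thesis by blast
  qed
  then show ?thesis by blast
qed

lemma curve_length_far:
  assumes "L \<ge> 1"
  shows "\<exists>C>0. \<exists>\<epsilon>>0. \<forall>a b g. a \<le> b \<and> quasi_geodesic L a b g \<and> bd (g a) \<le> 2 * norm (g a - g b) \<longrightarrow>
    curve_length a b g \<le> ennreal (C * norm (g a - g b) powr \<epsilon>)"
proof -
  obtain C0 \<epsilon> where "C0 > 0" and \<epsilon>: "\<epsilon> > 0" "\<epsilon> \<le> 1"
    and nd: "\<And>x y. \<lbrakk>x \<in> \<Omega>; y \<in> \<Omega>\<rbrakk> \<Longrightarrow> norm (y - x) \<le> C0 * bd x powr \<epsilon> * (exp (2 * K x y) * K x y)"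
    using norm_diff_le_K by blast
  obtain C4 \<kappa> where "C4 > 0" "\<kappa> > 0" and bdK: "\<And>x. x \<in> \<Omega> \<Longrightarrow> bd x \<le> C4 * exp (- \<kappa> * K x z0)"
    using bd_le_exp_K_z0 by blast
  obtain k where k: "\<And>x y. \<lbrakk>x \<in> \<Omega>; y \<in> \<Omega>; x \<noteq> y; bd x \<le> 2 * norm (x - y)\<rbrakk> \<Longrightarrow>
      k - ln (norm (x - y)) / 2 \<le> gromov_product K z0 x y"
    using gromov_product_z0_ge by blast
  obtain CM where CM: "\<And>a b g. \<lbrakk>a \<le> b; quasi_geodesic L a b g\<rbrakk> \<Longrightarrow>
    \<exists>t0. \<forall>t\<in>{a..b}. gromov_product K z0 (g a) (g b) + \<bar>t - t0\<bar> / L - CM \<le> K (g t) z0"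
    using quasi_geodesic_K_z0_ge[OF assms] by blast
  define \<mu> where "\<mu> = \<kappa> * \<epsilon> / L"
  have "\<mu> > 0" using \<open>\<kappa> > 0\<close> \<epsilon> assms by (simp add: \<mu>_def)
  define C7 where "C7 = (C4 * exp (\<kappa> * (CM - k))) powr \<epsilon>"
  define C8 where "C8 = max 1 (2 / \<mu>\<^sup>2)"
  define C9 where "C9 = C0 * C7 * C8 * (exp (2 * L) * L)"
  have "C7 > 0" "C8 > 0" using \<open>C4 > 0\<close> by (simp_all add: C7_def C8_def)
  then have "C9 > 0" using \<open>C0 > 0\<close> assms by (simp add: C9_def)
  have main: "curve_length a b g \<le> ennreal (3 * C9 * pi * norm (g a - g b) powr (\<kappa> * \<epsilon> / 2))"
    if ab: "a \<le> b" and qg: "quasi_geodesic L a b g" and far: "bd (g a) \<le> 2 * norm (g a - g b)" for a b g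
  proof -
    define r where "r = norm (g a - g b)"
    have g: "g s \<in> \<Omega>" if "s \<in> {a..b}" for s using qg that by (auto simp: quasi_geodesic_def)
    have up: "K (g s) (g t) \<le> L * \<bar>s - t\<bar>"
      if "s \<in> {a..b}" "t \<in> {a..b}" for s t using qg that by (auto simp: quasi_geodesic_def)
    have mem: "a \<in> {a..b}" "b \<in> {a..b}" using ab by auto
    have "r > 0" unfolding r_def using bd_pos[OF g[OF mem(1)]] far by linarith
    then have "g a \<noteq> g b" by (auto simp: r_def)
    then have gp: "k - ln r / 2 \<le> gromov_product K z0 (g a) (g b)"
      unfolding r_def using far g mem by (intro k) auto
    obtain t0 where t0: "\<And>t. t \<in> {a..b} \<Longrightarrow> gromov_product K z0 (g a) (g b) + \<bar>t - t0\<bar> / L - CM \<le> K (g t) z0"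
      using CM[OF ab qg] by blast
    \<comment> \<open>The exponent collects \<kappa> from the decay of \<open>bd\<close>, 1/2 from
      the bound on the Gromov product, and \<epsilon> from \<open>norm_diff_le_K\<close>.\<close>
    define p where "p = r powr (\<kappa> * \<epsilon> / 2)"
    have "p > 0" using \<open>r > 0\<close> by (simp add: p_def)
    have bd_le: "bd (g t) powr \<epsilon> \<le> C7 * C8 * p / (1 + (t - t0)\<^sup>2)" if t: "t \<in> {a..b}" for t
    proof -
      have "k - ln r / 2 + \<bar>t - t0\<bar> / L - CM \<le> K (g t) z0" using t0[OF t] gp by linarith
      then have "\<kappa> * (k - ln r / 2 + \<bar>t - t0\<bar> / L - CM) \<le> \<kappa> * K (g t) z0" using \<open>\<kappa> > 0\<close> by (intro mult_left_mono) auto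
      then have "- \<kappa> * K (g t) z0 \<le> \<kappa> * (CM - k) + \<kappa> / 2 * ln r + - (\<kappa> / L) * \<bar>t - t0\<bar>" by (simp add: algebra_simps)
      then have "exp (- \<kappa> * K (g t) z0) \<le> exp (\<kappa> * (CM - k)) * exp (\<kappa> / 2 * ln r) * exp (- (\<kappa> / L) * \<bar>t - t0\<bar>)"
        by (simp only: exp_add[symmetric] exp_le_cancel_iff)
      also have "exp (\<kappa> / 2 * ln r) = r powr (\<kappa> / 2)" using \<open>r > 0\<close> by (simp add: powr_def)
      finally have "C4 * exp (- \<kappa> * K (g t) z0) \<le> C4 * (exp (\<kappa> * (CM - k)) * r powr (\<kappa> / 2) * exp (- (\<kappa> / L) * \<bar>t - t0\<bar>))"
        using \<open>C4 > 0\<close> by (intro mult_left_mono) auto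
      then have "bd (g t) \<le> (C4 * exp (\<kappa> * (CM - k))) * r powr (\<kappa> / 2) * exp (- (\<kappa> / L) * \<bar>t - t0\<bar>)"
        using bdK[OF g[OF t]] by (simp only: mult.assoc)
      then have "bd (g t) powr \<epsilon> \<le> ((C4 * exp (\<kappa> * (CM - k))) * r powr (\<kappa> / 2) * exp (- (\<kappa> / L) * \<bar>t - t0\<bar>)) powr \<epsilon>"
        using \<epsilon> bd_nonneg by (intro powr_mono2) auto
      also have "\<dots> = C7 * (r powr (\<kappa> / 2)) powr \<epsilon> * exp (- (\<kappa> / L) * \<bar>t - t0\<bar>) powr \<epsilon>"
        unfolding C7_def using \<open>C4 > 0\<close> by (simp add: powr_mult)
      also have "(r powr (\<kappa> / 2)) powr \<epsilon> = p" by (simp add: p_def powr_powr)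
      also have "exp (- (\<kappa> / L) * \<bar>t - t0\<bar>) powr \<epsilon> = exp (- \<mu> * \<bar>t - t0\<bar>)"
        by (simp add: powr_def \<mu>_def)
      also have "C7 * p * exp (- \<mu> * \<bar>t - t0\<bar>) \<le> C7 * p * (C8 / (1 + \<bar>t - t0\<bar>\<^sup>2))"
        unfolding C8_def using \<open>C7 > 0\<close> \<open>p > 0\<close> \<open>\<mu> > 0\<close> by (intro mult_left_mono exp_minus_le_quadratic) auto
      finally show ?thesis by (simp add: mult_ac)
    qed
    \<comment> \<open>The total increase of \<open>arctan\<close> is at most \<open>pi\<close>,
      which makes the bound independent of the length of the parameter interval.\<close>
    define \<Phi> where "\<Phi> t = 3 * C9 * p * arctan (t - t0)" for t
    have inc: "dist (g s) (g t) \<le> \<Phi> t - \<Phi> s" if st: "a \<le> s" "s \<le> t" "t \<le> b" for s t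
    proof (rule local_increment_bound_imp_global[of 1 a b "\<lambda>s t. dist (g s) (g t)", OF _ _ _ st])
      show "dist (g s) (g u) \<le> dist (g s) (g t) + dist (g t) (g u)" for s t u by (rule dist_triangle)
      \<comment> \<open>Steps of length at most 1 keep \<open>K (g s) (g t)\<close> below
        \<open>L\<close>, so the exponential factor of \<open>norm_diff_le_K\<close> is bounded by
        \<open>exp (2 * L)\<close>.\<close>
      fix s t assume st: "a \<le> s" "s \<le> t" "t \<le> b" "t - s \<le> 1"
      have m: "s \<in> {a..b}" "t \<in> {a..b}" using st by auto
      have KL: "K (g s) (g t) \<le> L * (t - s)" using up[OF m] st by simp
      have "L * (t - s) \<le> L * 1" using st assms by (intro mult_left_mono) auto
      then have "K (g s) (g t) \<le> L" using KL by linarith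
      then have 2: "exp (2 * K (g s) (g t)) * K (g s) (g t) \<le> exp (2 * L) * (L * (t - s))"
        using KL by (intro mult_mono) auto
      have "C0 * bd (g s) powr \<epsilon> * (exp (2 * K (g s) (g t)) * K (g s) (g t))
          \<le> C0 * (C7 * C8 * p / (1 + (s - t0)\<^sup>2)) * (exp (2 * L) * (L * (t - s)))"
        by (rule mult_mono[OF mult_left_mono[OF bd_le[OF m(1)]] 2])
          (use \<open>C0 > 0\<close> \<open>C7 > 0\<close> \<open>C8 > 0\<close> \<open>p > 0\<close> in auto)
      also have "\<dots> = 3 * C9 * p * ((t - s) / (3 * (1 + (s - t0)\<^sup>2)))"
      proof -
        have "C0 * (C7 * C8 * p / q) * (e * (L * d)) = 3 * (C0 * C7 * C8 * (e * L)) * p * (d / (3 * q))" for q d e :: real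
          by simp
        then show ?thesis unfolding C9_def by blast
      qed
      also have "\<dots> \<le> 3 * C9 * p * (arctan (t - t0) - arctan (s - t0))"
      proof (rule mult_left_mono)
        show "(t - s) / (3 * (1 + (s - t0)\<^sup>2)) \<le> arctan (t - t0) - arctan (s - t0)"
          using arctan_increment_ge[of "s - t0" "t - t0"] st by simp
      qed (use \<open>C9 > 0\<close> \<open>p > 0\<close> in simp)
      also have "\<dots> = \<Phi> t - \<Phi> s" by (simp add: \<Phi>_def right_diff_distrib)
      finally show "dist (g s) (g t) \<le> \<Phi> t - \<Phi> s"
        using nd[OF g[OF m(1)] g[OF m(2)]] by (simp add: dist_norm norm_minus_commute)
    qed simp
    show ?thesis
    proof (rule curve_length_le_of_increments[OF inc])
      have "\<Phi> b - \<Phi> a = 3 * C9 * p * (arctan (b - t0) - arctan (a - t0))" by (simp add: \<Phi>_def right_diff_distrib)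
      also have "\<dots> \<le> 3 * C9 * p * pi"
        using \<open>C9 > 0\<close> \<open>p > 0\<close> arctan_ubound[of "b - t0"] arctan_lbound[of "a - t0"] by (intro mult_left_mono) auto
      also have "\<dots> = 3 * C9 * pi * norm (g a - g b) powr (\<kappa> * \<epsilon> / 2)" by (simp add: p_def r_def)
      finally show "\<Phi> b - \<Phi> a \<le> 3 * C9 * pi * norm (g a - g b) powr (\<kappa> * \<epsilon> / 2)" .
    qed
  qed
  have "3 * C9 * pi > 0" "\<kappa> * \<epsilon> / 2 > 0" using \<open>C9 > 0\<close> \<open>\<kappa> > 0\<close> \<epsilon> by auto
  with main show ?thesis by blast
qed

lemma powr_le_powr_of_bounded:
  fixes r :: real
  assumes "0 \<le> r" "r \<le> m" "q \<le> p"
  shows "r powr p \<le> m powr (p - q) * r powr q"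
proof -
  have "r powr p = r powr (p - q) * r powr q" by (simp add: powr_add[symmetric])
  also have "\<dots> \<le> m powr (p - q) * r powr q" using assms by (intro mult_right_mono powr_mono2) auto
  finally show ?thesis .
qed

lemma curve_length_quasi_geodesic:
  assumes "L \<ge> 1"
  shows "\<exists>C>0. \<exists>\<epsilon>>0. \<forall>a b g. a \<le> b \<and> quasi_geodesic L a b g \<longrightarrow>
    curve_length a b g \<le> ennreal (C * norm (g a - g b) powr \<epsilon>)"
proof -
  obtain C1 p1 where "C1 > 0" "p1 > 0" and 1: "\<And>a b g. \<lbrakk>a \<le> b; quasi_geodesic L a b g; 2 * norm (g a - g b) \<le> bd (g a)\<rbrakk> \<Longrightarrow>
    curve_length a b g \<le> ennreal (C1 * norm (g a - g b) powr p1)"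
    using curve_length_near[OF assms] by blast
  obtain C2 p2 where "C2 > 0" "p2 > 0" and 2: "\<And>a b g. \<lbrakk>a \<le> b; quasi_geodesic L a b g; bd (g a) \<le> 2 * norm (g a - g b)\<rbrakk> \<Longrightarrow>
    curve_length a b g \<le> ennreal (C2 * norm (g a - g b) powr p2)"
    using curve_length_far[OF assms] by blast
  define p where "p = min p1 p2"
  \<comment> \<open>Since \<open>r \<le> dm\<close>, both exponents can be lowered to
    \<open>p\<close> at the cost of a power of \<open>dm\<close>.\<close>
  define C where "C = C1 * dm powr (p1 - p) + C2 * dm powr (p2 - p)"
  have pos: "C > 0" "p > 0" using \<open>C1 > 0\<close> \<open>C2 > 0\<close> \<open>p1 > 0\<close> \<open>p2 > 0\<close> dm_pos by (auto simp: C_def p_def intro!: add_pos_pos)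
  have "curve_length a b g \<le> ennreal (C * norm (g a - g b) powr p)"
    if ab: "a \<le> b" and qg: "quasi_geodesic L a b g" for a b g
  proof -
    define r where "r = norm (g a - g b)"
    have r: "0 \<le> r" "r \<le> dm" using qg ab diam[of "g a" "g b"] by (auto simp: r_def quasi_geodesic_def)
    have le: "C' * r powr p' \<le> C * r powr p" if "C' * dm powr (p' - p) \<le> C" "p \<le> p'" "C' > 0" for C' p'
    proof -
      have "C' * r powr p' \<le> C' * (dm powr (p' - p) * r powr p)"
        using powr_le_powr_of_bounded[OF r that(2)] that(3) by (intro mult_left_mono) auto
      also have "\<dots> = C' * dm powr (p' - p) * r powr p" by simp
      also have "\<dots> \<le> C * r powr p" using that(1) by (intro mult_right_mono) auto
      finally show ?thesis .
    qed
    have "C1 * r powr p1 \<le> C * r powr p" "C2 * r powr p2 \<le> C * r powr p"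
      by (rule le; use \<open>C1 > 0\<close> \<open>C2 > 0\<close> in \<open>simp add: C_def p_def\<close>)+
    then show ?thesis
      using 1[OF ab qg] 2[OF ab qg] unfolding r_def[symmetric]
      by (cases "2 * r \<le> bd (g a)") (auto intro: order_trans ennreal_leI)
  qed
  with pos show ?thesis by blast
qed

end

theorem corollary1p4:
  fixes \<Omega> :: "(complex ^ 'n) set"
  assumes "CARD('n) \<ge> 2"
    and "open \<Omega>" and "connected \<Omega>" and "\<Omega> \<noteq> {}" and "bounded \<Omega>" and "convex \<Omega>"
    and "Dini_smooth_boundary \<Omega>"
    and "gromov_hyperbolic \<Omega> (kobayashi_dist \<Omega>)"
  shows "\<forall>L\<ge>1. \<exists>c1>0. \<exists>c2>0. \<forall>x\<in>\<Omega>. \<forall>y\<in>\<Omega>. \<forall>a b \<gamma>.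
           a \<le> b \<and> kobayashi_quasi_geodesic \<Omega> L {a..b} \<gamma> \<and> \<gamma> a = x \<and> \<gamma> b = y \<longrightarrow>
           curve_length a b \<gamma> \<le> ennreal (c1 * norm (x - y) powr c2)"
proof -
  obtain \<delta> where gh: "Metric_space \<Omega> (kobayashi_dist \<Omega>)" "geodesic_metric \<Omega> (kobayashi_dist \<Omega>)" "\<delta> \<ge> 0"
    "\<And>w x y z. \<lbrakk>w \<in> \<Omega>; x \<in> \<Omega>; y \<in> \<Omega>; z \<in> \<Omega>\<rbrakk> \<Longrightarrow> gromov_product (kobayashi_dist \<Omega>) w x y \<ge>
        min (gromov_product (kobayashi_dist \<Omega>) w x z) (gromov_product (kobayashi_dist \<Omega>) w z y) - \<delta>"
    using assms(8) unfolding gromov_hyperbolic_def by blast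
  obtain z0 where "z0 \<in> \<Omega>" using assms(4) by blast
  then obtain c where c: "c > 0" "ball z0 c \<subseteq> \<Omega>" using assms(2) by (meson open_contains_ball)
  have diam: "norm (x - y) \<le> diameter \<Omega>" if "x \<in> \<Omega>" "y \<in> \<Omega>" for x y
    using diameter_bounded_bound[OF assms(5) that] by (simp add: dist_norm)
  have "\<Omega> \<noteq> UNIV" using assms(5) not_bounded_UNIV by blast
  then have compl: "- \<Omega> \<noteq> {}" by blast
  interpret Metric_space \<Omega> "kobayashi_dist \<Omega>" by (rule gh(1))
  interpret hyperbolic_convex_domain \<Omega> \<delta> z0 c "diameter \<Omega>"
    by unfold_locales (use gh(2-4) assms(2,6) c diam compl in auto)
  show ?thesis
  proof (intro allI impI)
    fix L :: real assume "L \<ge> 1"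
    obtain C \<epsilon> where pos: "C > 0" "\<epsilon> > 0" and len: "\<And>a b \<gamma>. \<lbrakk>a \<le> b; quasi_geodesic L a b \<gamma>\<rbrakk> \<Longrightarrow>
        curve_length a b \<gamma> \<le> ennreal (C * norm (\<gamma> a - \<gamma> b) powr \<epsilon>)"
      using curve_length_quasi_geodesic[OF \<open>L \<ge> 1\<close>] by blast
    have "quasi_geodesic L a b \<gamma>" if "kobayashi_quasi_geodesic \<Omega> L {a..b} \<gamma>" for a b \<gamma>
      using that \<open>L \<ge> 1\<close> unfolding kobayashi_quasi_geodesic_def quasi_geodesic_def
      by (auto simp: image_subset_iff abs_minus_commute pos_divide_le_eq mult.commute)
    then show "\<exists>c1>0. \<exists>c2>0. \<forall>x\<in>\<Omega>. \<forall>y\<in>\<Omega>. \<forall>a b \<gamma>.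
           a \<le> b \<and> kobayashi_quasi_geodesic \<Omega> L {a..b} \<gamma> \<and> \<gamma> a = x \<and> \<gamma> b = y \<longrightarrow>
           curve_length a b \<gamma> \<le> ennreal (c1 * norm (x - y) powr c2)"
      using pos len by blast
  qed
qed

end
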